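(* Let $(t,J)$ be a placed skew shape and let $\mathcal{F}^{(t,J)}$ be the set of standard tableaux of shape $(t,J)$. Let $$\tilde H^{(t,J)}=\mathbb{C}\text{-span}\{v_w \mid w\in\mathcal{F}^{(t,J)}\},$$ the complex vector space in which the symbols $v_w$, $w\in\mathcal{F}^{(t,J)}$, form a basis. Then the following formulas make $\tilde H^{(t,J)}$ into an irreducible $\tilde H$-module: for each $w\in\mathcal{F}^{(t,J)}$, $$X^\lambda v_w=(wt)(X^\lambda)\,v_w\quad\text{for } X^\lambda\in X,$$ $$T_iv_w=(T_i)_{ww}\,v_w+\bigl(q^{-1}+(T_i)_{ww}\bigr)v_{s_iw}\quad\text{for }1\le i\le n,$$ where $$(T_i)_{ww}=\frac{q-q^{-1}}{1-(wt)(X^{-\alpha_i})},$$ and $v_{s_iw}$ is set equal to $0$ if $s_iw\notin\mathcal{F}^{(t,J)}$.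
   Context: **Affine Hecke algebra.** $R$ is a reduced irreducible root system in $\mathbb{R}^n$ (of rank $n$), with positive roots $R^+$ (write $\alpha>0$ for $\alpha\in R^+$ and $\alpha<0$ for $-\alpha\in R^+$), simple roots $\alpha_1,\dots,\alpha_n$, Weyl group $W$ and simple reflections $s_1,\dots,s_n$; for $i\neq j$, $m_{ij}$ is the order of $s_is_j$ in $W$. Fix $q\in\mathbb{C}^*$, not a root of unity. The fundamental weights $\omega_i$ satisfy $\langle\omega_i,\alpha_j^\vee\rangle=\delta_{ij}$, where $\alpha_j^\vee=2\alpha_j/\langle\alpha_j,\alpha_j\rangle$, and $P=\sum_i\mathbb{Z}\omega_i$ is the weight lattice. $X=\{X^\lambda\mid\lambda\in P\}$ is $P$ written multiplicatively: $X^\lambda X^\mu=X^{\lambda+\mu}$; $\mathbb{C}[X]$ is its group algebra. $\tilde H$ is the associative unital $\mathbb{C}$-algebra generated by $T_1,\dots,T_n$ and $X^\lambda$ ($\lambda\in P$) with relations: $T_i^2=(q-q^{-1})T_i+1$; $T_iT_jT_i\cdots=T_jT_iT_j\cdots$ ($m_{ij}$ factors on each side, $i\ne j$); $X^\lambda X^\mu=X^{\lambda+\mu}$, $X^0=1$; and $$X^\lambda T_i=T_iX^{s_i\lambda}+(q-q^{-1})\frac{X^\lambda-X^{s_i\lambda}}{1-X^{-\alpha_i}}.$$ With $T_w=T_{i_1}\cdots T_{i_p}$ for a reduced expression $w=s_{i_1}\cdots s_{i_p}$, the elements $T_wX^\lambda$ ($w\in W$, $\lambda\in P$) form a basis of $\tilde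 H$. **Weights.** $T=\{\text{group homomorphisms }t:X\to\mathbb{C}^*\}$, with $W$-action $(wt)(X^\lambda)=t(X^{w^{-1}\lambda})$. **Placed shapes and standard tableaux.** For $t\in T$ put $Z(t)=\{\alpha>0\mid t(X^\alpha)=1\}$ and $P(t)=\{\alpha>0\mid t(X^\alpha)=q^{2}\text{ or }q^{-2}\}$. For $w\in W$ let $R(w)=\{\alpha>0\mid w\alpha<0\}$. For $J\subseteq P(t)$ let $$\mathcal{F}^{(t,J)}=\{w\in W\mid R(w)\cap Z(t)=\emptyset,\ R(w)\cap P(t)=J\}.$$ A *placed shape* is a pair $(t,J)$ with $t\in T$, $J\subseteq P(t)$ and $\mathcal{F}^{(t,J)}\neq\emptyset$; the elements of $\mathcal{F}^{(t,J)}$ are the *standard tableaux* of shape $(t,J)$. **Placed skew shapes.** For simple roots $\alpha_i,\alpha_j$ ($i\ne j$) let $R_{ij}$ be the rank two root subsystem of $R$ generated by $\alpha_i,\alpha_j$ and $W_{ij}=\langle s_i,s_j\rangle$ its Weyl group. A weight $t\in T$ is *calibratable* for $R_{ij}$ if one of the following holds: (a) $t(X^\alpha)\neq1$ for all $\alpha\in R_{ij}$; (b) $R_{ij}$ is of type $C_2$ or $G_2$ and, naming the two simple roots so that $\alpha_i$ is long and $\alpha_j$ is short, there is $u\in W_{ij}$ with $(ut)(X^{\alpha_i})=q^2$ and $(ut)(X^{\alpha_j})=1$, and moreover $t(X^{\alpha_i})\ne1$ and $t(X^{\alpha_j})\neq1$. A *placed skew shape* is a placed shape $(t,J)$ such that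 for all $w\in\mathcal{F}^{(t,J)}$ and all pairs $\alpha_i,\alpha_j$ of distinct simple roots the weight $wt$ is calibratable for $R_{ij}$; when $n=1$ the requirement is that $(wt)(X^{\alpha_1})\ne1$ for all $w\in\mathcal{F}^{(t,J)}$. *)

theory Defs
  imports "HOL-Analysis.Analysis" "HOL-Algebra.QuotRing" "HOL-Algebra.Module"
    "HOL-Library.Poly_Mapping"
begin

section \<open>Root systems and Weyl groups\<close>

definition copair :: "real ^ 'n \<Rightarrow> real ^ 'n \<Rightarrow> real"
  where "copair x \<beta> = 2 * (x \<bullet> \<beta>) / (\<beta> \<bullet> \<beta>)"  \<comment> \<open>the pairing of \<open>x\<close> with the coroot of \<open>\<beta>\<close>\<close>

definition refl_at :: "real ^ 'n \<Rightarrow> real ^ 'n \<Rightarrow> real ^ 'n"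
  where "refl_at \<beta> x = x - copair x \<beta> *\<^sub>R \<beta>"

definition root_system :: "(real ^ 'n) set \<Rightarrow> bool"
  where "root_system R \<longleftrightarrow>
    finite R \<and> 0 \<notin> R \<and> span R = UNIV \<and>
    (\<forall>\<beta>\<in>R. refl_at \<beta> ` R \<subseteq> R) \<and>
    (\<forall>\<beta>\<in>R. \<forall>\<gamma>\<in>R. copair \<gamma> \<beta> \<in> \<int>)"

definition reduced_root_system :: "(real ^ 'n) set \<Rightarrow> bool"
  where "reduced_root_system R \<longleftrightarrow>
    root_system R \<and> (\<forall>\<beta>\<in>R. \<forall>c. c *\<^sub>R \<beta> \<in> R \<longrightarrow> c = 1 \<or> c = -1)"

definition irreducible_root_system :: "(real ^ 'n) set \<Rightarrow> bool"
  where "irreducible_root_system R \<longleftrightarrow>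
    root_system R \<and>
    \<not> (\<exists>A B. A \<noteq> {} \<and> B \<noteq> {} \<and> A \<union> B = R \<and> (\<forall>a\<in>A. \<forall>b\<in>B. a \<bullet> b = 0))"

text \<open>Since \<open>R\<close> has rank \<open>n\<close>, the index type \<open>'n\<close> of the coordinates of \<open>\<real>\<^sup>n\<close> also serves as
  the index set of the simple roots.\<close>

definition pos_roots :: "(real ^ 'n) set \<Rightarrow> ('n \<Rightarrow> real ^ 'n) \<Rightarrow> (real ^ 'n) set"
  where "pos_roots R \<alpha> = {\<beta> \<in> R. \<exists>c :: 'n \<Rightarrow> nat. \<beta> = (\<Sum>i\<in>UNIV. real (c i) *\<^sub>R \<alpha> i)}"

definition simple_roots :: "(real ^ 'n) set \<Rightarrow> ('n \<Rightarrow> real ^ 'n) \<Rightarrow> bool"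
  where "simple_roots R \<alpha> \<longleftrightarrow>
    range \<alpha> \<subseteq> R \<and> inj \<alpha> \<and> independent (range \<alpha>) \<and>
    (\<forall>\<beta>\<in>R. \<beta> \<in> pos_roots R \<alpha> \<or> - \<beta> \<in> pos_roots R \<alpha>)"

text \<open>As reflections are involutions, the monoid they generate under composition is a group.\<close>

inductive_set refl_group :: "(real ^ 'n) set \<Rightarrow> (real ^ 'n \<Rightarrow> real ^ 'n) set"
  for S :: "(real ^ 'n) set" where
  id: "id \<in> refl_group S"
| refl: "\<beta> \<in> S \<Longrightarrow> w \<in> refl_group S \<Longrightarrow> refl_at \<beta> \<circ> w \<in> refl_group S"

abbreviation simple_refl :: "('n \<Rightarrow> real ^ 'n) \<Rightarrow> 'n \<Rightarrow> real ^ 'n \<Rightarrow> real ^ 'n"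
  where "simple_refl \<alpha> i \<equiv> refl_at (\<alpha> i)"

definition coxeter_m :: "('n \<Rightarrow> real ^ 'n) \<Rightarrow> 'n \<Rightarrow> 'n \<Rightarrow> nat"
  where "coxeter_m \<alpha> i j =
    (LEAST m. 0 < m \<and> (simple_refl \<alpha> i \<circ> simple_refl \<alpha> j) ^^ m = id)"

definition inversions ::
    "(real ^ 'n) set \<Rightarrow> ('n \<Rightarrow> real ^ 'n) \<Rightarrow> (real ^ 'n \<Rightarrow> real ^ 'n) \<Rightarrow> (real ^ 'n) set"
  where "inversions R \<alpha> w = {\<beta> \<in> pos_roots R \<alpha>. - w \<beta> \<in> pos_roots R \<alpha>}"

definition fund_weight :: "('n \<Rightarrow> real ^ 'n) \<Rightarrow> 'n \<Rightarrow> real ^ 'n"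
  where "fund_weight \<alpha> i = (THE \<omega>. \<forall>j. copair \<omega> (\<alpha> j) = (if i = j then 1 else 0))"

definition weight_lattice :: "('n \<Rightarrow> real ^ 'n) \<Rightarrow> (real ^ 'n) set"
  where "weight_lattice \<alpha> =
    {\<nu>. \<exists>c :: 'n \<Rightarrow> int. \<nu> = (\<Sum>i\<in>UNIV. real_of_int (c i) *\<^sub>R fund_weight \<alpha> i)}"


section \<open>Free algebras and the affine Hecke algebra\<close>

text \<open>The free monoid, written additively so that \<open>'g free_monoid \<Rightarrow>\<^sub>0 complex\<close> carries the
  convolution product of \<^theory>\<open>HOL-Library.Poly_Mapping\<close>; this is the free unital
  associative \<open>\<complex>\<close>-algebra on \<open>'g\<close>.\<close>

datatype 'g free_monoid = Word (letters: "'g list")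

instantiation free_monoid :: (type) monoid_add
begin

definition "0 = Word []"

definition "u + v = Word (letters u @ letters v)"

instance
  by standard (simp_all add: zero_free_monoid_def plus_free_monoid_def)

end

definition free_algebra :: "'g set \<Rightarrow> ('g free_monoid \<Rightarrow>\<^sub>0 complex) ring"
  where "free_algebra A =
    \<lparr>carrier = {f. \<forall>u\<in>Poly_Mapping.keys f. set (letters u) \<subseteq> A},
     mult = (*), one = 1, zero = 0, add = (+)\<rparr>"

definition word :: "'g list \<Rightarrow> ('g free_monoid \<Rightarrow>\<^sub>0 complex)"
  where "word gs = Poly_Mapping.single (Word gs) 1"

definition scalar :: "complex \<Rightarrow> ('g free_monoid \<Rightarrow>\<^sub>0 complex)"
  where "scalar c = Poly_Mapping.single 0 c"

datatype 'n hecke_gen = Tgen 'n | Xgen "real ^ 'n"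

definition hecke_gens :: "('n \<Rightarrow> real ^ 'n) \<Rightarrow> 'n hecke_gen set"
  where "hecke_gens \<alpha> = range Tgen \<union> Xgen ` weight_lattice \<alpha>"

text \<open>The group algebra \<open>\<complex>[X]\<close> consists of the \<open>p :: real ^ 'n \<Rightarrow>\<^sub>0 complex\<close> with keys in the weight
  lattice, where \<open>X\<^sup>\<mu>\<close> is \<open>Poly_Mapping.single \<mu> 1\<close>. The quotient
  \<open>(X\<^sup>\<nu> - X\<^bsup>s\<^sub>i\<nu>\<^esup>) / (1 - X\<^bsup>-\<alpha>\<^sub>i\<^esup>)\<close> is the unique element of \<open>\<complex>[X]\<close> whose product with the
  denominator is the numerator (existence and uniqueness are shown in
  \<open>ex1_demazure_quotient\<close> below).\<close>

definition demazure_quotient ::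
    "('n \<Rightarrow> real ^ 'n) \<Rightarrow> 'n \<Rightarrow> real ^ 'n \<Rightarrow> (real ^ 'n \<Rightarrow>\<^sub>0 complex) \<Rightarrow> bool"
  where "demazure_quotient \<alpha> i \<nu> p \<longleftrightarrow>
    Poly_Mapping.keys p \<subseteq> weight_lattice \<alpha> \<and>
    p * (1 - Poly_Mapping.single (- \<alpha> i) 1)
      = Poly_Mapping.single \<nu> 1 - Poly_Mapping.single (simple_refl \<alpha> i \<nu>) 1"

lemma copair_zero_on_simple:
  fixes \<alpha> :: "'n \<Rightarrow> real ^ 'n"
  assumes "simple_roots R \<alpha>" "\<And>j. copair x (\<alpha> j) = 0"
  shows "x = 0"
proof -
  have ind: "independent (range \<alpha>)" and inj: "inj \<alpha>"
    using assms by (auto simp: simple_roots_def)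
  have "card (range \<alpha>) = DIM(real ^ 'n)"
    using inj by (simp add: card_image)
  then have sp: "span (range \<alpha>) = UNIV"
    using ind by (metis (no_types, lifting) card_eq_dim dim_UNIV top.extremum
        dim_eq_full dim_eq_card_independent)
  have "x \<bullet> \<alpha> j = 0" for j
    using assms(2)[of j] by (auto simp: copair_def)
  then have "\<forall>y\<in>range \<alpha>. orthogonal x y"
    by (auto simp: orthogonal_def)
  then have "orthogonal x x"
    using sp orthogonal_to_span by blast
  then show ?thesis
    by (simp add: orthogonal_self)
qed

lemma linear_copair: "linear (\<lambda>x. copair x \<beta>)"
  by (rule linearI) (simp_all add: copair_def inner_add_left algebra_simps add_divide_distrib)

lemmas copair_linear = linear_add[OF linear_copair] linear_cmul[OF linear_copair]
  linear_diff[OF linear_copair] linear_sum[OF linear_copair]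

lemma copair_fund_weight:
  fixes \<alpha> :: "'n \<Rightarrow> real ^ 'n"
  assumes "simple_roots R \<alpha>"
  shows "copair (fund_weight \<alpha> i) (\<alpha> j) = (if i = j then 1 else 0)"
proof -
  define f where "f = (\<lambda>x. \<chi> j. copair x (\<alpha> j))"
  have lin: "linear f"
    by (auto intro!: linearI simp: f_def vec_eq_iff copair_linear)
  have "inj f"
    unfolding linear_injective_0[OF lin]
    using copair_zero_on_simple[OF assms] by (auto simp: f_def vec_eq_iff)
  then have "surj f"
    using lin linear_injective_imp_surjective by blast
  then obtain \<omega> where "f \<omega> = (\<chi> j. if i = j then 1 else 0)"
    by (metis surjD)
  then have \<omega>: "\<forall>j. copair \<omega> (\<alpha> j) = (if i = j then 1 else 0)"
    by (simp add: f_def vec_eq_iff)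
  have "\<omega>' = \<omega>" if "\<forall>j. copair \<omega>' (\<alpha> j) = (if i = j then 1 else 0)" for \<omega>'
    using injD[OF \<open>inj f\<close>, of \<omega>' \<omega>] that \<omega> by (simp add: f_def)
  then have "\<forall>j. copair (fund_weight \<alpha> i) (\<alpha> j) = (if i = j then 1 else 0)"
    unfolding fund_weight_def using \<omega> by (rule theI[rotated])
  then show ?thesis by blast
qed

lemma weight_lattice_iff:
  fixes \<alpha> :: "'n \<Rightarrow> real ^ 'n"
  assumes "simple_roots R \<alpha>"
  shows "\<nu> \<in> weight_lattice \<alpha> \<longleftrightarrow> (\<forall>j. copair \<nu> (\<alpha> j) \<in> \<int>)"
proof -
  have c: "copair (\<Sum>i\<in>UNIV. c i *\<^sub>R fund_weight \<alpha> i) (\<alpha> j) = c j" for c :: "'n \<Rightarrow> real" and j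
    by (simp add: copair_linear copair_fund_weight[OF assms] if_distrib cong: if_cong)
  show ?thesis
  proof
    assume "\<nu> \<in> weight_lattice \<alpha>"
    then show "\<forall>j. copair \<nu> (\<alpha> j) \<in> \<int>"
      by (auto simp: weight_lattice_def c)
  next
    assume "\<forall>j. copair \<nu> (\<alpha> j) \<in> \<int>"
    then have "\<forall>j. \<exists>k. copair \<nu> (\<alpha> j) = real_of_int k"
      by (auto elim: Ints_cases)
    then obtain k :: "'n \<Rightarrow> int" where k: "\<And>j. copair \<nu> (\<alpha> j) = real_of_int (k j)"
      by metis
    let ?y = "\<Sum>i\<in>UNIV. real_of_int (k i) *\<^sub>R fund_weight \<alpha> i"
    have "copair (\<nu> - ?y) (\<alpha> j) = 0" for j
      using c[of "\<lambda>i. real_of_int (k i)" j] k[of j]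
      by (simp add: copair_linear)
    then have "\<nu> = ?y"
      using copair_zero_on_simple[OF assms, of "\<nu> - ?y"] by simp
    then show "\<nu> \<in> weight_lattice \<alpha>"
      unfolding weight_lattice_def by blast
  qed
qed

lemma ex1_demazure_quotient:
  fixes \<alpha> :: "'n \<Rightarrow> real ^ 'n"
  assumes R: "root_system R" and \<alpha>: "simple_roots R \<alpha>" and \<nu>: "\<nu> \<in> weight_lattice \<alpha>"
  shows "\<exists>!p. demazure_quotient \<alpha> i \<nu> p"
proof -
  let ?X = "\<lambda>\<mu>. Poly_Mapping.single \<mu> (1 :: complex)"
  let ?d = "1 - ?X (- \<alpha> i)"
  have \<alpha>R: "\<alpha> j \<in> R" for j
    using \<alpha> by (auto simp: simple_roots_def)
  then have "\<alpha> i \<noteq> 0"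
    using R unfolding root_system_def by metis
  have mem: "\<nu> + of_int m *\<^sub>R \<alpha> i \<in> weight_lattice \<alpha>" for m
  proof -
    have "copair (\<alpha> i) (\<alpha> j) \<in> \<int>" and "copair \<nu> (\<alpha> j) \<in> \<int>" for j
      using R \<alpha>R \<nu> weight_lattice_iff[OF \<alpha>] by (auto simp: root_system_def)
    then show ?thesis
      unfolding weight_lattice_iff[OF \<alpha>]
      by (auto simp: copair_linear)
  qed
  obtain k where k: "copair \<nu> (\<alpha> i) = real_of_int k"
    using \<nu> weight_lattice_iff[OF \<alpha>] by (metis Ints_cases)
  have tel: "(\<Sum>m<n. ?X (\<mu> - of_nat m *\<^sub>R \<alpha> i)) * ?d = ?X \<mu> - ?X (\<mu> - of_nat n *\<^sub>R \<alpha> i)"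
    for n :: nat and \<mu>
  proof (induction n)
    case (Suc n)
    have "?X (\<mu> - of_nat n *\<^sub>R \<alpha> i) * ?d
        = ?X (\<mu> - of_nat n *\<^sub>R \<alpha> i) - ?X (\<mu> - of_nat (Suc n) *\<^sub>R \<alpha> i)"
      by (simp add: right_diff_distrib mult_single algebra_simps)
    with Suc show ?case
      by (simp add: distrib_right)
  qed simp
  have s: "simple_refl \<alpha> i \<nu> = \<nu> + of_int (- k) *\<^sub>R \<alpha> i"
    by (simp add: refl_at_def k)
  have ex: "\<exists>p. demazure_quotient \<alpha> i \<nu> p"
  proof (cases "k \<ge> 0")
    case True
    define p where "p = (\<Sum>m<nat k. ?X (\<nu> - of_nat m *\<^sub>R \<alpha> i))"
    have "p * ?d = ?X \<nu> - ?X (simple_refl \<alpha> i \<nu>)"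
      using tel[of \<nu> "nat k"] True by (simp add: p_def s)
    moreover have "Poly_Mapping.keys p \<subseteq> (\<Union>m<nat k. {\<nu> - of_nat m *\<^sub>R \<alpha> i})"
      unfolding p_def by (rule order_trans[OF keys_sum]) auto
    moreover have "\<nu> - of_nat m *\<^sub>R \<alpha> i \<in> weight_lattice \<alpha>" for m :: nat
      using mem[of "- int m"] by simp
    ultimately show ?thesis
      unfolding demazure_quotient_def by blast
  next
    case False
    let ?\<mu> = "simple_refl \<alpha> i \<nu>"
    define p where "p = - (\<Sum>m<nat (- k). ?X (?\<mu> - of_nat m *\<^sub>R \<alpha> i))"
    have [simp]: "Poly_Mapping.keys (- r) = Poly_Mapping.keys r" for r :: "real ^ 'n \<Rightarrow>\<^sub>0 complex"
      by (auto simp: in_keys_iff)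
    have "p * ?d = ?X \<nu> - ?X ?\<mu>"
      using tel[of ?\<mu> "nat (- k)"] False by (simp add: p_def s)
    moreover have "Poly_Mapping.keys p \<subseteq> (\<Union>m<nat (- k). {?\<mu> - of_nat m *\<^sub>R \<alpha> i})"
      using keys_sum[of "\<lambda>m. ?X (?\<mu> - of_nat m *\<^sub>R \<alpha> i)" "{..<nat (- k)}"] by (auto simp: p_def)
    moreover have "?\<mu> - of_nat m *\<^sub>R \<alpha> i \<in> weight_lattice \<alpha>" for m :: nat
      using mem[of "- k - int m"] by (simp add: s algebra_simps)
    ultimately show ?thesis
      unfolding demazure_quotient_def by blast
  qed
  have un: "r = 0" if "r * ?d = 0" for r :: "real ^ 'n \<Rightarrow>\<^sub>0 complex"
  proof (rule ccontr)
    assume "r \<noteq> 0"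
    have rX: "r = r * ?X (- \<alpha> i)"
      using that by (simp add: right_diff_distrib)
    have "\<exists>\<mu>'\<in>Poly_Mapping.keys r. \<mu> = \<mu>' - \<alpha> i" if "\<mu> \<in> Poly_Mapping.keys r" for \<mu>
    proof -
      have "\<mu> \<in> Poly_Mapping.keys (r * ?X (- \<alpha> i))"
        using that rX by simp
      then show ?thesis
        using keys_mult[of r "?X (- \<alpha> i)"] by force
    qed
    then have step: "\<mu> + \<alpha> i \<in> Poly_Mapping.keys r" if "\<mu> \<in> Poly_Mapping.keys r" for \<mu>
      using that by force
    obtain \<mu> where \<mu>: "\<mu> \<in> Poly_Mapping.keys r"
      using \<open>r \<noteq> 0\<close> by fastforce
    have "\<mu> + of_nat m *\<^sub>R \<alpha> i \<in> Poly_Mapping.keys r" for m :: nat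
    proof (induction m)
      case (Suc m)
      from step[OF this] show ?case
        by (simp add: algebra_simps)
    qed (use \<mu> in simp)
    moreover have "inj (\<lambda>m :: nat. \<mu> + of_nat m *\<^sub>R \<alpha> i)"
      using \<open>\<alpha> i \<noteq> 0\<close> by (auto intro!: injI)
    ultimately have "infinite (Poly_Mapping.keys r)"
      by (meson finite_subset image_subsetI range_inj_infinite)
    then show False by simp
  qed
  have "p = p'" if "demazure_quotient \<alpha> i \<nu> p" "demazure_quotient \<alpha> i \<nu> p'" for p p'
  proof -
    have "(p - p') * ?d = 0"
      using that by (simp add: demazure_quotient_def left_diff_distrib)
    then have "p - p' = 0" by (rule un)
    then show ?thesis by simp
  qed
  with ex show ?thesis by blast
qed

definition lift_X :: "(real ^ 'n \<Rightarrow>\<^sub>0 complex) \<Rightarrow> ('n hecke_gen free_monoid \<Rightarrow>\<^sub>0 complex)"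
  where "lift_X p =
    (\<Sum>\<mu>\<in>Poly_Mapping.keys p. scalar (Poly_Mapping.lookup p \<mu>) * word [Xgen \<mu>])"

fun alternating :: "nat \<Rightarrow> 'a \<Rightarrow> 'a \<Rightarrow> 'a list"
  where
    "alternating 0 a b = []"
  | "alternating (Suc m) a b = a # alternating m b a"

text \<open>A relation \<open>x = y\<close> is recorded as the element \<open>x - y\<close> of the free algebra.\<close>

inductive_set hecke_relations ::
    "('n \<Rightarrow> real ^ 'n) \<Rightarrow> complex \<Rightarrow> ('n hecke_gen free_monoid \<Rightarrow>\<^sub>0 complex) set"
  for \<alpha> :: "'n \<Rightarrow> real ^ 'n" and q :: complex where
  quadratic:
    "word [Tgen i, Tgen i] - (scalar (q - inverse q) * word [Tgen i] + 1) \<in> hecke_relations \<alpha> q"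
| braid:
    "i \<noteq> j \<Longrightarrow>
      word (alternating (coxeter_m \<alpha> i j) (Tgen i) (Tgen j))
        - word (alternating (coxeter_m \<alpha> i j) (Tgen j) (Tgen i)) \<in> hecke_relations \<alpha> q"
| X_mult:
    "\<nu> \<in> weight_lattice \<alpha> \<Longrightarrow> \<mu> \<in> weight_lattice \<alpha> \<Longrightarrow>
      word [Xgen \<nu>, Xgen \<mu>] - word [Xgen (\<nu> + \<mu>)] \<in> hecke_relations \<alpha> q"
| X_one:
    "word [Xgen 0] - 1 \<in> hecke_relations \<alpha> q"
| X_T:
    "\<nu> \<in> weight_lattice \<alpha> \<Longrightarrow> demazure_quotient \<alpha> i \<nu> p \<Longrightarrow>
      word [Xgen \<nu>, Tgen i]
        - (word [Tgen i, Xgen (simple_refl \<alpha> i \<nu>)] + scalar (q - inverse q) * lift_X p)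
        \<in> hecke_relations \<alpha> q"

definition hecke_ideal ::
    "('n \<Rightarrow> real ^ 'n) \<Rightarrow> complex \<Rightarrow> ('n hecke_gen free_monoid \<Rightarrow>\<^sub>0 complex) set"
  where "hecke_ideal \<alpha> q = Idl\<^bsub>free_algebra (hecke_gens \<alpha>)\<^esub> (hecke_relations \<alpha> q)"

definition affine_hecke ::
    "('n \<Rightarrow> real ^ 'n) \<Rightarrow> complex \<Rightarrow> ('n hecke_gen free_monoid \<Rightarrow>\<^sub>0 complex) set ring"
  where "affine_hecke \<alpha> q = free_algebra (hecke_gens \<alpha>) Quot hecke_ideal \<alpha> q"

definition hecke_class :: "('n \<Rightarrow> real ^ 'n) \<Rightarrow> complex \<Rightarrow>
    ('n hecke_gen free_monoid \<Rightarrow>\<^sub>0 complex) \<Rightarrow> ('n hecke_gen free_monoid \<Rightarrow>\<^sub>0 complex) set"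
  where "hecke_class \<alpha> q x = hecke_ideal \<alpha> q +>\<^bsub>free_algebra (hecke_gens \<alpha>)\<^esub> x"

abbreviation hecke_T :: "('n \<Rightarrow> real ^ 'n) \<Rightarrow> complex \<Rightarrow> 'n \<Rightarrow>
    ('n hecke_gen free_monoid \<Rightarrow>\<^sub>0 complex) set"
  where "hecke_T \<alpha> q i \<equiv> hecke_class \<alpha> q (word [Tgen i])"

abbreviation hecke_X :: "('n \<Rightarrow> real ^ 'n) \<Rightarrow> complex \<Rightarrow> real ^ 'n \<Rightarrow>
    ('n hecke_gen free_monoid \<Rightarrow>\<^sub>0 complex) set"
  where "hecke_X \<alpha> q \<nu> \<equiv> hecke_class \<alpha> q (word [Xgen \<nu>])"

abbreviation hecke_scalar :: "('n \<Rightarrow> real ^ 'n) \<Rightarrow> complex \<Rightarrow> complex \<Rightarrow>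
    ('n hecke_gen free_monoid \<Rightarrow>\<^sub>0 complex) set"
  where "hecke_scalar \<alpha> q c \<equiv> hecke_class \<alpha> q (scalar c)"


section \<open>Modules over a noncommutative ring\<close>

text \<open>The library's locale \<^locale>\<open>module\<close> requires a commutative ring of scalars, which the affine
  Hecke algebra is not. Its remaining axioms are those of a left module.\<close>

definition left_module :: "('a, 'c) ring_scheme \<Rightarrow> ('a, 'b, 'd) module_scheme \<Rightarrow> bool"
  where "left_module H M \<longleftrightarrow> ring H \<and> abelian_group M \<and> module_axioms H M"

definition irreducible_module :: "('a, 'c) ring_scheme \<Rightarrow> ('a, 'b, 'd) module_scheme \<Rightarrow> bool"
  where "irreducible_module H M \<longleftrightarrow>
    left_module H M \<and> carrier M \<noteq> {\<zero>\<^bsub>M\<^esub>} \<and>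
    (\<forall>N. submodule N H M \<longrightarrow> N = {\<zero>\<^bsub>M\<^esub>} \<or> N = carrier M)"


section \<open>Weights, placed shapes and standard tableaux\<close>

text \<open>The group \<open>X\<close> is the weight lattice written multiplicatively, so \<open>t(X\<^sup>\<nu>)\<close> is rendered as
  \<open>t \<nu>\<close>. The values of \<open>t\<close> off the weight lattice are never used.\<close>

definition weight_char :: "('n \<Rightarrow> real ^ 'n) \<Rightarrow> (real ^ 'n \<Rightarrow> complex) \<Rightarrow> bool"
  where "weight_char \<alpha> t \<longleftrightarrow>
    (\<forall>\<mu>\<in>weight_lattice \<alpha>. t \<mu> \<noteq> 0) \<and>
    (\<forall>\<mu>\<in>weight_lattice \<alpha>. \<forall>\<nu>\<in>weight_lattice \<alpha>. t (\<mu> + \<nu>) = t \<mu> * t \<nu>)"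

definition weyl_act ::
    "(real ^ 'n \<Rightarrow> real ^ 'n) \<Rightarrow> (real ^ 'n \<Rightarrow> complex) \<Rightarrow> real ^ 'n \<Rightarrow> complex"
  where "weyl_act w t \<nu> = t (inv_into UNIV w \<nu>)"

definition Z_set ::
    "(real ^ 'n) set \<Rightarrow> ('n \<Rightarrow> real ^ 'n) \<Rightarrow> (real ^ 'n \<Rightarrow> complex) \<Rightarrow> (real ^ 'n) set"
  where "Z_set R \<alpha> t = {\<beta> \<in> pos_roots R \<alpha>. t \<beta> = 1}"

definition P_set :: "(real ^ 'n) set \<Rightarrow> ('n \<Rightarrow> real ^ 'n) \<Rightarrow> complex \<Rightarrow>
    (real ^ 'n \<Rightarrow> complex) \<Rightarrow> (real ^ 'n) set"
  where "P_set R \<alpha> q t = {\<beta> \<in> pos_roots R \<alpha>. t \<beta> = q ^ 2 \<or> t \<beta> = inverse (q ^ 2)}"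

definition std_tableaux :: "(real ^ 'n) set \<Rightarrow> ('n \<Rightarrow> real ^ 'n) \<Rightarrow> complex \<Rightarrow>
    (real ^ 'n \<Rightarrow> complex) \<Rightarrow> (real ^ 'n) set \<Rightarrow> (real ^ 'n \<Rightarrow> real ^ 'n) set"
  where "std_tableaux R \<alpha> q t J =
    {w \<in> refl_group R. inversions R \<alpha> w \<inter> Z_set R \<alpha> t = {} \<and>
                       inversions R \<alpha> w \<inter> P_set R \<alpha> q t = J}"

definition placed_shape :: "(real ^ 'n) set \<Rightarrow> ('n \<Rightarrow> real ^ 'n) \<Rightarrow> complex \<Rightarrow>
    (real ^ 'n \<Rightarrow> complex) \<Rightarrow> (real ^ 'n) set \<Rightarrow> bool"
  where "placed_shape R \<alpha> q t J \<longleftrightarrow>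
    weight_char \<alpha> t \<and> J \<subseteq> P_set R \<alpha> q t \<and> std_tableaux R \<alpha> q t J \<noteq> {}"

definition rank2_roots :: "('n \<Rightarrow> real ^ 'n) \<Rightarrow> 'n \<Rightarrow> 'n \<Rightarrow> (real ^ 'n) set"
  where "rank2_roots \<alpha> i j = (\<Union>u\<in>refl_group {\<alpha> i, \<alpha> j}. u ` {\<alpha> i, \<alpha> j})"

text \<open>Cartan matrix of type \<open>C\<^sub>2\<close> or \<open>G\<^sub>2\<close>, with \<open>\<alpha> i\<close> the long and \<open>\<alpha> j\<close> the short simple root.\<close>

definition C2_G2_long_short :: "('n \<Rightarrow> real ^ 'n) \<Rightarrow> 'n \<Rightarrow> 'n \<Rightarrow> bool"
  where "C2_G2_long_short \<alpha> i j \<longleftrightarrow>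
    copair (\<alpha> j) (\<alpha> i) = -1 \<and> (copair (\<alpha> i) (\<alpha> j) = -2 \<or> copair (\<alpha> i) (\<alpha> j) = -3)"

definition calibratable_special ::
    "('n \<Rightarrow> real ^ 'n) \<Rightarrow> complex \<Rightarrow> (real ^ 'n \<Rightarrow> complex) \<Rightarrow> 'n \<Rightarrow> 'n \<Rightarrow> bool"
  where "calibratable_special \<alpha> q t i j \<longleftrightarrow>
    C2_G2_long_short \<alpha> i j \<and>
    (\<exists>u\<in>refl_group {\<alpha> i, \<alpha> j}. weyl_act u t (\<alpha> i) = q ^ 2 \<and> weyl_act u t (\<alpha> j) = 1) \<and>
    t (\<alpha> i) \<noteq> 1 \<and> t (\<alpha> j) \<noteq> 1"

definition calibratable ::
    "('n \<Rightarrow> real ^ 'n) \<Rightarrow> complex \<Rightarrow> (real ^ 'n \<Rightarrow> complex) \<Rightarrow> 'n \<Rightarrow> 'n \<Rightarrow> bool"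
  where "calibratable \<alpha> q t i j \<longleftrightarrow>
    (\<forall>\<beta>\<in>rank2_roots \<alpha> i j. t \<beta> \<noteq> 1) \<or>
    calibratable_special \<alpha> q t i j \<or> calibratable_special \<alpha> q t j i"

definition placed_skew_shape :: "(real ^ 'n) set \<Rightarrow> ('n \<Rightarrow> real ^ 'n) \<Rightarrow> complex \<Rightarrow>
    (real ^ 'n \<Rightarrow> complex) \<Rightarrow> (real ^ 'n) set \<Rightarrow> bool"
  where "placed_skew_shape R \<alpha> q t J \<longleftrightarrow>
    placed_shape R \<alpha> q t J \<and>
    (\<forall>w\<in>std_tableaux R \<alpha> q t J.
      (\<forall>i j. i \<noteq> j \<longrightarrow> calibratable \<alpha> q (weyl_act w t) i j) \<and>
      (CARD('n) = 1 \<longrightarrow> (\<forall>i. weyl_act w t (\<alpha> i) \<noteq> 1)))"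


section \<open>The space of formal combinations of tableaux\<close>

definition vscale :: "complex \<Rightarrow> ('w \<Rightarrow>\<^sub>0 complex) \<Rightarrow> ('w \<Rightarrow>\<^sub>0 complex)"
  where "vscale c = Poly_Mapping.map ((*) c)"

definition tab_vec :: "'w set \<Rightarrow> 'w \<Rightarrow> ('w \<Rightarrow>\<^sub>0 complex)"
  where "tab_vec F w = (if w \<in> F then Poly_Mapping.single w 1 else 0)"

text \<open>The formal \<open>\<complex>\<close>-span of \<open>F\<close> as an additive group with scalar multiplication \<open>act\<close>. The ring
  product and unit in the library's module record play no role.\<close>

definition tab_module ::
    "'w set \<Rightarrow> ('a \<Rightarrow> ('w \<Rightarrow>\<^sub>0 complex) \<Rightarrow> ('w \<Rightarrow>\<^sub>0 complex)) \<Rightarrow> ('a, 'w \<Rightarrow>\<^sub>0 complex) module"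
  where "tab_module F act =
    \<lparr>carrier = {v. Poly_Mapping.keys v \<subseteq> F}, mult = undefined, one = undefined,
     zero = 0, add = (+), smult = act\<rparr>"

definition T_diag ::
    "('n \<Rightarrow> real ^ 'n) \<Rightarrow> complex \<Rightarrow> (real ^ 'n \<Rightarrow> complex) \<Rightarrow> 'n \<Rightarrow>
      (real ^ 'n \<Rightarrow> real ^ 'n) \<Rightarrow> complex"
  where "T_diag \<alpha> q t i w = (q - inverse q) / (1 - weyl_act w t (- \<alpha> i))"

end

theory Submission
  imports Defs
begin

text \<open>
  Let \<open>c(x) = (q x - q\<^sup>-\<^sup>1) / (x - 1)\<close>. On functions on \<open>W\<close> put
  \<open>(T\<^sub>i f)(w) = (c(x\<^sub>i(w)) - q\<^sup>-\<^sup>1) f(w) + c(x\<^sub>i(s\<^sub>i w)) f(s\<^sub>i w)\<close> with \<open>x\<^sub>i(w) = (wt)(X\<^bsup>\<alpha>\<^sub>i\<^esup>)\<close>;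
  this is the full principal series whenever \<open>t\<close> is nowhere trivial on the roots involved. As
  \<open>c(q\<^sup>-\<^sup>2) = 0\<close>, the set of roots \<open>\<beta>\<close> with \<open>t(X\<^sup>\<beta>) = q\<^sup>2\<close> and \<open>w\<beta> > 0\<close> can only shrink along a nonzero
  matrix entry, so the functions on the tableaux form a subquotient and inherit every relation. The
  braid relations reduce to polynomial identities among the values of \<open>c\<close> on a rank two system, all
  consequences of the addition formula for \<open>c(x y)\<close>; in the exceptional calibratable cases the
  tableaux in a coset of \<open>W\<^sub>i\<^sub>j\<close> number at most two and the relation is checked on that space.

  For irreducibility, two tableaux are joined by steps \<open>w \<mapsto> s\<^sub>i w\<close> through tableaux, with invertible
  coefficients, and distinct tableaux have distinct weights. The latter needs Steinberg's theorem that
  the stabilizer of \<open>t\<close> is trivial when \<open>t\<close> is regular: the Jacobian of the orbit sums of the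
  fundamental weights is, up to a constant, the Weyl denominator, hence nonzero at \<open>t\<close>, while an
  element of the stabilizer fixes the differentials at \<open>t\<close> of these orbit sums.
\<close>

section \<open>Root systems and their Weyl groups\<close>

text \<open>The obstacle is that \<open>t\<close> may be trivial on some roots. Then c has poles on
  \<open>W\<close>, and the operators on all functions need not satisfy the braid relations, so
  there is no full module to take a subquotient of. The way out is locality: a braid relation in i,
  j evaluated at one point w involves only the coset \<open>W_ij w\<close>, and calibratability of
  \<open>wt\<close> speaks about exactly that coset. Each relation is therefore proved point by
  point, with a conventional value of \<open>cfun\<close> at the pole, and the passage to tableaux
  works for words of any length because c vanishes on the edges where it has to.

  Replacing T_i by T_i + q^-1 turns a braid relation into the equality of two forms of one element,
  whose matrix entries are products of values of c and of Q - c. Reversing the 2m-gon exchanges the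
  two forms.

  Trivial stabilizers depend on characters living on the whole weight lattice: on the root lattice
  of type A1 the character with t(X^alpha) = -1 is regular and yet fixed by the reflection. This is
  why the orbit sums of the fundamental weights enter.\<close>

lemma linear_refl_at: "linear (refl_at \<beta>)"
  by (rule linearI) (simp_all add: refl_at_def copair_linear algebra_simps)

lemma refl_at_self: "refl_at \<beta> \<beta> = - \<beta>"
  by (cases "\<beta> = 0") (auto simp: refl_at_def copair_def scaleR_2)

lemma refl_at_refl_at [simp]: "refl_at \<beta> (refl_at \<beta> x) = x"
proof (cases "\<beta> = 0")
  case False
  then have "copair \<beta> \<beta> = 2"
    by (simp add: copair_def)
  then have "copair (refl_at \<beta> x) \<beta> = - copair x \<beta>"
    by (simp add: refl_at_def copair_linear)
  then show ?thesis
    by (simp add: refl_at_def [of _ "refl_at \<beta> x"]) (simp add: refl_at_def)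
qed (simp add: refl_at_def)

lemma inner_refl_at: "refl_at \<beta> x \<bullet> y = x \<bullet> refl_at \<beta> y"
  by (simp add: refl_at_def copair_def algebra_simps inner_commute)

lemma inner_refl_at_refl_at [simp]: "refl_at \<beta> x \<bullet> refl_at \<beta> y = x \<bullet> y"
  by (simp add: inner_refl_at)

lemma refl_group_linear: "w \<in> refl_group S \<Longrightarrow> linear w"
  by (induction rule: refl_group.induct) (simp_all only: linear_id linear_compose linear_refl_at)

lemma refl_group_inner: "w \<in> refl_group S \<Longrightarrow> w x \<bullet> w y = x \<bullet> y"
  by (induction rule: refl_group.induct) auto

lemma refl_group_comp: "u \<in> refl_group S \<Longrightarrow> w \<in> refl_group S \<Longrightarrow> u \<circ> w \<in> refl_group S"
  by (induction rule: refl_group.induct) (auto simp: comp_assoc intro: refl_group.intros)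

lemma refl_group_single: "\<beta> \<in> S \<Longrightarrow> refl_at \<beta> \<in> refl_group S"
  using refl_group.refl[OF _ refl_group.id] by force

lemma refl_group_inverse_ex:
  "w \<in> refl_group S \<Longrightarrow> \<exists>u\<in>refl_group S. u \<circ> w = id \<and> w \<circ> u = id"
proof (induction rule: refl_group.induct)
  case id
  show ?case by (intro bexI[of _ id]) (auto intro: refl_group.id)
next
  case (refl \<beta> w)
  then obtain u where u: "u \<in> refl_group S" "u \<circ> w = id" "w \<circ> u = id"
    by blast
  then have "u \<circ> refl_at \<beta> \<in> refl_group S"
    using refl_group_comp refl_group_single refl(1) by blast
  moreover have "(u \<circ> refl_at \<beta>) \<circ> (refl_at \<beta> \<circ> w) = id" "(refl_at \<beta> \<circ> w) \<circ> (u \<circ> refl_at \<beta>) = id"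
    using u(2,3) by (auto simp: fun_eq_iff)
  ultimately show ?case by blast
qed

lemma refl_group_bij: "w \<in> refl_group S \<Longrightarrow> bij w"
  using refl_group_inverse_ex o_bij by metis

lemma refl_group_inverse: "w \<in> refl_group S \<Longrightarrow> inv_into UNIV w \<in> refl_group S"
  using refl_group_inverse_ex inv_unique_comp by metis

lemma refl_group_inv_apply [simp]:
  assumes "w \<in> refl_group S"
  shows "w (inv_into UNIV w x) = x" "inv_into UNIV w (w x) = x"
  using refl_group_bij[OF assms] by (simp_all add: bij_is_surj surj_f_inv_f bij_is_inj inv_f_f)

lemma refl_group_mono: "S \<subseteq> S' \<Longrightarrow> refl_group S \<subseteq> refl_group S'"
proof
  fix w assume "S \<subseteq> S'" "w \<in> refl_group S"
  from this(2,1) show "w \<in> refl_group S'"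
    by (induction rule: refl_group.induct) (auto intro: refl_group.intros)
qed

lemma weyl_act_comp:
  assumes "u \<in> refl_group S" "w \<in> refl_group S"
  shows "weyl_act (u \<circ> w) t = weyl_act u (weyl_act w t)"
  using assms by (simp add: weyl_act_def fun_eq_iff o_inv_distrib refl_group_bij)

lemma weyl_act_refl: "weyl_act (refl_at \<beta>) t \<nu> = t (refl_at \<beta> \<nu>)"
proof -
  have "inv_into UNIV (refl_at \<beta>) = refl_at \<beta>"
    by (rule inv_unique_comp) (simp_all add: fun_eq_iff)
  then show ?thesis by (simp add: weyl_act_def)
qed

locale simple_root_system =
  fixes R :: "(real ^ 'n) set" and \<alpha> :: "'n \<Rightarrow> real ^ 'n"
  assumes reduced: "reduced_root_system R" and simple: "simple_roots R \<alpha>"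
begin

abbreviation "W \<equiv> refl_group R"
abbreviation "P \<equiv> weight_lattice \<alpha>"
abbreviation "s i \<equiv> refl_at (\<alpha> i)"

lemma root_system: "root_system R"
  using reduced by (simp add: reduced_root_system_def)

lemma finite_R: "finite R" and zero_notin_R: "0 \<notin> R" and span_R: "span R = UNIV"
  and refl_at_R: "\<beta> \<in> R \<Longrightarrow> \<gamma> \<in> R \<Longrightarrow> refl_at \<beta> \<gamma> \<in> R"
  and copair_Ints: "\<beta> \<in> R \<Longrightarrow> \<gamma> \<in> R \<Longrightarrow> copair \<gamma> \<beta> \<in> \<int>"
  using root_system by (auto simp: root_system_def)

lemma simple_in_R: "\<alpha> i \<in> R"
  using simple by (auto simp: simple_roots_def)

lemma simple_nonzero: "\<alpha> i \<noteq> 0"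
  using simple_in_R zero_notin_R by metis

lemma uminus_R: "\<beta> \<in> R \<Longrightarrow> - \<beta> \<in> R"
  using refl_at_R[of \<beta> \<beta>] by (simp add: refl_at_self)

lemma W_R: "w \<in> W \<Longrightarrow> \<beta> \<in> R \<Longrightarrow> w \<beta> \<in> R"
  by (induction rule: refl_group.induct) (auto intro: refl_at_R)

lemma s_in_W: "s i \<in> W"
  by (simp add: refl_group_single simple_in_R)

lemma W_uminus: "w \<in> W \<Longrightarrow> w (- x) = - w x"
  by (simp add: linear_neg refl_group_linear)

text \<open>The scaled fundamental weights are the fundamental coweights, the basis dual to the
  simple roots, so pairing with them reads off coefficients in the basis of simple roots.\<close>

definition coord :: "'n \<Rightarrow> real ^ 'n \<Rightarrow> real"
  where "coord i x = 2 / (\<alpha> i \<bullet> \<alpha> i) * (fund_weight \<alpha> i \<bullet> x)"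

text \<open>The sum of the fundamental coweights represents the height functional. Signs of roots
  are handled throughout as signs of \<open>ht\<close>, which is linear. The vector itself returns
  in \<open>weight_stabilizer_trivial\<close> as a point pairing positively with all positive
  roots.\<close>

definition ht_vec :: "real ^ 'n"
  where "ht_vec = (\<Sum>i\<in>UNIV. (2 / (\<alpha> i \<bullet> \<alpha> i)) *\<^sub>R fund_weight \<alpha> i)"

definition ht :: "real ^ 'n \<Rightarrow> real"
  where "ht x = ht_vec \<bullet> x"

lemma ht_eq_sum_coord: "ht x = (\<Sum>i\<in>UNIV. coord i x)"
  by (simp add: ht_def ht_vec_def coord_def inner_sum_left)

lemma coord_simple: "coord i (\<alpha> j) = (if i = j then 1 else 0)"
  using copair_fund_weight[OF simple, of i j] simple_nonzero[of j] simple_nonzero[of i]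
  by (auto simp: coord_def copair_def split: if_splits)

lemma linear_coord: "linear (coord i)"
  by (rule linearI) (simp_all add: coord_def inner_add_right algebra_simps)

lemma linear_ht: "linear ht"
  by (rule linearI) (simp_all add: ht_def inner_add_right algebra_simps)

lemmas coord_linear = linear_add[OF linear_coord] linear_cmul[OF linear_coord]
  linear_diff[OF linear_coord] linear_sum[OF linear_coord] linear_neg[OF linear_coord]
  linear_0[OF linear_coord]

lemmas ht_linear = linear_add[OF linear_ht] linear_cmul[OF linear_ht]
  linear_diff[OF linear_ht] linear_sum[OF linear_ht] linear_neg[OF linear_ht]
  linear_0[OF linear_ht]

lemma ht_simple: "ht (\<alpha> i) = 1"
  by (simp add: ht_eq_sum_coord coord_simple)

lemma coord_expansion: "x = (\<Sum>i\<in>UNIV. coord i x *\<^sub>R \<alpha> i)"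
proof -
  have "independent (range \<alpha>)" "inj \<alpha>"
    using simple by (auto simp: simple_roots_def)
  then have "card (range \<alpha>) = DIM(real ^ 'n)"
    by (simp add: card_image)
  then have "span (range \<alpha>) = UNIV"
    using \<open>independent (range \<alpha>)\<close> by (metis (no_types, lifting) card_eq_dim dim_UNIV top.extremum
        dim_eq_full dim_eq_card_independent)
  then have "x \<in> span (range \<alpha>)" by simp
  then show ?thesis
  proof (induction rule: span_induct_alt)
    case base
    then show ?case by (simp add: coord_linear)
  next
    case (step c y z)
    then obtain j where j: "y = \<alpha> j" by blast
    have "(\<Sum>i\<in>UNIV. coord i (c *\<^sub>R y + z) *\<^sub>R \<alpha> i)
      = (\<Sum>i\<in>UNIV. (if i = j then c else 0) *\<^sub>R \<alpha> i) + (\<Sum>i\<in>UNIV. coord i z *\<^sub>R \<alpha> i)"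
      unfolding sum.distrib[symmetric] scaleR_left_distrib[symmetric]
      by (rule sum.cong) (auto simp: j coord_linear coord_simple)
    also have "\<dots> = c *\<^sub>R y + z"
      using step by (simp add: j if_distrib[of "\<lambda>c. c *\<^sub>R _"] cong: if_cong)
    finally show ?case by simp
  qed
qed

lemma pos_roots_coord: "\<beta> \<in> pos_roots R \<alpha> \<Longrightarrow> coord i \<beta> \<in> \<nat>"
  by (auto simp: pos_roots_def coord_linear coord_simple if_distrib cong: if_cong)

lemma pos_roots_coord_nonneg: "\<beta> \<in> pos_roots R \<alpha> \<Longrightarrow> coord i \<beta> \<ge> 0"
  using pos_roots_coord Nats_cases by (metis of_nat_0_le_iff)

lemma pos_roots_in_R: "\<beta> \<in> pos_roots R \<alpha> \<Longrightarrow> \<beta> \<in> R"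
  by (simp add: pos_roots_def)

lemma finite_pos_roots: "finite (pos_roots R \<alpha>)"
  by (rule finite_subset[OF _ finite_R]) (auto simp: pos_roots_def)

lemma pos_roots_ht: "\<beta> \<in> pos_roots R \<alpha> \<Longrightarrow> ht \<beta> > 0"
proof -
  assume \<beta>: "\<beta> \<in> pos_roots R \<alpha>"
  then have "\<beta> \<noteq> 0"
    using pos_roots_in_R zero_notin_R by metis
  then obtain i where "coord i \<beta> \<noteq> 0"
    using coord_expansion[of \<beta>] by (metis (no_types, lifting) scaleR_zero_left sum.neutral)
  then have "coord i \<beta> > 0"
    using pos_roots_coord_nonneg[OF \<beta>, of i] by simp
  then show ?thesis
    unfolding ht_eq_sum_coord
    by (intro sum_pos2[of _ i]) (auto simp: pos_roots_coord_nonneg[OF \<beta>])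
qed

lemma pos_roots_ht_nat: "\<beta> \<in> pos_roots R \<alpha> \<Longrightarrow> \<exists>m::nat. ht \<beta> = m"
proof -
  assume "\<beta> \<in> pos_roots R \<alpha>"
  then obtain c :: "'n \<Rightarrow> nat" where "\<beta> = (\<Sum>i\<in>UNIV. real (c i) *\<^sub>R \<alpha> i)"
    by (auto simp: pos_roots_def)
  then have "ht \<beta> = real (\<Sum>i\<in>UNIV. c i)"
    by (simp add: ht_linear ht_simple)
  then show ?thesis by blast
qed

lemma root_pos_or_neg: "\<beta> \<in> R \<Longrightarrow> \<beta> \<in> pos_roots R \<alpha> \<or> - \<beta> \<in> pos_roots R \<alpha>"
  using simple by (auto simp: simple_roots_def)

lemma pos_iff_ht: "\<beta> \<in> R \<Longrightarrow> \<beta> \<in> pos_roots R \<alpha> \<longleftrightarrow> ht \<beta> > 0"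
  using root_pos_or_neg[of \<beta>] pos_roots_ht[of \<beta>] pos_roots_ht[of "- \<beta>"]
  by (auto simp: ht_linear)

lemma neg_iff_ht: "\<beta> \<in> R \<Longrightarrow> - \<beta> \<in> pos_roots R \<alpha> \<longleftrightarrow> ht \<beta> < 0"
  using pos_iff_ht[of "- \<beta>"] by (simp add: uminus_R ht_linear)

lemma ht_root_nonzero: "\<beta> \<in> R \<Longrightarrow> ht \<beta> \<noteq> 0"
  using root_pos_or_neg[of \<beta>] pos_roots_ht[of \<beta>] pos_roots_ht[of "- \<beta>"]
  by (auto simp: ht_linear)

lemma simple_pos: "\<alpha> i \<in> pos_roots R \<alpha>"
  by (simp add: pos_iff_ht simple_in_R ht_simple)

lemma pos_coord_pos: "\<beta> \<in> R \<Longrightarrow> coord k \<beta> > 0 \<Longrightarrow> ht \<beta> > 0"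
  using root_pos_or_neg[of \<beta>] pos_roots_coord_nonneg[of "- \<beta>" k] pos_roots_ht[of \<beta>]
  by (auto simp: coord_linear)

text \<open>Reducedness enters here: a root supported on alpha_i alone is a multiple of it. As s_i
  changes no other coefficient, and one positive coefficient makes a root positive,
  \<open>s_pos\<close> follows.\<close>

lemma pos_root_other_coord:
  assumes "\<beta> \<in> R" "ht \<beta> > 0" "\<beta> \<noteq> \<alpha> i"
  shows "\<exists>k. k \<noteq> i \<and> coord k \<beta> > 0"
proof (rule ccontr)
  assume a: "\<not> ?thesis"
  have nn: "coord k \<beta> \<ge> 0" for k
    using assms pos_iff_ht pos_roots_coord_nonneg by blast
  with a have z: "coord k \<beta> = 0" if "k \<noteq> i" for k
    using that by (metis less_eq_real_def)
  have "(\<Sum>k\<in>UNIV. coord k \<beta> *\<^sub>R \<alpha> k) = (\<Sum>k\<in>UNIV. if k = i then coord i \<beta> *\<^sub>R \<alpha> i else 0)"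
    by (rule sum.cong) (auto simp: z)
  then have "\<beta> = (\<Sum>k\<in>UNIV. if k = i then coord i \<beta> *\<^sub>R \<alpha> i else 0)"
    using coord_expansion[of \<beta>] by simp
  then have eq: "\<beta> = coord i \<beta> *\<^sub>R \<alpha> i" by simp
  then have "coord i \<beta> = 1 \<or> coord i \<beta> = -1"
    using reduced assms(1) simple_in_R[of i] by (metis reduced_root_system_def)
  with nn[of i] eq assms(3) show False by auto
qed

lemma coord_s: "k \<noteq> i \<Longrightarrow> coord k (s i x) = coord k x"
  by (simp add: refl_at_def coord_linear coord_simple)

lemma ht_s: "ht (s i x) = ht x - copair x (\<alpha> i)"
  by (simp add: refl_at_def ht_linear ht_simple)

lemma s_pos:
  assumes "\<beta> \<in> R" "ht \<beta> > 0" "\<beta> \<noteq> \<alpha> i"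
  shows "ht (s i \<beta>) > 0"
  using pos_root_other_coord[OF assms] assms(1) s_in_W W_R pos_coord_pos coord_s by metis

lemma s_pos_iff:
  assumes "\<beta> \<in> R" "\<beta> \<noteq> \<alpha> i" "\<beta> \<noteq> - \<alpha> i"
  shows "ht (s i \<beta>) > 0 \<longleftrightarrow> ht \<beta> > 0"
proof
  assume "ht (s i \<beta>) > 0"
  moreover have "s i \<beta> \<noteq> \<alpha> i"
    using assms(3) by (metis refl_at_refl_at refl_at_self)
  moreover have "s i \<beta> \<in> R"
    by (simp add: assms(1) refl_at_R simple_in_R)
  ultimately show "ht \<beta> > 0"
    using s_pos[of "s i \<beta>" i] by simp
qed (use s_pos assms in blast)

lemma refl_at_conj:
  assumes "w \<in> W"
  shows "refl_at (w \<beta>) (w x) = w (refl_at \<beta> x)"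
proof -
  have l: "linear w" using assms refl_group_linear by blast
  show ?thesis
    using assms by (simp add: refl_at_def copair_def refl_group_inner linear_diff[OF l] linear_cmul[OF l])
qed

lemma refl_at_uminus: "refl_at (- \<beta>) = refl_at \<beta>"
  by (simp add: refl_at_def copair_def fun_eq_iff)

text \<open>Induction on the height. Expanding beta . beta in simple roots gives some alpha_i with
  beta . alpha_i > 0; then s_i beta is a positive root of smaller height, and its reflection is
  conjugate to that of beta by s_i.\<close>

lemma refl_pos_in_simple_group:
  assumes "\<beta> \<in> pos_roots R \<alpha>"
  shows "refl_at \<beta> \<in> refl_group (range \<alpha>)"
proof -
  have "\<exists>m::nat. ht \<beta> = m"
    by (rule pos_roots_ht_nat[OF assms])
  then obtain m :: nat where "ht \<beta> = m" by blast
  with assms show ?thesis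
  proof (induction m arbitrary: \<beta> rule: less_induct)
    case (less m)
    show ?case
    proof (cases "\<beta> \<in> range \<alpha>")
      case False
      have \<beta>R: "\<beta> \<in> R" and \<beta>p: "ht \<beta> > 0"
        using pos_roots_in_R[OF less(2)] pos_roots_ht[OF less(2)] by auto
      have "\<exists>i. \<beta> \<bullet> \<alpha> i > 0"
      proof (rule ccontr)
        assume "\<not> ?thesis"
        then have "\<beta> \<bullet> \<alpha> i \<le> 0" for i
          by (meson not_less)
        then have "coord i \<beta> * (\<beta> \<bullet> \<alpha> i) \<le> 0" for i
          using pos_roots_coord_nonneg[OF less(2)] by (simp add: mult_nonneg_nonpos)
        then have "(\<Sum>i\<in>UNIV. coord i \<beta> * (\<beta> \<bullet> \<alpha> i)) \<le> 0"
          by (simp add: sum_nonpos)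
        moreover have "\<beta> \<bullet> \<beta> = (\<Sum>i\<in>UNIV. coord i \<beta> * (\<beta> \<bullet> \<alpha> i))"
          by (subst (2) coord_expansion) (simp add: inner_sum_right)
        ultimately show False
          using \<beta>R zero_notin_R inner_gt_zero_iff[of \<beta>] by (metis not_le)
      qed
      then obtain i where "\<beta> \<bullet> \<alpha> i > 0" by blast
      then have cp: "copair \<beta> (\<alpha> i) > 0"
        using simple_nonzero[of i] by (simp add: copair_def)
      let ?\<gamma> = "s i \<beta>"
      have \<gamma>R: "?\<gamma> \<in> R"
        by (simp add: \<beta>R refl_at_R simple_in_R)
      have \<gamma>p: "ht ?\<gamma> > 0"
        using s_pos \<beta>R \<beta>p False by (metis rangeI)
      have "\<exists>m'::nat. ht ?\<gamma> = m'"
        using \<gamma>R \<gamma>p pos_iff_ht pos_roots_ht_nat by blast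
      then obtain m' :: nat where m': "ht ?\<gamma> = m'" by blast
      have "m' < m"
        using m' less(3) cp by (simp add: ht_s)
      then have IH: "refl_at ?\<gamma> \<in> refl_group (range \<alpha>)"
        using less(1) m' \<gamma>R \<gamma>p pos_iff_ht by blast
      have "refl_at \<beta> = s i \<circ> (refl_at ?\<gamma> \<circ> s i)"
        using refl_at_conj[OF s_in_W[of i], of ?\<gamma>] by (simp add: fun_eq_iff) (metis refl_at_refl_at)
      then show ?thesis
        using IH by (metis rangeI refl_group_comp refl_group_single)
    qed (simp add: refl_group_single)
  qed
qed

lemma W_eq_simple: "W = refl_group (range \<alpha>)"
proof
  show "refl_group (range \<alpha>) \<subseteq> W"
    by (rule refl_group_mono) (use simple_in_R in blast)
  show "W \<subseteq> refl_group (range \<alpha>)"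
  proof
    fix w assume "w \<in> W"
    then show "w \<in> refl_group (range \<alpha>)"
    proof (induction rule: refl_group.induct)
      case (refl \<beta> w)
      have "refl_at \<beta> \<in> refl_group (range \<alpha>)"
        using root_pos_or_neg[OF refl(1)] refl_pos_in_simple_group[of \<beta>]
          refl_pos_in_simple_group[of "- \<beta>"] by (auto simp: refl_at_uminus)
      then show ?case
        using refl refl_group_comp by blast
    qed (rule refl_group.id)
  qed
qed

section \<open>Words in the simple reflections; finiteness of the Weyl group; the weight
  lattice\<close>

definition s_word :: "'n list \<Rightarrow> real ^ 'n \<Rightarrow> real ^ 'n"
  where "s_word is = foldr (\<lambda>i. (\<circ>) (s i)) is id"

lemma s_word_Nil [simp]: "s_word [] = id" and s_word_Cons [simp]: "s_word (i # is) = s i \<circ> s_word is"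
  by (simp_all add: s_word_def)

lemma s_word_append: "s_word (xs @ ys) = s_word xs \<circ> s_word ys"
  by (induction xs) (auto simp: comp_assoc)

lemma s_word_in_W: "s_word is \<in> W"
  by (induction "is") (simp_all only: s_word_Nil s_word_Cons refl_group.intros simple_in_R)

lemma W_s_word: "w \<in> W \<Longrightarrow> \<exists>is. w = s_word is"
  unfolding W_eq_simple
proof (induction rule: refl_group.induct)
  case id
  then show ?case by (metis s_word_Nil)
next
  case (refl \<beta> w)
  then show ?case by (metis imageE s_word_Cons)
qed

text \<open>The exchange argument: if a word ending in \<open>s\<^sub>i\<close> keeps \<open>\<alpha>\<^sub>i\<close> positive, then following \<open>- \<alpha>\<^sub>i\<close>
  through the word to the letter at which it becomes positive allows two letters to be deleted.\<close>

lemma s_word_positive_imp_id: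
  assumes "\<And>\<beta>. \<beta> \<in> R \<Longrightarrow> ht \<beta> > 0 \<Longrightarrow> ht (s_word is \<beta>) > 0"
  shows "s_word is = id"
  using assms
proof (induction "length is" arbitrary: "is" rule: less_induct)
  case less
  show ?case
  proof (cases "is" rule: rev_cases)
    case (snoc js i)
    have cross: "\<exists>us j vs. js = us @ j # vs \<and> s_word vs (\<alpha> i) = \<alpha> j"
      if "ht (s_word js (\<alpha> i)) < 0" for js
      using that
    proof (induction js)
      case (Cons j js)
      show ?case
      proof (cases "ht (s_word js (\<alpha> i)) < 0")
        case True
        then show ?thesis
          using Cons.IH by (metis append_Cons)
      next
        case False
        have "s_word js (\<alpha> i) \<in> R"
          by (simp add: W_R s_word_in_W simple_in_R)
        then have "s_word js (\<alpha> i) = \<alpha> j"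
          using False Cons.prems s_pos ht_root_nonzero
          by (metis comp_apply not_less_iff_gr_or_eq s_word_Cons)
        then show ?thesis by (metis append_Nil)
      qed
    qed (simp add: ht_simple)
    have "ht (s_word is (\<alpha> i)) > 0"
      using less.prems simple_in_R ht_simple by simp
    moreover have "s_word is (\<alpha> i) = - s_word js (\<alpha> i)"
      by (simp add: snoc s_word_append refl_at_self W_uminus s_word_in_W)
    ultimately have "ht (s_word js (\<alpha> i)) < 0"
      by (simp add: ht_linear)
    then obtain us j vs where js: "js = us @ j # vs" and v: "s_word vs (\<alpha> i) = \<alpha> j"
      using cross by blast
    have "s j \<circ> s_word vs \<circ> s i = s_word vs"
      using refl_at_conj[OF s_word_in_W[of vs], of "\<alpha> i"] by (simp add: v fun_eq_iff)
    then have eq: "s_word is = s_word (us @ vs)"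
      by (simp add: snoc js s_word_append comp_assoc)
    show ?thesis
      using less.hyps[of "us @ vs"] less.prems unfolding eq by (simp add: snoc js)
  qed simp
qed

lemma W_positive_imp_id:
  "w \<in> W \<Longrightarrow> (\<And>\<beta>. \<beta> \<in> R \<Longrightarrow> ht \<beta> > 0 \<Longrightarrow> ht (w \<beta>) > 0) \<Longrightarrow> w = id"
  using W_s_word s_word_positive_imp_id by blast

lemma W_neg_simple_ex:
  assumes "w \<in> W" "w \<noteq> id"
  shows "\<exists>i. ht (w (\<alpha> i)) < 0"
proof (rule ccontr)
  assume "\<not> ?thesis"
  then have a: "ht (w (\<alpha> i)) \<ge> 0" for i
    by (meson not_less)
  have l: "linear w" using assms refl_group_linear by blast
  have "ht (w \<beta>) > 0" if "\<beta> \<in> R" "ht \<beta> > 0" for \<beta>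
  proof -
    have "w \<beta> = (\<Sum>i\<in>UNIV. coord i \<beta> *\<^sub>R w (\<alpha> i))"
      by (subst coord_expansion) (simp add: linear_sum[OF l] linear_cmul[OF l])
    then have "ht (w \<beta>) = (\<Sum>i\<in>UNIV. coord i \<beta> * ht (w (\<alpha> i)))"
      by (simp add: ht_linear)
    also have "\<dots> \<ge> 0"
      using that pos_iff_ht pos_roots_coord_nonneg a by (intro sum_nonneg) auto
    finally show ?thesis
      using ht_root_nonzero[of "w \<beta>"] W_R assms(1) that(1) by force
  qed
  then show False
    using W_positive_imp_id assms by blast
qed

lemma finite_W: "finite W"
proof -
  have "inj_on (\<lambda>w. restrict w R) W"
  proof (rule inj_onI)
    fix u w assume u: "u \<in> W" and w: "w \<in> W" and eq: "restrict u R = restrict w R"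
    have "u \<beta> = w \<beta>" if "\<beta> \<in> R" for \<beta>
      using eq that by (metis restrict_apply')
    then show "u = w"
      using linear_eq_on_span[OF refl_group_linear[OF u] refl_group_linear[OF w], of R]
      by (auto simp: span_R)
  qed
  moreover have "(\<lambda>w. restrict w R) ` W \<subseteq> R \<rightarrow>\<^sub>E R"
    using W_R by auto
  ultimately show ?thesis
    using finite_R by (meson finite_PiE finite_imageD finite_subset)
qed

lemma weight_lattice_iff': "\<nu> \<in> P \<longleftrightarrow> (\<forall>j. copair \<nu> (\<alpha> j) \<in> \<int>)"
  by (rule weight_lattice_iff[OF simple])

lemma R_in_P: "\<beta> \<in> R \<Longrightarrow> \<beta> \<in> P"
  using copair_Ints simple_in_R by (auto simp: weight_lattice_iff')

lemma P_add: "\<mu> \<in> P \<Longrightarrow> \<nu> \<in> P \<Longrightarrow> \<mu> + \<nu> \<in> P"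
  and P_uminus: "\<mu> \<in> P \<Longrightarrow> - \<mu> \<in> P"
  and P_diff: "\<mu> \<in> P \<Longrightarrow> \<nu> \<in> P \<Longrightarrow> \<mu> - \<nu> \<in> P"
  and P_zero: "0 \<in> P"
  by (auto simp: weight_lattice_iff' copair_linear linear_neg[OF linear_copair] linear_0[OF linear_copair])

lemma P_sum: "(\<And>a. a \<in> A \<Longrightarrow> f a \<in> P) \<Longrightarrow> sum f A \<in> P"
  by (induction A rule: infinite_finite_induct) (auto simp: P_add P_zero)

lemma fund_weight_in_P: "fund_weight \<alpha> i \<in> P"
  by (simp add: weight_lattice_iff' copair_fund_weight[OF simple])

lemma s_P: "\<mu> \<in> P \<Longrightarrow> s i \<mu> \<in> P"
proof -
  assume \<mu>: "\<mu> \<in> P"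
  then have "copair \<mu> (\<alpha> i) * copair (\<alpha> i) (\<alpha> j) \<in> \<int>" for j
    using copair_Ints simple_in_R by (simp add: weight_lattice_iff')
  then show ?thesis
    using \<mu> by (simp add: weight_lattice_iff' refl_at_def copair_linear)
qed

lemma W_P: "w \<in> W \<Longrightarrow> \<mu> \<in> P \<Longrightarrow> w \<mu> \<in> P"
  unfolding W_eq_simple by (induction rule: refl_group.induct) (auto intro: s_P)

end

section \<open>Weights with trivial stabilizer\<close>

lemma orthogonal_conj_refl_at:
  assumes "orthogonal_transformation f"
  shows "f (refl_at \<beta> x) = refl_at (f \<beta>) (f x)"
proof -
  have l: "linear f"
    using assms by (simp add: orthogonal_transformation_linear)
  have "f x \<bullet> f y = x \<bullet> y" for x y
    using assms by (simp add: orthogonal_transformation_def)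
  then show ?thesis
    by (simp add: refl_at_def copair_def linear_diff[OF l] linear_cmul[OF l])
qed

text \<open>An orthogonal map taking beta to a multiple of a coordinate axis conjugates the
  reflection to a diagonal matrix with a single entry -1.\<close>

lemma det_refl_at:
  fixes \<beta> :: "real ^ 'n"
  assumes "\<beta> \<noteq> 0"
  shows "det (matrix (refl_at \<beta>)) = -1"
proof -
  obtain k :: 'n where True by blast
  let ?e = "norm \<beta> *\<^sub>R axis k (1::real) :: real ^ 'n"
  have "norm \<beta> = norm ?e" by simp
  then obtain f where f: "orthogonal_transformation f" "f \<beta> = ?e"
    by (rule orthogonal_transformation_exists)
  have l: "linear f"
    using f by (simp add: orthogonal_transformation_linear)
  have entry: "matrix (refl_at ?e) $ i $ j = (if i = j then if i = k then -1 else 1 else 0)" for i j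
  proof -
    have "copair (axis j 1) ?e = (if j = k then 2 / norm \<beta> else 0)"
      using assms by (simp add: copair_def inner_axis_axis)
    then show ?thesis
      using assms by (simp add: matrix_def refl_at_def) (simp add: axis_def)
  qed
  have "f \<circ> refl_at \<beta> = refl_at ?e \<circ> f"
    using orthogonal_conj_refl_at[OF f(1)] f(2) by (simp add: fun_eq_iff)
  then have "matrix f ** matrix (refl_at \<beta>) = matrix (refl_at ?e) ** matrix f"
    by (metis l linear_refl_at matrix_compose)
  then have "det (matrix f) * det (matrix (refl_at \<beta>)) = det (matrix (refl_at ?e)) * det (matrix f)"
    by (metis det_mul)
  moreover have "det (matrix f) \<noteq> 0"
    using f(1) det_orthogonal_matrix orthogonal_transformation_matrix by force
  ultimately have "det (matrix (refl_at \<beta>)) = det (matrix (refl_at ?e))"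
    by simp
  also have "\<dots> = (\<Prod>i\<in>UNIV. matrix (refl_at ?e) $ i $ i)"
    by (rule det_diagonal) (simp add: entry)
  also have "\<dots> = (\<Prod>i\<in>UNIV. if i = k then -1 else 1)"
    by (intro prod.cong) (auto simp: entry)
  finally show ?thesis by simp
qed

lemma det_rows_refl_at:
  fixes \<tau> :: "'n \<Rightarrow> real ^ 'n"
  assumes "\<beta> \<noteq> 0"
  shows "det (\<chi> i. refl_at \<beta> (\<tau> i)) = - det (\<chi> i. \<tau> i)"
proof -
  have "(\<chi> i. refl_at \<beta> (\<tau> i)) = (\<chi> i. \<tau> i) ** transpose (matrix (refl_at \<beta>))"
  proof -
    have "refl_at \<beta> x $ j = (\<Sum>k\<in>UNIV. x $ k * matrix (refl_at \<beta>) $ j $ k)" for x j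
      using fun_cong[OF matrix_vector_mul(2)[OF linear_refl_at[of \<beta>]], of x]
      by (simp add: matrix_vector_mult_def vec_eq_iff mult.commute)
    then show ?thesis
      by (simp add: vec_eq_iff matrix_matrix_mult_def transpose_def)
  qed
  then show ?thesis
    by (simp add: det_mul det_transpose det_refl_at[OF assms])
qed

lemma prod_one_minus:
  fixes f :: "'a \<Rightarrow> 'b :: comm_ring_1"
  assumes "finite A"
  shows "(\<Prod>x\<in>A. 1 - f x) = (\<Sum>S\<in>Pow A. (-1) ^ card S * (\<Prod>x\<in>S. f x))"
proof -
  have "(\<Prod>x\<in>A. 1 - f x) = (\<Prod>x\<in>A. - f x + 1)"
    by simp
  also have "\<dots> = (\<Sum>S\<in>Pow A. (\<Prod>x\<in>S. - f x) * (\<Prod>x\<in>A - S. 1))"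
    by (rule prod_add[OF assms])
  also have "\<dots> = (\<Sum>S\<in>Pow A. (-1) ^ card S * (\<Prod>x\<in>S. f x))"
    by (simp add: prod_uminus)
  finally show ?thesis .
qed

text \<open>Grouping by the weight \<open>f a\<close> allows an identity of coefficient functions on
  weights to be evaluated at a character.\<close>

lemma sum_fibres:
  fixes g :: "'a \<Rightarrow> 'c :: semiring_0"
  assumes "finite N" "f ` A \<subseteq> N"
  shows "(\<Sum>a\<in>A. t (f a) * g a) = (\<Sum>\<mu>\<in>N. t \<mu> * (\<Sum>a\<in>A. if f a = \<mu> then g a else 0))"
proof -
  have "(\<Sum>\<mu>\<in>N. t \<mu> * (\<Sum>a\<in>A. if f a = \<mu> then g a else 0))
      = (\<Sum>a\<in>A. \<Sum>\<mu>\<in>N. if f a = \<mu> then t \<mu> * g a else 0)"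
    unfolding sum_distrib_left by (subst sum.swap) (simp add: if_distrib[of "\<lambda>x. _ * x"] cong: if_cong)
  also have "\<dots> = (\<Sum>a\<in>A. t (f a) * g a)"
    using assms by (intro sum.cong) auto
  finally show ?thesis by simp
qed

context simple_root_system
begin

text \<open>Induction on the number of inversions. If w alpha_i is negative, then w s_i has fewer
  inversions than w, and nu - w nu differs from nu - w s_i nu by a nonnegative multiple of the
  positive root -w alpha_i.\<close>

lemma dominant_minus_W:
  assumes dom: "\<And>i. copair \<nu> (\<alpha> i) \<ge> 0" and "w \<in> W"
  shows "coord k (\<nu> - w \<nu>) \<ge> 0"
  using assms(2)
proof (induction "card {\<beta>\<in>R. ht \<beta> > 0 \<and> ht (w \<beta>) < 0}" arbitrary: w rule: less_induct)
  case less
  let ?I = "\<lambda>w. {\<beta>\<in>R. ht \<beta> > 0 \<and> ht (w \<beta>) < 0}"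
  show ?case
  proof (cases "w = id")
    case False
    then obtain i where i: "ht (w (\<alpha> i)) < 0"
      using W_neg_simple_ex less.prems by blast
    have l: "linear w" using less.prems refl_group_linear by blast
    let ?w = "w \<circ> s i"
    have w': "?w \<in> W"
      using less.prems s_in_W refl_group_comp by blast
    have "s i ` ?I ?w \<subseteq> ?I w - {\<alpha> i}"
    proof safe
      fix \<beta> assume \<beta>: "\<beta> \<in> R" "ht \<beta> > 0" "ht (?w \<beta>) < 0"
      show "s i \<beta> \<in> R" by (simp add: \<beta> refl_at_R simple_in_R)
      show "ht (w (s i \<beta>)) < 0" using \<beta> by simp
      have "\<beta> \<noteq> \<alpha> i"
        using \<beta>(3) i by (auto simp: refl_at_self W_uminus less.prems ht_linear)
      then show "ht (s i \<beta>) > 0" using \<beta> s_pos by blast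
    next
      fix \<beta> assume "s i \<beta> = \<alpha> i" and \<beta>: "ht \<beta> > 0"
      then have "\<beta> = - \<alpha> i" by (metis refl_at_refl_at refl_at_self)
      then show False using \<beta> by (simp add: ht_linear ht_simple)
    qed
    then have "card (?I ?w) \<le> card (?I w - {\<alpha> i})"
      by (intro card_inj_on_le[of "s i"]) (auto simp: finite_R intro: inj_on_inverseI[of _ "s i"])
    also have "\<dots> < card (?I w)"
      using i simple_in_R ht_simple by (intro card_Diff1_less) (auto simp: finite_R)
    finally have IH: "coord k (\<nu> - ?w \<nu>) \<ge> 0"
      using less.hyps w' by blast
    have "- w (\<alpha> i) \<in> pos_roots R \<alpha>"
      using i neg_iff_ht W_R less.prems simple_in_R by blast
    then have "coord k (- w (\<alpha> i)) \<ge> 0"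
      by (rule pos_roots_coord_nonneg)
    then have "copair \<nu> (\<alpha> i) * coord k (- w (\<alpha> i)) \<ge> 0"
      using dom by simp
    moreover have "\<nu> - w \<nu> = (\<nu> - ?w \<nu>) + copair \<nu> (\<alpha> i) *\<^sub>R (- w (\<alpha> i))"
      by (simp add: refl_at_def linear_diff[OF l] linear_cmul[OF l])
    ultimately show ?thesis
      using IH by (simp only: coord_linear) simp
  qed (simp add: coord_linear)
qed

section \<open>The Weyl denominator and the Jacobian of the orbit sums of the fundamental
  weights\<close>

definition rho :: "real ^ 'n"
  where "rho = (\<Sum>i\<in>UNIV. fund_weight \<alpha> i)"

lemma copair_rho: "copair rho (\<alpha> i) = 1"
  by (simp add: rho_def copair_linear copair_fund_weight[OF simple])

lemma rho_in_P: "rho \<in> P"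
  unfolding rho_def by (rule P_sum) (rule fund_weight_in_P)

text \<open>An antiinvariant function vanishes on the walls, so a point of its support of maximal height
  is strictly dominant and hence \<open>\<rho>\<close> plus a dominant vector.\<close>

lemma antiinvariant_zero:
  fixes g :: "real ^ 'n \<Rightarrow> real"
  assumes fin: "finite {\<mu>. g \<mu> \<noteq> 0}"
    and anti: "\<And>i \<mu>. g (s i \<mu>) = - g \<mu>"
    and supp: "\<And>\<mu>. g \<mu> \<noteq> 0 \<Longrightarrow> \<mu> \<in> P" "\<And>\<mu> k. g \<mu> \<noteq> 0 \<Longrightarrow> coord k (rho - \<mu>) \<ge> 0"
    and rho: "g rho = 0"
  shows "g \<mu> = 0"
proof (rule ccontr)
  let ?S = "{\<mu>. g \<mu> \<noteq> 0}"
  assume "g \<mu> \<noteq> 0"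
  then have "?S \<noteq> {}" by blast
  then have "Max (ht ` ?S) \<in> ht ` ?S"
    using fin by (intro Max_in) auto
  then obtain \<nu> where \<nu>: "\<nu> \<in> ?S" and "ht \<nu> = Max (ht ` ?S)"
    by force
  then have max: "\<forall>\<mu>\<in>?S. \<not> ht \<nu> < ht \<mu>"
    using fin by (simp add: not_less)
  have dom: "copair \<nu> (\<alpha> i) \<ge> 1" for i
  proof -
    have "s i \<nu> \<in> ?S" using \<nu> anti by simp
    then have "copair \<nu> (\<alpha> i) \<ge> 0"
      using max ht_s by force
    moreover have "copair \<nu> (\<alpha> i) \<noteq> 0"
    proof
      assume "copair \<nu> (\<alpha> i) = 0"
      then have "s i \<nu> = \<nu>" by (simp add: refl_at_def)
      then show False using anti[of i \<nu>] \<nu> by simp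
    qed
    moreover have "copair \<nu> (\<alpha> i) \<in> \<int>"
      using supp(1) \<nu> by (auto simp: weight_lattice_iff')
    ultimately show ?thesis
      by (auto elim!: Ints_cases)
  qed
  define \<delta> where "\<delta> = rho - \<nu>"
  \<comment> \<open>delta is a nonnegative combination of simple roots and pairs nonpositively with
    each of them, so it is zero. The maximal point of the support would then be rho, where g
    vanishes.\<close>
  have "\<delta> \<bullet> \<delta> = (\<Sum>k\<in>UNIV. coord k \<delta> * (\<delta> \<bullet> \<alpha> k))"
    by (subst (2) coord_expansion) (simp add: inner_sum_right)
  also have "\<dots> \<le> 0"
  proof (rule sum_nonpos)
    fix k
    have "copair \<delta> (\<alpha> k) \<le> 0"
      using dom[of k] by (simp add: \<delta>_def copair_linear copair_rho)
    then have "\<delta> \<bullet> \<alpha> k \<le> 0"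
      using simple_nonzero[of k] inner_ge_zero[of "\<alpha> k"]
      by (auto simp: copair_def divide_le_0_iff mult_le_0_iff not_less)
    then show "coord k \<delta> * (\<delta> \<bullet> \<alpha> k) \<le> 0"
      using supp(2) \<nu> by (simp add: \<delta>_def mult_nonneg_nonpos)
  qed
  finally have "\<delta> = 0" by (metis inner_gt_zero_iff not_le)
  then show False using \<nu> rho by (simp add: \<delta>_def)
qed

text \<open>The coefficient of e^mu in the product of e^rho with all factors 1 - e^(-beta), beta a
  positive root.\<close>

definition weyl_denominator :: "real ^ 'n \<Rightarrow> real"
  where "weyl_denominator \<mu> =
    (\<Sum>S\<in>Pow (pos_roots R \<alpha>). if rho - \<Sum>S = \<mu> then (-1) ^ card S else 0)"

definition weight_tuples :: "('n \<Rightarrow> real ^ 'n) set"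
  where "weight_tuples = PiE UNIV (\<lambda>i. (\<lambda>w. w (fund_weight \<alpha> i)) ` W)"

text \<open>The coefficient of e^mu in the determinant of partial derivatives of the orbit sums,
  expanded multilinearly: a tuple chooses one weight from each orbit. The orbits are sets, so every
  weight counts once.\<close>

definition weight_jacobian :: "real ^ 'n \<Rightarrow> real"
  where "weight_jacobian \<mu> =
    (\<Sum>\<tau>\<in>weight_tuples. if (\<Sum>i\<in>UNIV. \<tau> i) = \<mu> then det (\<chi> i. \<tau> i) else 0)"

lemma finite_weight_tuples: "finite weight_tuples"
  unfolding weight_tuples_def by (rule finite_PiE) (auto simp: finite_W)

lemma weight_tuplesE:
  assumes "\<tau> \<in> weight_tuples"
  obtains w where "w \<in> W" "\<tau> i = w (fund_weight \<alpha> i)"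
  using assms by (auto simp: weight_tuples_def PiE_iff)

lemma weight_tuples_coord: "\<tau> \<in> weight_tuples \<Longrightarrow> coord k (fund_weight \<alpha> i - \<tau> i) \<ge> 0"
  by (erule weight_tuplesE[of _ i])
    (simp add: copair_fund_weight[OF simple] dominant_minus_W)

lemma weight_tuples_P: "\<tau> \<in> weight_tuples \<Longrightarrow> \<tau> i \<in> P"
  by (erule weight_tuplesE[of _ i]) (simp add: W_P fund_weight_in_P)

lemma s_weight_tuples: "\<tau> \<in> weight_tuples \<Longrightarrow> (\<lambda>j. s i (\<tau> j)) \<in> weight_tuples"
proof -
  assume t: "\<tau> \<in> weight_tuples"
  have "s i (\<tau> j) \<in> (\<lambda>w. w (fund_weight \<alpha> j)) ` W" for j
  proof -
    obtain w where w: "w \<in> W" "\<tau> j = w (fund_weight \<alpha> j)"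
      using t by (rule weight_tuplesE)
    then have "s i \<circ> w \<in> W" using s_in_W refl_group_comp by blast
    then show ?thesis
      using w(2) by (intro image_eqI[of _ _ "s i \<circ> w"]) auto
  qed
  then show ?thesis by (simp add: weight_tuples_def PiE_iff)
qed

lemma weight_jacobian_s: "weight_jacobian (s i \<mu>) = - weight_jacobian \<mu>"
proof -
  let ?s = "\<lambda>\<tau> j. s i (\<tau> j)"
  have "weight_jacobian (s i \<mu>) = (\<Sum>\<tau>\<in>weight_tuples. if (\<Sum>j\<in>UNIV. ?s \<tau> j) = s i \<mu> then det (\<chi> j. ?s \<tau> j) else 0)"
    unfolding weight_jacobian_def
    by (rule sum.reindex_bij_witness[of _ ?s ?s]) (auto simp: s_weight_tuples)
  also have "\<dots> = (\<Sum>\<tau>\<in>weight_tuples. - (if (\<Sum>j\<in>UNIV. \<tau> j) = \<mu> then det (\<chi> j. \<tau> j) else 0))"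
  proof (rule sum.cong)
    fix \<tau> :: "'n \<Rightarrow> real ^ 'n"
    have "(\<Sum>j\<in>UNIV. ?s \<tau> j) = s i \<mu> \<longleftrightarrow> (\<Sum>j\<in>UNIV. \<tau> j) = \<mu>"
      by (metis linear_sum[OF linear_refl_at] refl_at_refl_at)
    then show "(if (\<Sum>j\<in>UNIV. ?s \<tau> j) = s i \<mu> then det (\<chi> j. ?s \<tau> j) else 0)
        = - (if (\<Sum>j\<in>UNIV. \<tau> j) = \<mu> then det (\<chi> j. \<tau> j) else 0)"
      by (simp add: det_rows_refl_at[OF simple_nonzero])
  qed simp
  finally show ?thesis
    by (simp add: weight_jacobian_def sum_negf)
qed

lemma weyl_denominator_s: "weyl_denominator (s i \<mu>) = - weyl_denominator \<mu>"
proof -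
  let ?A = "pos_roots R \<alpha>"
  \<comment> \<open>An involution matching the terms at mu with those at s_i mu. It applies s_i to
    the roots other than alpha_i and toggles membership of alpha_i; the toggle absorbs s_i rho = rho
    - alpha_i and changes the parity.\<close>
  define f where "f S = s i ` (S - {\<alpha> i}) \<union> (if \<alpha> i \<in> S then {} else {\<alpha> i})" for S
  have inj: "inj_on (s i) S" for S
    by (rule inj_on_inverseI[of _ "s i"]) simp
  have ni: "\<alpha> i \<notin> s i ` (S - {\<alpha> i})" if "S \<subseteq> ?A" for S
  proof
    assume "\<alpha> i \<in> s i ` (S - {\<alpha> i})"
    then obtain \<beta> where \<beta>: "\<beta> \<in> S" "\<alpha> i = s i \<beta>" by blast
    then have "\<beta> = - \<alpha> i" by (metis refl_at_refl_at refl_at_self)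
    then show False using \<beta>(1) that pos_roots_ht[of \<beta>] by (auto simp: ht_linear ht_simple)
  qed
  have fPow: "f S \<in> Pow ?A" if "S \<in> Pow ?A" for S
  proof -
    have "s i \<beta> \<in> ?A" if "\<beta> \<in> S" "\<beta> \<noteq> \<alpha> i" for \<beta>
    proof -
      have "\<beta> \<in> ?A" using that \<open>S \<in> Pow ?A\<close> by blast
      then show ?thesis
        using that s_pos pos_iff_ht pos_roots_in_R refl_at_R simple_in_R by metis
    qed
    then show ?thesis by (auto simp: f_def simple_pos)
  qed
  have ff: "f (f S) = S" if "S \<in> Pow ?A" for S
  proof (cases "\<alpha> i \<in> S")
    case True
    then have "f S = s i ` (S - {\<alpha> i})" by (simp add: f_def)
    then have "f (f S) = s i ` s i ` (S - {\<alpha> i}) \<union> {\<alpha> i}"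
      using ni[of S] that by (subst f_def) auto
    then show ?thesis using True by (auto simp: image_image)
  next
    case False
    then have "f S = insert (\<alpha> i) (s i ` S)" by (auto simp: f_def)
    then have "f (f S) = s i ` (s i ` S - {\<alpha> i})" by (subst f_def) simp
    also have "s i ` S - {\<alpha> i} = s i ` S" using ni[of S] that False by simp
    finally show ?thesis by (simp add: image_image)
  qed
  have fin: "finite S" if "S \<subseteq> ?A" for S
    using that finite_pos_roots finite_subset by blast
  have srho: "s i rho = rho - \<alpha> i" by (simp add: refl_at_def copair_rho)
  have sumf: "rho - \<Sum>(f S) = s i (rho - \<Sum>S)" and cardf: "(-1 :: real) ^ card (f S) = - ((-1) ^ card S)"
    if "S \<in> Pow ?A" for S
  proof -
    have S: "finite S" using fin that by blast
    have im: "\<Sum>(s i ` B) = s i (\<Sum>B)" for B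
      using linear_sum[OF linear_refl_at, of "\<alpha> i" "\<lambda>x. x" B] by (simp add: sum.reindex[OF inj])
    have "rho - \<Sum>(f S) = s i (rho - \<Sum>S) \<and> (-1 :: real) ^ card (f S) = - ((-1) ^ card S)"
    proof (cases "\<alpha> i \<in> S")
      case True
      define B where "B = S - {\<alpha> i}"
      have B: "S = insert (\<alpha> i) B" "\<alpha> i \<notin> B" "finite B" using True S by (auto simp: B_def)
      have fS: "f S = s i ` B" by (simp add: f_def B_def True)
      show ?thesis
        unfolding fS im using B
        by (simp add: linear_diff[OF linear_refl_at] linear_add[OF linear_refl_at] refl_at_self srho
            card_image[OF inj])
    next
      case False
      have fS: "f S = insert (\<alpha> i) (s i ` S)" using False by (auto simp: f_def)
      have "\<alpha> i \<notin> s i ` S" using ni[of S] that False by simp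
      then show ?thesis
        unfolding fS using S
        by (simp add: im linear_diff[OF linear_refl_at] srho card_image[OF inj])
    qed
    then show "rho - \<Sum>(f S) = s i (rho - \<Sum>S)" "(-1 :: real) ^ card (f S) = - ((-1) ^ card S)"
      by auto
  qed
  have "weyl_denominator (s i \<mu>)
      = (\<Sum>S\<in>Pow ?A. if rho - \<Sum>(f S) = s i \<mu> then (-1) ^ card (f S) else 0)"
    unfolding weyl_denominator_def
    by (rule sum.reindex_bij_witness[of _ f f]) (simp_all only: ff fPow)
  also have "\<dots> = (\<Sum>S\<in>Pow ?A. - (if rho - \<Sum>S = \<mu> then (-1) ^ card S else 0))"
  proof (rule sum.cong)
    fix S assume S: "S \<in> Pow ?A"
    have "s i (rho - \<Sum>S) = s i \<mu> \<longleftrightarrow> rho - \<Sum>S = \<mu>"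
      by (metis refl_at_refl_at)
    then show "(if rho - \<Sum>(f S) = s i \<mu> then (-1) ^ card (f S) else 0)
        = - (if rho - \<Sum>S = \<mu> then (-1 :: real) ^ card S else 0)"
      using sumf[OF S] cardf[OF S] by simp
  qed simp
  finally show ?thesis by (simp add: weyl_denominator_def sum_negf)
qed

lemma weyl_denominator_rho: "weyl_denominator rho = 1"
proof -
  have "S = {}" if "S \<subseteq> pos_roots R \<alpha>" "\<Sum>S = 0" for S
  proof (rule ccontr)
    assume "S \<noteq> {}"
    then have "(\<Sum>\<beta>\<in>S. ht \<beta>) > 0"
      using that(1) finite_pos_roots finite_subset pos_roots_ht by (intro sum_pos) auto
    then show False using that(2) ht_linear(4)[of "\<lambda>x. x" S] by (simp add: ht_linear)
  qed
  then have "weyl_denominator rho = (\<Sum>S\<in>Pow (pos_roots R \<alpha>). if S = {} then 1 else 0)"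
    unfolding weyl_denominator_def by (intro sum.cong) auto
  then show ?thesis by (simp add: finite_pos_roots)
qed

lemma det_fund_weights: "det (\<chi> i. fund_weight \<alpha> i) \<noteq> 0"
proof
  assume "det (\<chi> i. fund_weight \<alpha> i) = 0"
  then have "\<not> invertible ((\<chi> i. fund_weight \<alpha> i) :: real^'n^'n)"
    by (simp add: invertible_det_nz)
  then obtain x where x: "(\<chi> i. fund_weight \<alpha> i) *v x = 0" "x \<noteq> 0"
    using invertible_left_inverse matrix_left_invertible_ker by blast
  then have "fund_weight \<alpha> i \<bullet> x = 0" for i
    by (simp add: vec_eq_iff matrix_vector_mult_def inner_vec_def)
  then have "coord i x = 0" for i
    by (simp add: coord_def)
  then show False
    using x(2) coord_expansion[of x] by simp
qed

text \<open>Every entry of a tuple lies below its fundamental weight by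
  \<open>weight_tuples_coord\<close>, so a tuple with sum rho has equality in each place and only
  one term survives.\<close>

lemma weight_jacobian_rho: "weight_jacobian rho = det (\<chi> i. fund_weight \<alpha> i)"
proof -
  let ?\<omega> = "fund_weight \<alpha>"
  have "\<tau> = ?\<omega>" if "\<tau> \<in> weight_tuples" "(\<Sum>i\<in>UNIV. \<tau> i) = rho" for \<tau>
  proof
    fix i
    have "coord k (?\<omega> i - \<tau> i) = 0" for k
    proof -
      have "(\<Sum>i\<in>UNIV. coord k (?\<omega> i - \<tau> i)) = coord k (rho - (\<Sum>i\<in>UNIV. \<tau> i))"
        by (simp add: rho_def coord_linear sum_subtractf)
      also have "\<dots> = 0" by (simp add: that coord_linear)
      finally show ?thesis
        using weight_tuples_coord[OF that(1)] by (simp add: sum_nonneg_eq_0_iff)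
    qed
    then show "\<tau> i = ?\<omega> i"
      using coord_expansion[of "?\<omega> i - \<tau> i"] by simp
  qed
  then have "weight_jacobian rho = (\<Sum>\<tau>\<in>weight_tuples. if \<tau> = ?\<omega> then det (\<chi> i. ?\<omega> i) else 0)"
    unfolding weight_jacobian_def by (intro sum.cong) (auto simp: rho_def)
  moreover have "?\<omega> \<in> weight_tuples"
    by (auto simp: weight_tuples_def PiE_iff intro!: image_eqI[of _ _ id] refl_group.id)
  ultimately show ?thesis by (simp add: finite_weight_tuples)
qed

text \<open>This is Weyl's denominator formula in the guise \<open>J(\<chi>\<^sub>1, \<dots>, \<chi>\<^sub>n) = c \<cdot> e\<^sup>\<rho> \<Prod> (1 - e\<^sup>-\<^sup>\<beta>)\<close> for the
  Jacobian \<open>J\<close> of the orbit sums \<open>\<chi>\<^sub>i\<close> of the fundamental weights.\<close>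

lemma weight_jacobian_eq: "weight_jacobian \<mu> = weight_jacobian rho * weyl_denominator \<mu>"
proof -
  define g where "g \<mu> = weight_jacobian \<mu> - weight_jacobian rho * weyl_denominator \<mu>" for \<mu>
  have supp: "(\<exists>\<tau>\<in>weight_tuples. \<mu> = (\<Sum>i\<in>UNIV. \<tau> i)) \<or> (\<exists>S\<in>Pow (pos_roots R \<alpha>). \<mu> = rho - \<Sum>S)"
    if "g \<mu> \<noteq> 0" for \<mu>
  proof (rule ccontr)
    assume "\<not> ?thesis"
    then have "weight_jacobian \<mu> = 0" "weyl_denominator \<mu> = 0"
      unfolding weight_jacobian_def weyl_denominator_def by (auto intro!: sum.neutral)
    then show False using that by (simp add: g_def)
  qed
  have "{\<mu>. g \<mu> \<noteq> 0} \<subseteq> (\<lambda>\<tau>. \<Sum>i\<in>UNIV. \<tau> i) ` weight_tuples \<union> (\<lambda>S. rho - \<Sum>S) ` Pow (pos_roots R \<alpha>)"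
    using supp by blast
  then have fin: "finite {\<mu>. g \<mu> \<noteq> 0}"
    by (rule finite_subset) (simp add: finite_weight_tuples finite_pos_roots)
  have "g \<mu> = 0"
  proof (rule antiinvariant_zero[OF fin])
    fix i \<mu> show "g (s i \<mu>) = - g \<mu>"
      by (simp add: g_def weight_jacobian_s weyl_denominator_s)
  next
    fix \<mu> assume "g \<mu> \<noteq> 0"
    then show "\<mu> \<in> P"
      using supp[of \<mu>] P_sum[of UNIV] P_sum[of _ "\<lambda>x. x"] P_diff rho_in_P weight_tuples_P R_in_P pos_roots_in_R
      by (metis PowD subsetD)
  next
    fix \<mu> k assume "g \<mu> \<noteq> 0"
    from supp[OF this] show "coord k (rho - \<mu>) \<ge> 0"
    proof (elim disjE bexE)
      fix \<tau> assume t: "\<tau> \<in> weight_tuples" "\<mu> = (\<Sum>i\<in>UNIV. \<tau> i)"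
      have "coord k (rho - \<mu>) = (\<Sum>i\<in>UNIV. coord k (fund_weight \<alpha> i - \<tau> i))"
        by (simp add: t rho_def coord_linear sum_subtractf)
      then show ?thesis by (simp add: weight_tuples_coord t sum_nonneg)
    next
      fix S assume "S \<in> Pow (pos_roots R \<alpha>)" "\<mu> = rho - \<Sum>S"
      then show ?thesis
        by (auto simp: coord_linear intro!: sum_nonneg pos_roots_coord_nonneg)
    qed
  qed (simp add: g_def weyl_denominator_rho)
  then show ?thesis by (simp add: g_def)
qed

section \<open>Characters of the weight lattice and their stabilizers\<close>

lemma weight_char_zero: "weight_char \<alpha> t \<Longrightarrow> t 0 = 1"
  using P_zero unfolding weight_char_def by (metis add_0 mult_cancel_right1)

lemma weight_char_add: "weight_char \<alpha> t \<Longrightarrow> \<mu> \<in> P \<Longrightarrow> \<nu> \<in> P \<Longrightarrow> t (\<mu> + \<nu>) = t \<mu> * t \<nu>"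
  and weight_char_nonzero: "weight_char \<alpha> t \<Longrightarrow> \<mu> \<in> P \<Longrightarrow> t \<mu> \<noteq> 0"
  by (auto simp: weight_char_def)

lemma weight_char_uminus: "weight_char \<alpha> t \<Longrightarrow> \<mu> \<in> P \<Longrightarrow> t (- \<mu>) = inverse (t \<mu>)"
  using weight_char_add[of t \<mu> "- \<mu>"] weight_char_zero[of t] P_uminus[of \<mu>]
  by (simp add: inverse_unique)

lemma weight_char_sum:
  assumes t: "weight_char \<alpha> t" and "\<And>a. a \<in> A \<Longrightarrow> f a \<in> P" and "finite A"
  shows "t (sum f A) = (\<Prod>a\<in>A. t (f a))"
  using assms(3,2) by (induction A rule: finite_induct)
    (auto simp: weight_char_zero[OF t] weight_char_add[OF t] P_sum)

text \<open>The differentials at \<open>t\<close> of the orbit sums \<open>\<Sum>\<^sub>\<mu> X\<^sup>\<mu>\<close> (\<open>\<mu> \<in> W\<omega>\<^sub>i\<close>) are linearly independent,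
  and every element of the stabilizer of \<open>t\<close> fixes them.\<close>

lemma regular_weight_stabilizer_trivial:
  assumes t: "weight_char \<alpha> t" and reg: "\<And>\<beta>. \<beta> \<in> R \<Longrightarrow> t \<beta> \<noteq> 1"
    and z: "z \<in> W" and fixed: "\<And>\<mu>. \<mu> \<in> P \<Longrightarrow> t (z \<mu>) = t \<mu>"
  shows "z = id"
proof -
  let ?O = "\<lambda>i. (\<lambda>w. w (fund_weight \<alpha> i)) ` W"
  \<comment> \<open>Row i is the differential at t of the orbit sum of the i-th fundamental weight,
    in the coordinates of the ambient space.\<close>
  define M :: "complex ^ 'n ^ 'n" where "M = (\<chi> i j. \<Sum>\<mu>\<in>?O i. t \<mu> * of_real (\<mu> $ j))"
  have OP: "\<mu> \<in> P" if "\<mu> \<in> ?O i" for i \<mu>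
    using that fund_weight_in_P W_P by auto
  have finO: "finite (?O i)" for i
    by (simp add: finite_W)
  have "det M = (\<Sum>\<tau>\<in>weight_tuples. t (\<Sum>i\<in>UNIV. \<tau> i) * of_real (det (\<chi> i. \<tau> i)))"
  proof -
    have "det M = (\<Sum>p\<in>{p. p permutes UNIV}. of_int (sign p) *
        (\<Prod>i\<in>UNIV. \<Sum>\<mu>\<in>?O i. t \<mu> * of_real (\<mu> $ p i)))"
      by (simp add: det_def M_def)
    also have "\<dots> = (\<Sum>p\<in>{p. p permutes UNIV}. of_int (sign p) *
        (\<Sum>\<tau>\<in>weight_tuples. \<Prod>i\<in>UNIV. t (\<tau> i) * of_real (\<tau> i $ p i)))"
      unfolding weight_tuples_def by (subst prod_sum_PiE) (simp_all add: finO)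
    also have "\<dots> = (\<Sum>\<tau>\<in>weight_tuples. \<Sum>p\<in>{p. p permutes UNIV}. of_int (sign p) *
        (\<Prod>i\<in>UNIV. t (\<tau> i) * of_real (\<tau> i $ p i)))"
      by (subst sum.swap) (simp add: sum_distrib_left)
    also have "\<dots> = (\<Sum>\<tau>\<in>weight_tuples. (\<Prod>i\<in>UNIV. t (\<tau> i)) * of_real (det (\<chi> i. \<tau> i)))"
      by (simp add: det_def sum_distrib_left prod.distrib mult.left_commute)
    also have "\<dots> = (\<Sum>\<tau>\<in>weight_tuples. t (\<Sum>i\<in>UNIV. \<tau> i) * of_real (det (\<chi> i. \<tau> i)))"
      by (intro sum.cong) (auto simp: weight_char_sum[OF t] weight_tuples_P)
    finally show ?thesis .
  qed
  also have "\<dots> = of_real (weight_jacobian rho) *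
      (\<Sum>S\<in>Pow (pos_roots R \<alpha>). t (rho - \<Sum>S) * (-1) ^ card S)"
  proof -
    define N where "N = (\<lambda>\<tau>. \<Sum>i\<in>UNIV. \<tau> i) ` weight_tuples
      \<union> (\<lambda>S. rho - \<Sum>S) ` Pow (pos_roots R \<alpha>)"
    have fN: "finite N"
      by (simp add: N_def finite_weight_tuples finite_pos_roots)
    have 1: "(\<Sum>\<tau>\<in>weight_tuples. t (\<Sum>i\<in>UNIV. \<tau> i) * of_real (det (\<chi> i. \<tau> i)))
        = (\<Sum>\<mu>\<in>N. t \<mu> * of_real (weight_jacobian \<mu>))"
      unfolding weight_jacobian_def of_real_sum if_distrib[of of_real] of_real_0
      by (rule sum_fibres[OF fN]) (simp add: N_def)
    have 2: "(\<Sum>S\<in>Pow (pos_roots R \<alpha>). t (rho - \<Sum>S) * (-1) ^ card S)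
        = (\<Sum>\<mu>\<in>N. t \<mu> * of_real (weyl_denominator \<mu>))"
      unfolding weyl_denominator_def of_real_sum if_distrib[of of_real] of_real_0 of_real_power
        of_real_minus of_real_1
      by (rule sum_fibres[OF fN]) (simp add: N_def)
    show ?thesis
      unfolding 1 2 sum_distrib_left
      by (rule sum.cong) (simp, subst weight_jacobian_eq, simp)
  qed
  also have "(\<Sum>S\<in>Pow (pos_roots R \<alpha>). t (rho - \<Sum>S) * (-1) ^ card S)
      = t rho * (\<Prod>\<beta>\<in>pos_roots R \<alpha>. 1 - t (- \<beta>))"
  proof -
    have "t (rho - \<Sum>S) = t rho * (\<Prod>\<beta>\<in>S. t (- \<beta>))" if "S \<subseteq> pos_roots R \<alpha>" for S
    proof -
      have S: "- \<beta> \<in> P" if "\<beta> \<in> S" for \<beta>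
        using that \<open>S \<subseteq> _\<close> pos_roots_in_R R_in_P P_uminus by blast
      have "finite S"
        using that finite_pos_roots finite_subset by blast
      moreover have eq: "rho - \<Sum>S = rho + (\<Sum>\<beta>\<in>S. - \<beta>)"
        by (simp add: sum_negf)
      ultimately show ?thesis
        unfolding eq using weight_char_add[OF t rho_in_P P_sum[of S uminus]] weight_char_sum[OF t, of S uminus] S by simp
    qed
    then have "(\<Sum>S\<in>Pow (pos_roots R \<alpha>). t (rho - \<Sum>S) * (-1) ^ card S)
        = (\<Sum>S\<in>Pow (pos_roots R \<alpha>). t rho * ((-1) ^ card S * (\<Prod>\<beta>\<in>S. t (- \<beta>))))"
      by (intro sum.cong) auto
    then show ?thesis
      by (simp add: prod_one_minus finite_pos_roots sum_distrib_left)
  qed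
  finally have detM: "det M = of_real (weight_jacobian rho) * (t rho * (\<Prod>\<beta>\<in>pos_roots R \<alpha>. 1 - t (- \<beta>)))" .
  have "(\<Prod>\<beta>\<in>pos_roots R \<alpha>. 1 - t (- \<beta>)) \<noteq> 0"
    using reg uminus_R pos_roots_in_R finite_pos_roots by (auto simp: prod_zero_iff)
  then have "det M \<noteq> 0"
    unfolding detM using weight_char_nonzero[OF t rho_in_P] det_fund_weights
    by (simp add: weight_jacobian_rho)
  then have ker: "x = 0" if "M *v x = 0" for x
    using that by (metis invertible_det_nz invertible_left_inverse matrix_left_invertible_ker)
  have zO: "z \<mu> \<in> ?O i" if \<mu>: "\<mu> \<in> ?O i" for i \<mu>
  proof -
    obtain w where "w \<in> W" "\<mu> = w (fund_weight \<alpha> i)" using \<mu> by blast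
    then show ?thesis
      using refl_group_comp[OF z] by (intro image_eqI[of _ _ "z \<circ> w"]) auto
  qed
  have bij: "bij_betw z (?O i) (?O i)" for i
  proof -
    have "inj_on z (?O i)"
      using refl_group_bij[OF z] by (meson bij_is_inj inj_on_subset subset_UNIV)
    then show ?thesis
      using zO finO by (intro bij_betw_imageI) (simp_all add: endo_inj_surj image_subsetI)
  qed
  show ?thesis
  proof
    fix v
    \<comment> \<open>Row i pairs equally with z v and with v: reindexing the orbit by z changes
      neither t nor the inner products. So z v - v, read as a complex vector, lies in the kernel of
      M.\<close>
    define x :: "complex ^ 'n" where "x = (\<chi> j. of_real ((z v - v) $ j))"
    have "(M *v x) $ i = 0" for i
    proof -
      have "(M *v x) $ i = (\<Sum>j\<in>UNIV. \<Sum>\<mu>\<in>?O i. t \<mu> * of_real (\<mu> $ j * (z v - v) $ j))"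
        by (simp add: M_def x_def matrix_vector_mult_def sum_distrib_right mult.assoc)
      also have "\<dots> = (\<Sum>\<mu>\<in>?O i. t \<mu> * of_real (\<mu> \<bullet> (z v - v)))"
        by (subst sum.swap) (simp add: inner_vec_def sum_distrib_left)
      also have "\<dots> = (\<Sum>\<mu>\<in>?O i. t \<mu> * of_real (\<mu> \<bullet> z v)) - (\<Sum>\<mu>\<in>?O i. t \<mu> * of_real (\<mu> \<bullet> v))"
        by (simp add: inner_diff_right sum_subtractf right_diff_distrib)
      also have "(\<Sum>\<mu>\<in>?O i. t \<mu> * of_real (\<mu> \<bullet> z v)) = (\<Sum>\<mu>\<in>?O i. t (z \<mu>) * of_real (z \<mu> \<bullet> z v))"
        by (rule sum.reindex_bij_betw[OF bij, symmetric])
      also have "\<dots> = (\<Sum>\<mu>\<in>?O i. t \<mu> * of_real (\<mu> \<bullet> v))"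
        by (intro sum.cong) (auto simp: fixed refl_group_inner[OF z] dest!: OP)
      finally show ?thesis by simp
    qed
    then have "\<forall>i. (M *v x) $ i = 0 $ i"
      unfolding zero_index by (rule allI)
    then have "M *v x = 0"
      unfolding vec_eq_iff .
    then have "x = 0"
      by (rule ker)
    then show "z v = id v"
      by (simp add: x_def vec_eq_iff)
  qed
qed

text \<open>In general, multiply \<open>t\<close> by \<open>exp (\<epsilon> \<langle>\<cdot>, y\<rangle>)\<close> with \<open>y\<close> fixed by \<open>z\<close> and off the hyperplanes of the
  roots on which \<open>t\<close> is trivial; for all but finitely many \<open>\<epsilon>\<close> the product is regular.\<close>

lemma weight_stabilizer_trivial:
  assumes t: "weight_char \<alpha> t"
    and z: "z \<in> W" and fixed: "\<And>\<mu>. \<mu> \<in> P \<Longrightarrow> t (z \<mu>) = t \<mu>"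
    and pos: "\<And>\<beta>. \<beta> \<in> Z_set R \<alpha> t \<Longrightarrow> z \<beta> \<in> Z_set R \<alpha> t"
  shows "z = id"
proof -
  let ?Z = "Z_set R \<alpha> t"
  define G where "G = {u\<in>W. u ` ?Z = ?Z}"
  \<comment> \<open>Averaging over G makes y fixed by z. As G permutes the positive roots in
    \<open>?Z\<close>, every summand, and hence y, still pairs positively with each of them.\<close>
  define y where "y = (\<Sum>u\<in>G. u ht_vec)"
  have finZ: "finite ?Z"
    by (rule finite_subset[OF _ finite_R]) (auto simp: Z_set_def pos_roots_in_R)
  have zG: "z \<in> G"
  proof -
    have "inj_on z ?Z"
      using refl_group_bij[OF z] by (meson bij_is_inj inj_on_subset subset_UNIV)
    then show ?thesis
      using z pos finZ by (simp add: G_def endo_inj_surj image_subsetI)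
  qed
  have G_comp: "u \<circ> v \<in> G" if "u \<in> G" "v \<in> G" for u v
  proof -
    have "(u \<circ> v) ` ?Z = u ` v ` ?Z"
      by (simp add: image_comp)
    then show ?thesis
      using that unfolding G_def by (simp add: refl_group_comp del: comp_apply)
  qed
  have G_inv: "inv_into UNIV u \<in> G" if "u \<in> G" for u
  proof -
    have u: "u \<in> W" "u ` ?Z = ?Z"
      using that by (auto simp: G_def)
    have "inv_into UNIV u ` ?Z = inv_into UNIV u ` u ` ?Z"
      by (simp only: u(2))
    also have "\<dots> = ?Z"
      by (simp add: image_image refl_group_inv_apply[OF u(1)])
    finally show ?thesis
      using that by (simp add: G_def refl_group_inverse)
  qed
  have finG: "finite G"
    by (simp add: G_def finite_W)
  have zy: "z y = y"
  proof -
    have "z y = (\<Sum>u\<in>G. (z \<circ> u) ht_vec)"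
      by (simp add: y_def linear_sum[OF refl_group_linear[OF z]])
    also have "\<dots> = (\<Sum>u\<in>G. u ht_vec)"
      using z by (intro sum.reindex_bij_witness[of _ "\<lambda>u. inv_into UNIV z \<circ> u" "\<lambda>u. z \<circ> u"])
        (auto simp: fun_eq_iff intro!: G_comp zG G_inv)
    finally show ?thesis by (simp add: y_def)
  qed
  have Zy: "\<beta> \<bullet> y > 0" if "\<beta> \<in> ?Z" for \<beta>
  proof -
    have "\<beta> \<bullet> u ht_vec > 0" if u: "u \<in> G" for u
    proof -
      have uW: "u \<in> W" using u by (simp add: G_def)
      have "inv_into UNIV u \<beta> \<in> ?Z"
        using G_inv[OF u] \<open>\<beta> \<in> ?Z\<close> by (auto simp: G_def)
      then have "ht (inv_into UNIV u \<beta>) > 0"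
        by (intro pos_roots_ht) (simp add: Z_set_def)
      moreover have "\<beta> \<bullet> u ht_vec = inv_into UNIV u \<beta> \<bullet> ht_vec"
        using refl_group_inner[OF uW, of "inv_into UNIV u \<beta>" ht_vec] uW by simp
      ultimately show ?thesis by (simp add: ht_def inner_commute)
    qed
    then show ?thesis
      unfolding y_def inner_sum_right using finG zG by (intro sum_pos) auto
  qed
  have fin_bad: "finite {e. t \<beta> * of_real (exp (e * (\<beta> \<bullet> y))) = 1}" if \<beta>: "\<beta> \<in> R" for \<beta>
  proof (cases "\<beta> \<bullet> y = 0")
    case True
    have "t \<beta> \<noteq> 1"
    proof
      assume "t \<beta> = 1"
      then have "\<beta> \<in> ?Z \<or> - \<beta> \<in> ?Z"
        using root_pos_or_neg[OF \<beta>] weight_char_uminus[OF t R_in_P[OF \<beta>]] by (auto simp: Z_set_def)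
      then show False
        using Zy[of \<beta>] Zy[of "- \<beta>"] True by auto
    qed
    then show ?thesis by (simp add: True)
  next
    case False
    have "inj_on (\<lambda>e. complex_of_real (exp (e * (\<beta> \<bullet> y)))) UNIV"
      using False by (intro injI) simp
    then have "{e. t \<beta> * of_real (exp (e * (\<beta> \<bullet> y))) = 1}
        = (\<lambda>e. complex_of_real (exp (e * (\<beta> \<bullet> y)))) -` {1 / t \<beta>}"
      using weight_char_nonzero[OF t R_in_P[OF \<beta>]] by (auto simp: field_simps)
    then show ?thesis
      using \<open>inj_on _ _\<close> by (simp add: finite_vimageI)
  qed
  have "finite (\<Union>\<beta>\<in>R. {e. t \<beta> * of_real (exp (e * (\<beta> \<bullet> y))) = 1})"
    using fin_bad finite_R by blast
  then obtain e where e: "\<And>\<beta>. \<beta> \<in> R \<Longrightarrow> t \<beta> * of_real (exp (e * (\<beta> \<bullet> y))) \<noteq> 1"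
    using ex_new_if_finite[OF infinite_UNIV_char_0] by (metis (mono_tags, lifting) UN_I mem_Collect_eq)
  define t' where "t' = (\<lambda>\<mu>. t \<mu> * of_real (exp (e * (\<mu> \<bullet> y))))"
  show ?thesis
  proof (rule regular_weight_stabilizer_trivial[of t'])
    show "weight_char \<alpha> t'"
      using t by (auto simp: weight_char_def t'_def inner_add_left ring_distribs exp_add)
    show "t' \<beta> \<noteq> 1" if "\<beta> \<in> R" for \<beta>
      using e that by (simp add: t'_def)
    show "t' (z \<mu>) = t' \<mu>" if "\<mu> \<in> P" for \<mu>
    proof -
      have "z \<mu> \<bullet> y = \<mu> \<bullet> y"
        using refl_group_inner[OF z, of \<mu> y] by (simp add: zy)
      then show ?thesis by (simp add: t'_def fixed[OF that])
    qed
  qed (rule z)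
qed

end

section \<open>Braid relations in rank two\<close>

text \<open>This is T + q^-1. Its values agree at p and s p, and it squares to Q times itself when c
  p + c (s p) = Q; both facts drive the computations on polygons.\<close>

definition hop :: "('p \<Rightarrow> 'p) \<Rightarrow> ('p \<Rightarrow> complex) \<Rightarrow> ('p \<Rightarrow> complex) \<Rightarrow> 'p \<Rightarrow> complex"
  where "hop s c f p = c p * f p + c (s p) * f (s p)"

text \<open>The operators act on coefficient functions, not on basis vectors. The transition from s
  p into p therefore carries the coefficient c at its source s p.\<close>

definition hecke_op ::
    "complex \<Rightarrow> ('p \<Rightarrow> 'p) \<Rightarrow> ('p \<Rightarrow> complex) \<Rightarrow> ('p \<Rightarrow> complex) \<Rightarrow> 'p \<Rightarrow> complex"
  where "hecke_op q s c f p = (c p - inverse q) * f p + c (s p) * f (s p)"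

text \<open>For \<open>a = c(x)\<close>, \<open>b = c(y)\<close>, \<open>d = c(x y)\<close> and \<open>Q = q + q\<^sup>-\<^sup>1\<close> this is the addition formula of \<open>c\<close>.\<close>

definition c_relation :: "complex \<Rightarrow> complex \<Rightarrow> complex \<Rightarrow> complex \<Rightarrow> bool"
  where "c_relation Q a b d \<longleftrightarrow> a * b + Q * d - (a + b) * d - 1 = 0"

text \<open>
  In the identities below \<open>a\<^sub>0, a\<^sub>1, \<dots>\<close> are the values of \<open>c\<close> at the positive roots of a rank two system
  in convex order and the \<open>h\<close> are the values, on alternate edges of a \<open>2m\<close>-gon, of a function in the
  image of \<open>T\<^sub>i + q\<^sup>-\<^sup>1\<close>. The cofactors of the relations were found by solving linear equations.
\<close>

lemma braid_identity_3:
  assumes "c_relation Q a0 a2 a1"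
  shows "a0 * ((Q-a2)*h4 + a2*h0) + (Q-a0)*(a1*h0 + (Q-a1)*h2) - h0
    = a1*a2*h0 + (Q-a0)*(Q-a1)*h2 + a0*(Q-a2)*h4" (is "?l = ?r")
proof -
  have "?l - ?r = h0 * (a0 * a2 + Q * a1 - (a0 + a2) * a1 - 1)"
    by (simp add: algebra_simps)
  also have "\<dots> = 0" using assms unfolding c_relation_def by (simp only: mult_zero_right)
  finally show ?thesis by (simp only: right_minus_eq)
qed

text \<open>The suffixes \<open>short\<close> and \<open>long\<close> give the length of the simple
  root at \<open>a0\<close>. Starting at the other end of the convex order reverses the relations,
  but the left side is not symmetric under this reversal, so each start has its own
  identity.\<close>

lemma braid_identity_4_short:
  assumes "c_relation Q a0 a3 a2" "c_relation Q a0 a2 a1"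
    and "k0 = a0*h7 + (Q-a0)*h1" "k2 = a2*h1 + (Q-a2)*h3" "k6 = (Q-a2)*h5 + a2*h7"
  shows "a0 * ((Q-a3)*k6 + a3*k0) + (Q-a0)*(a1*k0 + (Q-a1)*k2) - 2*k0
    = a2*a3*(Q-a0)*h1 + (Q-a0)*(Q-a1)*(Q-a2)*h3 + (Q-a2)*(Q-a3)*a0*h5 + a0*a1*a2*h7" (is "?l = ?r")
proof -
  have "?l - ?r = (a0*h7 + (Q-a0)*h1) *
      ((a0 * a3 + Q * a2 - (a0 + a3) * a2 - 1) + (a0 * a2 + Q * a1 - (a0 + a2) * a1 - 1))"
    unfolding assms by (simp add: algebra_simps)
  also have "\<dots> = 0" using assms(1,2) unfolding c_relation_def by (simp only: mult_zero_right add_0)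
  finally show ?thesis by (simp only: right_minus_eq)
qed

lemma braid_identity_4_long:
  assumes "c_relation Q a0 a3 a1" "c_relation Q a1 a3 a2"
    and "k0 = a0*h7 + (Q-a0)*h1" "k2 = a2*h1 + (Q-a2)*h3" "k6 = (Q-a2)*h5 + a2*h7"
  shows "a0 * ((Q-a3)*k6 + a3*k0) + (Q-a0)*(a1*k0 + (Q-a1)*k2) - 2*k0
    = a2*a3*(Q-a0)*h1 + (Q-a0)*(Q-a1)*(Q-a2)*h3 + (Q-a2)*(Q-a3)*a0*h5 + a0*a1*a2*h7" (is "?l = ?r")
proof -
  have "?l - ?r = (a0*h7 + (Q-a0)*h1) *
      ((a0 * a3 + Q * a1 - (a0 + a3) * a1 - 1) + (a1 * a3 + Q * a2 - (a1 + a3) * a2 - 1))"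
    unfolding assms by (simp add: algebra_simps)
  also have "\<dots> = 0" using assms(1,2) unfolding c_relation_def by (simp only: mult_zero_right add_0)
  finally show ?thesis by (simp only: right_minus_eq)
qed

lemma braid_identity_6_long:
  assumes "c_relation Q a0 a5 a1" "c_relation Q a1 a5 a3" "c_relation Q a3 a5 a4" "c_relation Q a0 a4 a2" "c_relation Q a1 a3 a2"
    and k: "k0 = a0*h11 + (Q-a0)*h1" "k2 = a2*h1 + (Q-a2)*h3" "k4 = a4*h3 + (Q-a4)*h5"
      "k8 = (Q-a2)*h7 + a2*h9" "k10 = (Q-a4)*h9 + a4*h11"
    and l: "l1 = a1*k0 + (Q-a1)*k2" "l3 = a3*k2 + (Q-a3)*k4"
      "l9 = (Q-a3)*k8 + a3*k10" "l11 = (Q-a5)*k10 + a5*k0"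
    and m: "m0 = a0*l11 + (Q-a0)*l1" "m2 = a2*l1 + (Q-a2)*l3" "m10 = (Q-a4)*l9 + a4*l11"
  shows "a0 * ((Q-a5)*m10 + a5*m0) + (Q-a0)*(a1*m0 + (Q-a1)*m2) - 4*m0 + 3*k0
    = a2*a3*a4*a5*(Q-a0)*h1 + a4*a5*(Q-a0)*(Q-a1)*(Q-a2)*h3
      + (Q-a0)*(Q-a1)*(Q-a2)*(Q-a3)*(Q-a4)*h5 + (Q-a2)*(Q-a3)*(Q-a4)*(Q-a5)*a0*h7
      + (Q-a4)*(Q-a5)*a0*a1*a2*h9 + a0*a1*a2*a3*a4*h11" (is "?l = ?r")
proof -
  define r0 r1 r2 r3 r4 where "r0 = a0 * a5 + Q * a1 - (a0 + a5) * a1 - 1"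
    and "r1 = a1 * a5 + Q * a3 - (a1 + a5) * a3 - 1" and "r2 = a3 * a5 + Q * a4 - (a3 + a5) * a4 - 1"
    and "r3 = a0 * a4 + Q * a2 - (a0 + a4) * a2 - 1" and "r4 = a1 * a3 + Q * a2 - (a1 + a3) * a2 - 1"
  note r = r0_def r1_def r2_def r3_def r4_def
  have "?l - ?r = h9 * a0 * (Q-a4) * (Q-a5) * (r0 + r1 + r2 + r4)
      + h3 * (Q-a0) * (Q-a1) * (Q-a2) * (r0 + r1 + r2 + r4)
      + h11 * a0 * ((a0*a5 - a0*a1 + a1*a5 + a1*Q - 3 - a1*a2 - 2*a4*a5 + 2*a4*Q) * r0
        + (a1*a5 - a4*a5 + a4*Q) * r1 + (a1*a2 + a1*a5 - a1*Q - a4*a5 + a4*Q) * r2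
        + (a1*Q - a1*a5) * r3 + a1*a5 * r4)
      + h1 * (Q-a0) * ((a0*a5 - a0*a1 - 3 + a1*a5 + a1*Q - a4*a5 + 2*a2*Q - 2*a1*a2) * r0
        + (a1*a5 - a1*a2 + a2*Q) * r1 + a1*a5 * r2 + (a5*Q - a1*a5) * r3
        + (a1*a5 - a1*a2 + a2*Q + a4*a5 - a5*Q) * r4)"
    unfolding k l m r by (simp add: algebra_simps)
  moreover have "r0 = 0" "r1 = 0" "r2 = 0" "r3 = 0" "r4 = 0"
    using assms(1-5) unfolding r c_relation_def .
  ultimately show ?thesis by simp
qed

lemma braid_identity_6_short:
  assumes "c_relation Q a5 a0 a4" "c_relation Q a4 a0 a2" "c_relation Q a2 a0 a1" "c_relation Q a5 a1 a3" "c_relation Q a4 a2 a3"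
    and k: "k0 = a0*h11 + (Q-a0)*h1" "k2 = a2*h1 + (Q-a2)*h3" "k4 = a4*h3 + (Q-a4)*h5"
      "k8 = (Q-a2)*h7 + a2*h9" "k10 = (Q-a4)*h9 + a4*h11"
    and l: "l1 = a1*k0 + (Q-a1)*k2" "l3 = a3*k2 + (Q-a3)*k4"
      "l9 = (Q-a3)*k8 + a3*k10" "l11 = (Q-a5)*k10 + a5*k0"
    and m: "m0 = a0*l11 + (Q-a0)*l1" "m2 = a2*l1 + (Q-a2)*l3" "m10 = (Q-a4)*l9 + a4*l11"
  shows "a0 * ((Q-a5)*m10 + a5*m0) + (Q-a0)*(a1*m0 + (Q-a1)*m2) - 4*m0 + 3*k0
    = a2*a3*a4*a5*(Q-a0)*h1 + a4*a5*(Q-a0)*(Q-a1)*(Q-a2)*h3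
      + (Q-a0)*(Q-a1)*(Q-a2)*(Q-a3)*(Q-a4)*h5 + (Q-a2)*(Q-a3)*(Q-a4)*(Q-a5)*a0*h7
      + (Q-a4)*(Q-a5)*a0*a1*a2*h9 + a0*a1*a2*a3*a4*h11" (is "?l = ?r")
proof -
  define r0 r1 r2 r3 r4 where "r0 = a5 * a0 + Q * a4 - (a5 + a0) * a4 - 1"
    and "r1 = a4 * a0 + Q * a2 - (a4 + a0) * a2 - 1" and "r2 = a2 * a0 + Q * a1 - (a2 + a0) * a1 - 1"
    and "r3 = a5 * a1 + Q * a3 - (a5 + a1) * a3 - 1" and "r4 = a4 * a2 + Q * a3 - (a4 + a2) * a3 - 1"
  note r = r0_def r1_def r2_def r3_def r4_def
  have "?l - ?r = h9 * a0 * (Q-a4) * (Q-a5) * (r0 + r1 + r2 + r4)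
      + h3 * (Q-a0) * (Q-a1) * (Q-a2) * (r0 + r1 + r2 + r4)
      + h11 * a0 * ((a0*a5 - 3 - a4*a5 + a0*a4 + a4*Q - 2*a0*a1 - a2*a4 + 2*a1*Q) * r0
        + (a1*Q - a0*a1 + a0*a4) * r1 + (a1*Q - a0*a1 + a4*a5 - a4*Q + a0*a4) * r2
        + a2*a4 * r3 + (a4*Q - a4*a5) * r4)
      + h1 * (Q-a0) * ((a0*a5 - a0*a2 + a1*a2) * r0 + (a2*Q + a0*a5 - a0*a2) * r1
        + (a1*Q - a0*a1 - 3 + 2*a2*Q + 2*a0*a5 - a1*a2 - a0*a2 - a2*a4) * r2
        + a2*a4 * r3 + (a2*Q - a1*a2) * r4)"
    unfolding k l m r by (simp add: algebra_simps)
  moreover have "r0 = 0" "r1 = 0" "r2 = 0" "r3 = 0" "r4 = 0"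
    using assms(1-5) unfolding r c_relation_def .
  ultimately show ?thesis by simp
qed

locale two_hops =
  fixes q :: complex and s s' :: "'p \<Rightarrow> 'p" and c c' :: "'p \<Rightarrow> complex" and Q :: complex
  assumes q: "q \<noteq> 0" and Q: "Q = q + inverse q"
    and ss: "\<And>p. s (s p) = p" and ss': "\<And>p. s' (s' p) = p"
    and cc: "\<And>p. c (s p) = Q - c p" and cc': "\<And>p. c' (s' p) = Q - c' p"
begin

lemma swap: "two_hops q s' s c' c Q"
  using two_hops_axioms by (simp add: two_hops_def)

abbreviation "H \<equiv> hop s c"
abbreviation "H' \<equiv> hop s' c'"
abbreviation "T \<equiv> hecke_op q s c"
abbreviation "T' \<equiv> hecke_op q s' c'"

lemma hop_s: "H f (s p) = H f p" "H' f (s' p) = H' f p"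
  by (simp_all add: hop_def ss ss')

lemma hop_linear:
  "H (\<lambda>p. f p - g p) = (\<lambda>p. H f p - H g p)" "H' (\<lambda>p. f p - g p) = (\<lambda>p. H' f p - H' g p)"
  "H (\<lambda>p. k * f p) = (\<lambda>p. k * H f p)" "H' (\<lambda>p. k * f p) = (\<lambda>p. k * H' f p)"
  by (simp_all add: hop_def fun_eq_iff algebra_simps)

lemma hop_hop: "H (H f) = (\<lambda>p. Q * H f p)" "H' (H' f) = (\<lambda>p. Q * H' f p)"
proof -
  have "H (H f) p = (c p + c (s p)) * H f p" "H' (H' f) p = (c' p + c' (s' p)) * H' f p" for p
    by (simp_all add: hop_def[of _ _ "hop _ _ _"] hop_s algebra_simps)
  then show "H (H f) = (\<lambda>p. Q * H f p)" "H' (H' f) = (\<lambda>p. Q * H' f p)"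
    by (auto simp: cc cc' fun_eq_iff)
qed

lemma hecke_op_hop: "T = (\<lambda>f p. H f p - inverse q * f p)" "T' = (\<lambda>f p. H' f p - inverse q * f p)"
  by (simp_all add: hop_def hecke_op_def fun_eq_iff algebra_simps)

lemmas expand = hecke_op_hop hop_linear hop_hop

lemma quadratic: "T (T f) p = (q - inverse q) * T f p + f p"
  unfolding expand Q using q by (simp add: field_simps)

text \<open>The combinations of words in \<open>H\<close> and \<open>H'\<close> on the right are the two expressions for the
  Kazhdan--Lusztig basis element of the longest element of the dihedral group.\<close>

lemma hecke_word_2: "T (T' f) p - T' (T f) p = H (H' f) p - H' (H f) p"
  by (simp add: expand algebra_simps)

lemma hecke_word_3:
  "T (T' (T f)) p - T' (T (T' f)) p = (H (H' (H f)) p - H f p) - (H' (H (H' f)) p - H' f p)"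
proof -
  define r where "r = inverse q"
  have r: "r * q = 1" "q * r = 1" "r * (q * x) = x" "q * (r * x) = x" for x
    using q by (simp_all add: r_def)
  show ?thesis
    unfolding expand Q r_def[symmetric] by (simp add: r algebra_simps)
qed

lemma hecke_word_4:
  "T (T' (T (T' f))) p - T' (T (T' (T f))) p
    = (H (H' (H (H' f))) p - 2 * H (H' f) p) - (H' (H (H' (H f))) p - 2 * H' (H f) p)"
proof -
  define r where "r = inverse q"
  have r: "r * q = 1" "q * r = 1" "r * (q * x) = x" "q * (r * x) = x" for x
    using q by (simp_all add: r_def)
  show ?thesis
    unfolding expand Q r_def[symmetric] by (simp add: r algebra_simps)
qed

text \<open>The dihedral recursion C_(k+1) = H C_k' - C_(k-1), where the prime exchanges
  \<open>H\<close> and \<open>H'\<close>, produces the coefficients of the Chebyshev polynomials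
  U_(m-1)(x/2): x^2 - 1, x^3 - 2x and, here, x^5 - 4x^3 + 3x.\<close>

lemma hecke_word_6:
  "T (T' (T (T' (T (T' f))))) p - T' (T (T' (T (T' (T f))))) p
    = (H (H' (H (H' (H (H' f))))) p - 4 * H (H' (H (H' f))) p + 3 * H (H' f) p)
      - (H' (H (H' (H (H' (H f))))) p - 4 * H' (H (H' (H f))) p + 3 * H' (H f) p)"
proof -
  define r where "r = inverse q"
  have r: "r * q = 1" "q * r = 1" "r * (q * x) = x" "q * (r * x) = x" for x
    using q by (simp_all add: r_def)
  show ?thesis
    unfolding expand Q r_def[symmetric] by (simp add: r algebra_simps)
qed

end

definition braid_rels_3 :: "complex \<Rightarrow> complex \<Rightarrow> complex \<Rightarrow> complex \<Rightarrow> bool"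
  where "braid_rels_3 Q a0 a1 a2 \<longleftrightarrow> c_relation Q a0 a2 a1"

definition braid_rels_4 :: "complex \<Rightarrow> complex \<Rightarrow> complex \<Rightarrow> complex \<Rightarrow> complex \<Rightarrow> bool"
  where "braid_rels_4 Q a0 a1 a2 a3 \<longleftrightarrow> c_relation Q a0 a3 a1 \<and> c_relation Q a1 a3 a2"

text \<open>The positive roots of G2 in convex order, from the long simple root a to the short b,
  are a, a+b, 2a+3b, a+2b, a+3b, b. The five conditions are all the ways to write one of them as a
  sum of two others; \<open>braid_rels_3\<close> and \<open>braid_rels_4\<close> do the same for A2
  and C2.\<close>

definition braid_rels_6 ::
    "complex \<Rightarrow> complex \<Rightarrow> complex \<Rightarrow> complex \<Rightarrow> complex \<Rightarrow> complex \<Rightarrow> complex \<Rightarrow> bool"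
  where "braid_rels_6 Q a0 a1 a2 a3 a4 a5 \<longleftrightarrow>
    c_relation Q a0 a5 a1 \<and> c_relation Q a1 a5 a3 \<and> c_relation Q a3 a5 a4 \<and> c_relation Q a0 a4 a2 \<and> c_relation Q a1 a3 a2"

lemma c_relation_commute: "c_relation Q a b d \<longleftrightarrow> c_relation Q b a d"
  by (simp add: c_relation_def mult.commute add.commute)

context two_hops
begin

text \<open>The pattern of the whole \<open>hop_cycle\<close> family: the coefficient of f at each
  vertex is a product with one factor per positive root, either a_i or b_i = Q - a_i. Traversing the
  polygon backwards with s and s' exchanged gives the same sum, and this symmetry is the braid
  relation.\<close>

lemma hop_cycle_2:
  assumes p: "s p0 = p1" "s' p1 = p2" "s p2 = p3" "s' p3 = p0"
    and w: "c p0 = a0" "c' p1 = a1" "c p2 = b0" "c' p3 = b1"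
    and b: "b0 = Q - a0" "b1 = Q - a1"
  shows "H (H' f) p0 =
    a0*a1 * f p0 + b0*a1 * f p1 + b0*b1 * f p2 + a0*b1 * f p3"
proof -
  have V: "H g p0 = a0 * g p0 + b0 * g p1" "H' g p1 = a1 * g p1 + b1 * g p2"
    "H g p2 = b0 * g p2 + a0 * g p3" "H' g p3 = b1 * g p3 + a1 * g p0" for g
    using cc[of p0] cc'[of p1] cc[of p2] cc'[of p3]
    by (simp_all add: hop_def p w b)
  have E: "H g p1 = H g p0" "H' g p2 = H' g p1" "H g p3 = H g p2" "H' g p0 = H' g p3" for g
    using hop_s(1)[of g p0] hop_s(2)[of g p1] hop_s(1)[of g p2] hop_s(2)[of g p3]
    by (simp_all add: p)
  show ?thesis by (simp add: V E algebra_simps)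
qed

lemma hop_cycle_3:
  assumes p: "s p0 = p1" "s' p1 = p2" "s p2 = p3" "s' p3 = p4" "s p4 = p5" "s' p5 = p0"
    and w: "c p0 = a0" "c' p1 = a1" "c p2 = a2" "c' p3 = b0" "c p4 = b1" "c' p5 = b2"
    and b: "b0 = Q - a0" "b1 = Q - a1" "b2 = Q - a2"
    and rel: "braid_rels_3 Q a0 a1 a2 \<or> braid_rels_3 Q a2 a1 a0"
  shows "H (H' (H f)) p0 - H f p0 =
    a0*a1*a2 * f p0 + b0*a1*a2 * f p1 + b0*b1*a2 * f p2 + b0*b1*b2 * f p3 + a0*b1*b2 * f p4
    + a0*a1*b2 * f p5"
proof -
  have V: "H g p0 = a0 * g p0 + b0 * g p1" "H' g p1 = a1 * g p1 + b1 * g p2"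
    "H g p2 = a2 * g p2 + b2 * g p3" "H' g p3 = b0 * g p3 + a0 * g p4"
    "H g p4 = b1 * g p4 + a1 * g p5" "H' g p5 = b2 * g p5 + a2 * g p0" for g
    using cc[of p0] cc'[of p1] cc[of p2] cc'[of p3] cc[of p4] cc'[of p5]
    by (simp_all add: hop_def p w b)
  have E: "H g p1 = H g p0" "H' g p2 = H' g p1" "H g p3 = H g p2" "H' g p4 = H' g p3"
    "H g p5 = H g p4" "H' g p0 = H' g p5" for g
    using hop_s(1)[of g p0] hop_s(2)[of g p1] hop_s(1)[of g p2] hop_s(2)[of g p3] hop_s(1)[of g p4]
      hop_s(2)[of g p5]
    by (simp_all add: p)
  have O: "H (H' (H g)) p0 = a0 * ((Q-a2)*H g p4 + a2*H g p0) + (Q-a0) * (a1*H g p0 + (Q-a1)*H g p2)" for g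
    by (simp only: V E b)
  have "c_relation Q a0 a2 a1"
    using rel by (simp add: braid_rels_3_def c_relation_commute)
  note identity = braid_identity_3[OF this, of "H f p4" "H f p0" "H f p2"]
  show ?thesis
    unfolding O[of f] unfolding identity unfolding V b[symmetric] by (simp add: algebra_simps)
qed

lemma hop_cycle_4:
  assumes p: "s p0 = p1" "s' p1 = p2" "s p2 = p3" "s' p3 = p4" "s p4 = p5" "s' p5 = p6" "s p6 = p7"
      "s' p7 = p0"
    and w: "c p0 = a0" "c' p1 = a1" "c p2 = a2" "c' p3 = a3" "c p4 = b0" "c' p5 = b1" "c p6 = b2"
      "c' p7 = b3"
    and b: "b0 = Q - a0" "b1 = Q - a1" "b2 = Q - a2" "b3 = Q - a3"
    and rel: "braid_rels_4 Q a0 a1 a2 a3 \<or> braid_rels_4 Q a3 a2 a1 a0"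
  shows "H (H' (H (H' f))) p0 - 2 * H (H' f) p0 =
    a0*a1*a2*a3 * f p0 + b0*a1*a2*a3 * f p1 + b0*b1*a2*a3 * f p2 + b0*b1*b2*a3 * f p3
    + b0*b1*b2*b3 * f p4 + a0*b1*b2*b3 * f p5 + a0*a1*b2*b3 * f p6 + a0*a1*a2*b3 * f p7"
proof -
  have V: "H g p0 = a0 * g p0 + b0 * g p1" "H' g p1 = a1 * g p1 + b1 * g p2"
    "H g p2 = a2 * g p2 + b2 * g p3" "H' g p3 = a3 * g p3 + b3 * g p4"
    "H g p4 = b0 * g p4 + a0 * g p5" "H' g p5 = b1 * g p5 + a1 * g p6"
    "H g p6 = b2 * g p6 + a2 * g p7" "H' g p7 = b3 * g p7 + a3 * g p0" for g
    using cc[of p0] cc'[of p1] cc[of p2] cc'[of p3] cc[of p4] cc'[of p5] cc[of p6] cc'[of p7]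
    by (simp_all add: hop_def p w b)
  have E: "H g p1 = H g p0" "H' g p2 = H' g p1" "H g p3 = H g p2" "H' g p4 = H' g p3"
    "H g p5 = H g p4" "H' g p6 = H' g p5" "H g p7 = H g p6" "H' g p0 = H' g p7" for g
    using hop_s(1)[of g p0] hop_s(2)[of g p1] hop_s(1)[of g p2] hop_s(2)[of g p3] hop_s(1)[of g p4]
      hop_s(2)[of g p5] hop_s(1)[of g p6] hop_s(2)[of g p7]
    by (simp_all add: p)
  have K: "H (H' g) p0 = a0*H' g p7 + (Q-a0)*H' g p1" "H (H' g) p2 = a2*H' g p1 + (Q-a2)*H' g p3"
    "H (H' g) p6 = (Q-a2)*H' g p5 + a2*H' g p7" for g
    by (simp_all only: V E b)
  have O: "H (H' (H g)) p0 = a0 * ((Q-a3)*H g p6 + a3*H g p0) + (Q-a0) * (a1*H g p0 + (Q-a1)*H g p2)" for g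
    by (simp only: V E b)
  show ?thesis
    using rel
  proof
    assume "braid_rels_4 Q a0 a1 a2 a3"
    then have "c_relation Q a0 a3 a1" "c_relation Q a1 a3 a2"
      by (auto simp: braid_rels_4_def)
    note identity = braid_identity_4_long[OF this K[of f]]
    show ?thesis
      unfolding O[of "H' f"] unfolding identity unfolding V b[symmetric]
      by (simp add: algebra_simps)
  next
    assume "braid_rels_4 Q a3 a2 a1 a0"
    then have "c_relation Q a0 a3 a2" "c_relation Q a0 a2 a1"
      by (auto simp: braid_rels_4_def c_relation_commute)
    note identity = braid_identity_4_short[OF this K[of f]]
    show ?thesis
      unfolding O[of "H' f"] unfolding identity unfolding V b[symmetric]
      by (simp add: algebra_simps)
  qed
qed

lemma hop_cycle_6:
  assumes p: "s p0 = p1" "s' p1 = p2" "s p2 = p3" "s' p3 = p4" "s p4 = p5" "s' p5 = p6" "s p6 = p7"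
      "s' p7 = p8" "s p8 = p9" "s' p9 = p10" "s p10 = p11" "s' p11 = p0"
    and w: "c p0 = a0" "c' p1 = a1" "c p2 = a2" "c' p3 = a3" "c p4 = a4" "c' p5 = a5" "c p6 = b0"
      "c' p7 = b1" "c p8 = b2" "c' p9 = b3" "c p10 = b4" "c' p11 = b5"
    and b: "b0 = Q - a0" "b1 = Q - a1" "b2 = Q - a2" "b3 = Q - a3" "b4 = Q - a4" "b5 = Q - a5"
    and rel: "braid_rels_6 Q a0 a1 a2 a3 a4 a5 \<or> braid_rels_6 Q a5 a4 a3 a2 a1 a0"
  shows "H (H' (H (H' (H (H' f))))) p0 - 4 * H (H' (H (H' f))) p0 + 3 * H (H' f) p0 =
    a0*a1*a2*a3*a4*a5 * f p0 + b0*a1*a2*a3*a4*a5 * f p1 + b0*b1*a2*a3*a4*a5 * f p2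
    + b0*b1*b2*a3*a4*a5 * f p3 + b0*b1*b2*b3*a4*a5 * f p4 + b0*b1*b2*b3*b4*a5 * f p5
    + b0*b1*b2*b3*b4*b5 * f p6 + a0*b1*b2*b3*b4*b5 * f p7 + a0*a1*b2*b3*b4*b5 * f p8
    + a0*a1*a2*b3*b4*b5 * f p9 + a0*a1*a2*a3*b4*b5 * f p10 + a0*a1*a2*a3*a4*b5 * f p11"
proof -
  have V: "H g p0 = a0 * g p0 + b0 * g p1" "H' g p1 = a1 * g p1 + b1 * g p2"
    "H g p2 = a2 * g p2 + b2 * g p3" "H' g p3 = a3 * g p3 + b3 * g p4"
    "H g p4 = a4 * g p4 + b4 * g p5" "H' g p5 = a5 * g p5 + b5 * g p6"
    "H g p6 = b0 * g p6 + a0 * g p7" "H' g p7 = b1 * g p7 + a1 * g p8"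
    "H g p8 = b2 * g p8 + a2 * g p9" "H' g p9 = b3 * g p9 + a3 * g p10"
    "H g p10 = b4 * g p10 + a4 * g p11" "H' g p11 = b5 * g p11 + a5 * g p0" for g
    using cc[of p0] cc'[of p1] cc[of p2] cc'[of p3] cc[of p4] cc'[of p5] cc[of p6] cc'[of p7]
      cc[of p8] cc'[of p9] cc[of p10] cc'[of p11]
    by (simp_all add: hop_def p w b)
  have E: "H g p1 = H g p0" "H' g p2 = H' g p1" "H g p3 = H g p2" "H' g p4 = H' g p3"
    "H g p5 = H g p4" "H' g p6 = H' g p5" "H g p7 = H g p6" "H' g p8 = H' g p7"
    "H g p9 = H g p8" "H' g p10 = H' g p9" "H g p11 = H g p10" "H' g p0 = H' g p11" for g
    using hop_s(1)[of g p0] hop_s(2)[of g p1] hop_s(1)[of g p2] hop_s(2)[of g p3] hop_s(1)[of g p4]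
      hop_s(2)[of g p5] hop_s(1)[of g p6] hop_s(2)[of g p7] hop_s(1)[of g p8] hop_s(2)[of g p9]
      hop_s(1)[of g p10] hop_s(2)[of g p11]
    by (simp_all add: p)
  have K: "H (H' g) p0 = a0*H' g p11 + (Q-a0)*H' g p1" "H (H' g) p2 = a2*H' g p1 + (Q-a2)*H' g p3"
    "H (H' g) p4 = a4*H' g p3 + (Q-a4)*H' g p5" "H (H' g) p8 = (Q-a2)*H' g p7 + a2*H' g p9"
    "H (H' g) p10 = (Q-a4)*H' g p9 + a4*H' g p11" for g
    by (simp_all only: V E b)
  have L: "H' (H g) p1 = a1*H g p0 + (Q-a1)*H g p2" "H' (H g) p3 = a3*H g p2 + (Q-a3)*H g p4"
    "H' (H g) p9 = (Q-a3)*H g p8 + a3*H g p10" "H' (H g) p11 = (Q-a5)*H g p10 + a5*H g p0" for g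
    by (simp_all only: V E b)
  have O: "H (H' (H g)) p0 = a0 * ((Q-a5)*H g p10 + a5*H g p0) + (Q-a0) * (a1*H g p0 + (Q-a1)*H g p2)" for g
    by (simp only: V E b)
  note KLK = K[of f] L[of "H' f"] K(1,2,5)[of "H (H' f)"]
  show ?thesis
    using rel
  proof
    assume "braid_rels_6 Q a0 a1 a2 a3 a4 a5"
    then have "c_relation Q a0 a5 a1" "c_relation Q a1 a5 a3" "c_relation Q a3 a5 a4" "c_relation Q a0 a4 a2" "c_relation Q a1 a3 a2"
      by (auto simp: braid_rels_6_def)
    note identity = braid_identity_6_long[OF this KLK]
    show ?thesis
      unfolding O[of "H' (H (H' f))"] unfolding identity unfolding V b[symmetric]
      by (simp add: algebra_simps)
  next
    assume "braid_rels_6 Q a5 a4 a3 a2 a1 a0"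
    then have "c_relation Q a5 a0 a4" "c_relation Q a4 a0 a2" "c_relation Q a2 a0 a1" "c_relation Q a5 a1 a3" "c_relation Q a4 a2 a3"
      by (auto simp: braid_rels_6_def)
    note identity = braid_identity_6_short[OF this KLK]
    show ?thesis
      unfolding O[of "H' (H (H' f))"] unfolding identity unfolding V b[symmetric]
      by (simp add: algebra_simps)
  qed
qed

end

text \<open>The value at \<open>1\<close> makes \<open>cfun_inverse\<close> hold for all nonzero \<open>x\<close>.\<close>

definition cfun :: "complex \<Rightarrow> complex \<Rightarrow> complex"
  where "cfun q x = (if x = 1 then (q + inverse q) / 2 else (q * x - inverse q) / (x - 1))"

lemma cfun_inverse: "x \<noteq> 0 \<Longrightarrow> cfun q (inverse x) = q + inverse q - cfun q x"
  by (cases "x = 1") (auto simp: cfun_def divide_simps, simp_all add: algebra_simps)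

lemma cfun_c_relation:
  assumes "x \<noteq> 1" "y \<noteq> 1" "x * y \<noteq> 1" "q \<noteq> 0"
  shows "c_relation (q + inverse q) (cfun q x) (cfun q y) (cfun q (x * y))"
proof -
  have "x - 1 \<noteq> 0" "y - 1 \<noteq> 0" "x * y - 1 \<noteq> 0" using assms by auto
  then show ?thesis
    using assms by (simp add: c_relation_def cfun_def divide_simps) (simp add: algebra_simps)
qed

text \<open>\<open>X p\<close> and \<open>Y p\<close> model the values of the weight at p on the two
  simple roots, and k, l the negated Cartan integers. \<open>D\<close> will be a coset of
  \<open>W_ij\<close> on which the weight is regular along the rank two system.\<close>

locale rank_two_weights = two_hops q s s' c c' Q
  for q :: complex and s s' :: "'p \<Rightarrow> 'p" and c c' Q +
  fixes D :: "'p set" and X Y :: "'p \<Rightarrow> complex" and k l :: nat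
  assumes D: "p \<in> D \<Longrightarrow> s p \<in> D" "p \<in> D \<Longrightarrow> s' p \<in> D"
    and weight: "p \<in> D \<Longrightarrow> c p = cfun q (X p)" "p \<in> D \<Longrightarrow> c' p = cfun q (Y p)"
    and nonzero: "p \<in> D \<Longrightarrow> X p \<noteq> 0" "p \<in> D \<Longrightarrow> Y p \<noteq> 0"
    and nonunit: "p \<in> D \<Longrightarrow> X p \<noteq> 1" "p \<in> D \<Longrightarrow> Y p \<noteq> 1"
    and s_act: "p \<in> D \<Longrightarrow> X (s p) = inverse (X p)" "p \<in> D \<Longrightarrow> Y (s p) = Y p * X p ^ l"
    and s'_act: "p \<in> D \<Longrightarrow> X (s' p) = X p * Y p ^ k" "p \<in> D \<Longrightarrow> Y (s' p) = inverse (Y p)"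
begin

lemma braid_2:
  assumes "k = 0" "l = 0" and p: "p \<in> D"
    and closed: "s' (s (s' (s p))) = p"
  shows "T (T' f) p = T' (T f) p"
proof -
  define p1 p2 p3
    where "p1 = s p" and "p2 = s' p1" and "p3 = s p2"
  note p_defs = p1_def p2_def p3_def
  define x y where "x = X p" and "y = Y p"
  have adj: "s p = p1" "s' p1 = p2" "s p2 = p3" "s' p3 = p"
    using closed by (simp_all only: p_defs)
  have D: "p1 \<in> D" "p2 \<in> D" "p3 \<in> D"
    by (simp_all add: p_defs D p)
  note nz = nonzero[OF p, folded x_def y_def]
  have V0: "X p = x" "Y p = y"
    by (simp_all add: x_def y_def)
  have V1: "X p1 = inverse x" "Y p1 = y"
    using s_act[of p] s'_act[of p] p nz
    by (simp_all add: p1_def V0 assms(1,2) field_simps power2_eq_square power3_eq_cube)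
  have V2: "X p2 = inverse x" "Y p2 = inverse y"
    using s_act[of p1] s'_act[of p1] D(1) nz
    by (simp_all add: p2_def V1 assms(1,2) field_simps power2_eq_square power3_eq_cube)
  have V3: "X p3 = x" "Y p3 = inverse y"
    using s_act[of p2] s'_act[of p2] D(2) nz
    by (simp_all add: p3_def V2 assms(1,2) field_simps power2_eq_square power3_eq_cube)
  have ne: "x \<noteq> 1" "y \<noteq> 1"
    using nonunit[OF p] nonunit[OF D(1)]
    by (simp_all add: V0 V1)
  have w: "c p = cfun q (x)" "c' p1 = cfun q (y)" "c p2 = Q - cfun q (x)" "c' p3 = Q - cfun q (y)"
    using nz by (simp_all add: weight p D V0 V1 V2 V3 cfun_inverse Q del: inverse_mult_distrib)
  interpret swapped: two_hops q s' s c' c Q by (rule swap)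
  have w': "c' p = cfun q (y)" "c p3 = cfun q (x)" "c' p2 = Q - cfun q (y)" "c p1 = Q - cfun q (x)"
    using w cc[of p] cc'[of p1] cc[of p2] cc'[of p3]
    by (simp_all add: adj)
  have adj': "s' p = p3" "s p3 = p2" "s' p2 = p1" "s p1 = p"
    using adj ss ss' by metis+
  show ?thesis
    using hecke_word_2[of f p] hop_cycle_2[OF adj w HOL.refl HOL.refl, of f] swapped.hop_cycle_2[OF adj' w' HOL.refl HOL.refl, of f]
    by (simp add: algebra_simps)
qed

text \<open>Along the closed walk the edges carry the positive roots in convex order, then their
  inverses, where c becomes Q - c. The backward walk meets them in reverse order, so it uses the
  second alternative for \<open>rel\<close> in \<open>hop_cycle_3\<close>. \<open>braid_4\<close>
  and \<open>braid_6\<close> have the same structure.\<close>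

lemma braid_3:
  assumes "k = 1" "l = 1" and p: "p \<in> D"
    and closed: "s' (s (s' (s (s' (s p))))) = p"
  shows "T (T' (T f)) p = T' (T (T' f)) p"
proof -
  define p1 p2 p3 p4 p5
    where "p1 = s p" and "p2 = s' p1" and "p3 = s p2" and "p4 = s' p3" and "p5 = s p4"
  note p_defs = p1_def p2_def p3_def p4_def p5_def
  define x y where "x = X p" and "y = Y p"
  have adj: "s p = p1" "s' p1 = p2" "s p2 = p3" "s' p3 = p4" "s p4 = p5" "s' p5 = p"
    using closed by (simp_all only: p_defs)
  have D: "p1 \<in> D" "p2 \<in> D" "p3 \<in> D" "p4 \<in> D" "p5 \<in> D"
    by (simp_all add: p_defs D p)
  note nz = nonzero[OF p, folded x_def y_def]
  have V0: "X p = x" "Y p = y"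
    by (simp_all add: x_def y_def)
  have V1: "X p1 = inverse x" "Y p1 = x*y"
    using s_act[of p] s'_act[of p] p nz
    by (simp_all add: p1_def V0 assms(1,2) field_simps power2_eq_square power3_eq_cube)
  have V2: "X p2 = y" "Y p2 = inverse (x*y)"
    using s_act[of p1] s'_act[of p1] D(1) nz
    by (simp_all add: p2_def V1 assms(1,2) field_simps power2_eq_square power3_eq_cube)
  have V3: "X p3 = inverse y" "Y p3 = inverse x"
    using s_act[of p2] s'_act[of p2] D(2) nz
    by (simp_all add: p3_def V2 assms(1,2) field_simps power2_eq_square power3_eq_cube)
  have V4: "X p4 = inverse (x*y)" "Y p4 = x"
    using s_act[of p3] s'_act[of p3] D(3) nz
    by (simp_all add: p4_def V3 assms(1,2) field_simps power2_eq_square power3_eq_cube)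
  have V5: "X p5 = x*y" "Y p5 = inverse y"
    using s_act[of p4] s'_act[of p4] D(4) nz
    by (simp_all add: p5_def V4 assms(1,2) field_simps power2_eq_square power3_eq_cube)
  have ne: "x \<noteq> 1" "x*y \<noteq> 1" "y \<noteq> 1"
    using nonunit[OF p] nonunit[OF D(1)] nonunit[OF D(2)]
    by (simp_all add: V0 V1 V2)
  have w: "c p = cfun q (x)" "c' p1 = cfun q (x*y)" "c p2 = cfun q (y)" "c' p3 = Q - cfun q (x)"
    "c p4 = Q - cfun q (x*y)" "c' p5 = Q - cfun q (y)"
    using nz by (simp_all add: weight p D V0 V1 V2 V3 V4 V5 cfun_inverse Q del: inverse_mult_distrib)
  have rel: "braid_rels_3 Q (cfun q (x)) (cfun q (x*y)) (cfun q (y))"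
    unfolding braid_rels_3_def
    using cfun_c_relation[OF ne(1) ne(3), of q] ne q
    by (simp_all add: Q mult_ac power2_eq_square power3_eq_cube)
  interpret swapped: two_hops q s' s c' c Q by (rule swap)
  have w': "c' p = cfun q (y)" "c p5 = cfun q (x*y)" "c' p4 = cfun q (x)" "c p3 = Q - cfun q (y)"
    "c' p2 = Q - cfun q (x*y)" "c p1 = Q - cfun q (x)"
    using w cc[of p] cc'[of p1] cc[of p2] cc'[of p3] cc[of p4] cc'[of p5]
    by (simp_all add: adj)
  have adj': "s' p = p5" "s p5 = p4" "s' p4 = p3" "s p3 = p2" "s' p2 = p1" "s p1 = p"
    using adj ss ss' by metis+
  show ?thesis
    using hecke_word_3[of f p] hop_cycle_3[OF adj w HOL.refl HOL.refl HOL.refl disjI1[OF rel], of f]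
      swapped.hop_cycle_3[OF adj' w' HOL.refl HOL.refl HOL.refl disjI2[OF rel], of f]
    by (simp only: mult_ac add_ac diff_self) simp
qed

lemma braid_4:
  assumes "k = 2" "l = 1" and p: "p \<in> D"
    and closed: "s' (s (s' (s (s' (s (s' (s p))))))) = p"
  shows "T (T' (T (T' f))) p = T' (T (T' (T f))) p"
proof -
  define p1 p2 p3 p4 p5 p6 p7
    where "p1 = s p" and "p2 = s' p1" and "p3 = s p2" and "p4 = s' p3" and "p5 = s p4"
      and "p6 = s' p5" and "p7 = s p6"
  note p_defs = p1_def p2_def p3_def p4_def p5_def p6_def p7_def
  define x y where "x = X p" and "y = Y p"
  have adj: "s p = p1" "s' p1 = p2" "s p2 = p3" "s' p3 = p4" "s p4 = p5" "s' p5 = p6" "s p6 = p7"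
    "s' p7 = p"
    using closed by (simp_all only: p_defs)
  have D: "p1 \<in> D" "p2 \<in> D" "p3 \<in> D" "p4 \<in> D" "p5 \<in> D" "p6 \<in> D" "p7 \<in> D"
    by (simp_all add: p_defs D p)
  note nz = nonzero[OF p, folded x_def y_def]
  have V0: "X p = x" "Y p = y"
    by (simp_all add: x_def y_def)
  have V1: "X p1 = inverse x" "Y p1 = x*y"
    using s_act[of p] s'_act[of p] p nz
    by (simp_all add: p1_def V0 assms(1,2) field_simps power2_eq_square power3_eq_cube)
  have V2: "X p2 = x*y^2" "Y p2 = inverse (x*y)"
    using s_act[of p1] s'_act[of p1] D(1) nz
    by (simp_all add: p2_def V1 assms(1,2) field_simps power2_eq_square power3_eq_cube)
  have V3: "X p3 = inverse (x*y^2)" "Y p3 = y"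
    using s_act[of p2] s'_act[of p2] D(2) nz
    by (simp_all add: p3_def V2 assms(1,2) field_simps power2_eq_square power3_eq_cube)
  have V4: "X p4 = inverse x" "Y p4 = inverse y"
    using s_act[of p3] s'_act[of p3] D(3) nz
    by (simp_all add: p4_def V3 assms(1,2) field_simps power2_eq_square power3_eq_cube)
  have V5: "X p5 = x" "Y p5 = inverse (x*y)"
    using s_act[of p4] s'_act[of p4] D(4) nz
    by (simp_all add: p5_def V4 assms(1,2) field_simps power2_eq_square power3_eq_cube)
  have V6: "X p6 = inverse (x*y^2)" "Y p6 = x*y"
    using s_act[of p5] s'_act[of p5] D(5) nz
    by (simp_all add: p6_def V5 assms(1,2) field_simps power2_eq_square power3_eq_cube)
  have V7: "X p7 = x*y^2" "Y p7 = inverse y"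
    using s_act[of p6] s'_act[of p6] D(6) nz
    by (simp_all add: p7_def V6 assms(1,2) field_simps power2_eq_square power3_eq_cube)
  have ne: "x \<noteq> 1" "x*y \<noteq> 1" "x*y^2 \<noteq> 1" "y \<noteq> 1"
    using nonunit[OF p] nonunit[OF D(1)] nonunit[OF D(2)] nonunit[OF D(3)]
    by (simp_all add: V0 V1 V2 V3)
  have w: "c p = cfun q (x)" "c' p1 = cfun q (x*y)" "c p2 = cfun q (x*y^2)" "c' p3 = cfun q (y)"
    "c p4 = Q - cfun q (x)" "c' p5 = Q - cfun q (x*y)" "c p6 = Q - cfun q (x*y^2)"
    "c' p7 = Q - cfun q (y)"
    using nz by (simp_all add: weight p D V0 V1 V2 V3 V4 V5 V6 V7 cfun_inverse Q del: inverse_mult_distrib)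
  have rel: "braid_rels_4 Q (cfun q (x)) (cfun q (x*y)) (cfun q (x*y^2)) (cfun q (y))"
    unfolding braid_rels_4_def
    using cfun_c_relation[OF ne(1) ne(4), of q] cfun_c_relation[OF ne(2) ne(4), of q] ne q
    by (simp_all add: Q mult_ac power2_eq_square power3_eq_cube)
  interpret swapped: two_hops q s' s c' c Q by (rule swap)
  have w': "c' p = cfun q (y)" "c p7 = cfun q (x*y^2)" "c' p6 = cfun q (x*y)" "c p5 = cfun q (x)"
    "c' p4 = Q - cfun q (y)" "c p3 = Q - cfun q (x*y^2)" "c' p2 = Q - cfun q (x*y)"
    "c p1 = Q - cfun q (x)"
    using w cc[of p] cc'[of p1] cc[of p2] cc'[of p3] cc[of p4] cc'[of p5] cc[of p6] cc'[of p7]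
    by (simp_all add: adj)
  have adj': "s' p = p7" "s p7 = p6" "s' p6 = p5" "s p5 = p4" "s' p4 = p3" "s p3 = p2" "s' p2 = p1"
    "s p1 = p"
    using adj ss ss' by metis+
  show ?thesis
    using hecke_word_4[of f p] hop_cycle_4[OF adj w HOL.refl HOL.refl HOL.refl HOL.refl disjI1[OF rel], of f]
      swapped.hop_cycle_4[OF adj' w' HOL.refl HOL.refl HOL.refl HOL.refl disjI2[OF rel], of f]
    by (simp only: mult_ac add_ac diff_self) simp
qed

lemma braid_6:
  assumes "k = 3" "l = 1" and p: "p \<in> D"
    and closed: "s' (s (s' (s (s' (s (s' (s (s' (s (s' (s p))))))))))) = p"
  shows "T (T' (T (T' (T (T' f))))) p = T' (T (T' (T (T' (T f))))) p"
proof -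
  define p1 p2 p3 p4 p5 p6 p7 p8 p9 p10 p11
    where "p1 = s p" and "p2 = s' p1" and "p3 = s p2" and "p4 = s' p3" and "p5 = s p4"
      and "p6 = s' p5" and "p7 = s p6" and "p8 = s' p7" and "p9 = s p8" and "p10 = s' p9"
      and "p11 = s p10"
  note p_defs = p1_def p2_def p3_def p4_def p5_def p6_def p7_def p8_def p9_def p10_def p11_def
  define x y where "x = X p" and "y = Y p"
  have adj: "s p = p1" "s' p1 = p2" "s p2 = p3" "s' p3 = p4" "s p4 = p5" "s' p5 = p6" "s p6 = p7"
    "s' p7 = p8" "s p8 = p9" "s' p9 = p10" "s p10 = p11" "s' p11 = p"
    using closed by (simp_all only: p_defs)
  have D: "p1 \<in> D" "p2 \<in> D" "p3 \<in> D" "p4 \<in> D" "p5 \<in> D" "p6 \<in> D" "p7 \<in> D"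
    "p8 \<in> D" "p9 \<in> D" "p10 \<in> D" "p11 \<in> D"
    by (simp_all add: p_defs D p)
  note nz = nonzero[OF p, folded x_def y_def]
  have V0: "X p = x" "Y p = y"
    by (simp_all add: x_def y_def)
  have V1: "X p1 = inverse x" "Y p1 = x*y"
    using s_act[of p] s'_act[of p] p nz
    by (simp_all add: p1_def V0 assms(1,2) field_simps power2_eq_square power3_eq_cube)
  have V2: "X p2 = x^2*y^3" "Y p2 = inverse (x*y)"
    using s_act[of p1] s'_act[of p1] D(1) nz
    by (simp_all add: p2_def V1 assms(1,2) field_simps power2_eq_square power3_eq_cube)
  have V3: "X p3 = inverse (x^2*y^3)" "Y p3 = x*y^2"
    using s_act[of p2] s'_act[of p2] D(2) nz
    by (simp_all add: p3_def V2 assms(1,2) field_simps power2_eq_square power3_eq_cube)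
  have V4: "X p4 = x*y^3" "Y p4 = inverse (x*y^2)"
    using s_act[of p3] s'_act[of p3] D(3) nz
    by (simp_all add: p4_def V3 assms(1,2) field_simps power2_eq_square power3_eq_cube)
  have V5: "X p5 = inverse (x*y^3)" "Y p5 = y"
    using s_act[of p4] s'_act[of p4] D(4) nz
    by (simp_all add: p5_def V4 assms(1,2) field_simps power2_eq_square power3_eq_cube)
  have V6: "X p6 = inverse x" "Y p6 = inverse y"
    using s_act[of p5] s'_act[of p5] D(5) nz
    by (simp_all add: p6_def V5 assms(1,2) field_simps power2_eq_square power3_eq_cube)
  have V7: "X p7 = x" "Y p7 = inverse (x*y)"
    using s_act[of p6] s'_act[of p6] D(6) nz
    by (simp_all add: p7_def V6 assms(1,2) field_simps power2_eq_square power3_eq_cube)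
  have V8: "X p8 = inverse (x^2*y^3)" "Y p8 = x*y"
    using s_act[of p7] s'_act[of p7] D(7) nz
    by (simp_all add: p8_def V7 assms(1,2) field_simps power2_eq_square power3_eq_cube)
  have V9: "X p9 = x^2*y^3" "Y p9 = inverse (x*y^2)"
    using s_act[of p8] s'_act[of p8] D(8) nz
    by (simp_all add: p9_def V8 assms(1,2) field_simps power2_eq_square power3_eq_cube)
  have V10: "X p10 = inverse (x*y^3)" "Y p10 = x*y^2"
    using s_act[of p9] s'_act[of p9] D(9) nz
    by (simp_all add: p10_def V9 assms(1,2) field_simps power2_eq_square power3_eq_cube)
  have V11: "X p11 = x*y^3" "Y p11 = inverse y"
    using s_act[of p10] s'_act[of p10] D(10) nz
    by (simp_all add: p11_def V10 assms(1,2) field_simps power2_eq_square power3_eq_cube)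
  have ne: "x \<noteq> 1" "x*y \<noteq> 1" "x^2*y^3 \<noteq> 1" "x*y^2 \<noteq> 1" "x*y^3 \<noteq> 1"
    "y \<noteq> 1"
    using nonunit[OF p] nonunit[OF D(1)] nonunit[OF D(2)] nonunit[OF D(3)] nonunit[OF D(4)] nonunit[OF D(5)]
    by (simp_all add: V0 V1 V2 V3 V4 V5)
  have w: "c p = cfun q (x)" "c' p1 = cfun q (x*y)" "c p2 = cfun q (x^2*y^3)" "c' p3 = cfun q (x*y^2)"
    "c p4 = cfun q (x*y^3)" "c' p5 = cfun q (y)" "c p6 = Q - cfun q (x)"
    "c' p7 = Q - cfun q (x*y)" "c p8 = Q - cfun q (x^2*y^3)" "c' p9 = Q - cfun q (x*y^2)"
    "c p10 = Q - cfun q (x*y^3)" "c' p11 = Q - cfun q (y)"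
    using nz by (simp_all add: weight p D V0 V1 V2 V3 V4 V5 V6 V7 V8 V9 V10 V11 cfun_inverse Q del: inverse_mult_distrib)
  have rel: "braid_rels_6 Q (cfun q (x)) (cfun q (x*y)) (cfun q (x^2*y^3)) (cfun q (x*y^2)) (cfun q (x*y^3)) (cfun q (y))"
    unfolding braid_rels_6_def
    using cfun_c_relation[OF ne(1) ne(6), of q] cfun_c_relation[OF ne(2) ne(6), of q]
      cfun_c_relation[OF ne(4) ne(6), of q] cfun_c_relation[OF ne(1) ne(5), of q]
      cfun_c_relation[OF ne(2) ne(4), of q] ne q
    by (simp_all add: Q mult_ac power2_eq_square power3_eq_cube)
  interpret swapped: two_hops q s' s c' c Q by (rule swap)
  have w': "c' p = cfun q (y)" "c p11 = cfun q (x*y^3)" "c' p10 = cfun q (x*y^2)"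
    "c p9 = cfun q (x^2*y^3)" "c' p8 = cfun q (x*y)" "c p7 = cfun q (x)"
    "c' p6 = Q - cfun q (y)" "c p5 = Q - cfun q (x*y^3)" "c' p4 = Q - cfun q (x*y^2)"
    "c p3 = Q - cfun q (x^2*y^3)" "c' p2 = Q - cfun q (x*y)" "c p1 = Q - cfun q (x)"
    using w cc[of p] cc'[of p1] cc[of p2] cc'[of p3] cc[of p4] cc'[of p5] cc[of p6] cc'[of p7]
      cc[of p8] cc'[of p9] cc[of p10] cc'[of p11]
    by (simp_all add: adj)
  have adj': "s' p = p11" "s p11 = p10" "s' p10 = p9" "s p9 = p8" "s' p8 = p7" "s p7 = p6" "s' p6 = p5"
    "s p5 = p4" "s' p4 = p3" "s p3 = p2" "s' p2 = p1" "s p1 = p"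
    using adj ss ss' by metis+
  show ?thesis
    using hecke_word_6[of f p] hop_cycle_6[OF adj w HOL.refl HOL.refl HOL.refl HOL.refl HOL.refl HOL.refl disjI1[OF rel], of f]
      swapped.hop_cycle_6[OF adj' w' HOL.refl HOL.refl HOL.refl HOL.refl HOL.refl HOL.refl disjI2[OF rel], of f]
    by (simp only: mult_ac add_ac diff_self) simp
qed

end

section \<open>Rank two subsystems\<close>

context simple_root_system
begin

text \<open>Otherwise the root s_i alpha_j would have coefficient 1 at alpha_j and a negative one at
  alpha_i.\<close>

lemma copair_simple_nonpos:
  assumes "i \<noteq> j"
  shows "copair (\<alpha> j) (\<alpha> i) \<le> 0"
proof (rule ccontr)
  assume a: "\<not> ?thesis"
  let ?\<beta> = "s i (\<alpha> j)"
  have "?\<beta> \<in> R" by (simp add: refl_at_R simple_in_R)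
  moreover have "coord j ?\<beta> = 1" "coord i ?\<beta> = - copair (\<alpha> j) (\<alpha> i)"
    using assms by (auto simp: refl_at_def coord_linear coord_simple)
  ultimately show False
    using root_pos_or_neg[of ?\<beta>] pos_roots_coord_nonneg[of ?\<beta> i] pos_roots_coord_nonneg[of "- ?\<beta>" j] a
    by (auto simp: coord_linear)
qed

lemma copair_simple_mult_less:
  assumes "i \<noteq> j"
  shows "copair (\<alpha> j) (\<alpha> i) * copair (\<alpha> i) (\<alpha> j) < 4"
proof -
  have "\<bar>\<alpha> i \<bullet> \<alpha> j\<bar> \<noteq> norm (\<alpha> i) * norm (\<alpha> j)"
  proof
    assume "\<bar>\<alpha> i \<bullet> \<alpha> j\<bar> = norm (\<alpha> i) * norm (\<alpha> j)"
    then have "norm (\<alpha> i) *\<^sub>R \<alpha> j = norm (\<alpha> j) *\<^sub>R \<alpha> i \<or> norm (\<alpha> i) *\<^sub>R \<alpha> j = - norm (\<alpha> j) *\<^sub>R \<alpha> i"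
      by (simp add: norm_cauchy_schwarz_abs_eq)
    then have "coord j (norm (\<alpha> i) *\<^sub>R \<alpha> j) = coord j (norm (\<alpha> j) *\<^sub>R \<alpha> i)
        \<or> coord j (norm (\<alpha> i) *\<^sub>R \<alpha> j) = coord j (- norm (\<alpha> j) *\<^sub>R \<alpha> i)"
      by metis
    then show False
      using assms simple_nonzero[of i] by (simp add: coord_linear coord_simple)
  qed
  moreover have "\<bar>\<alpha> i \<bullet> \<alpha> j\<bar> \<le> norm (\<alpha> i) * norm (\<alpha> j)"
    by (rule Cauchy_Schwarz_ineq2)
  ultimately have "\<bar>\<alpha> i \<bullet> \<alpha> j\<bar> < norm (\<alpha> i) * norm (\<alpha> j)" by simp
  then have "\<bar>\<alpha> i \<bullet> \<alpha> j\<bar>\<^sup>2 < (norm (\<alpha> i) * norm (\<alpha> j))\<^sup>2"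
    by (intro power_strict_mono) auto
  then have "(\<alpha> i \<bullet> \<alpha> j) * (\<alpha> i \<bullet> \<alpha> j) < (\<alpha> i \<bullet> \<alpha> i) * (\<alpha> j \<bullet> \<alpha> j)"
    by (simp add: power_mult_distrib power2_eq_square[of "\<alpha> i \<bullet> \<alpha> j"] power2_norm_eq_inner)
  moreover have "\<alpha> i \<bullet> \<alpha> i > 0" "\<alpha> j \<bullet> \<alpha> j > 0"
    using simple_nonzero by auto
  ultimately show ?thesis
    by (simp add: copair_def inner_commute[of "\<alpha> j" "\<alpha> i"] divide_simps)
qed

lemma cartan_cases:
  assumes "i \<noteq> j"
  shows "(copair (\<alpha> j) (\<alpha> i), copair (\<alpha> i) (\<alpha> j)) \<in>
    {(0, 0), (-1, -1), (-1, -2), (-2, -1), (-1, -3), (-3, -1)}"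
proof -
  obtain a b :: int where ab: "copair (\<alpha> j) (\<alpha> i) = of_int b" "copair (\<alpha> i) (\<alpha> j) = of_int a"
    using copair_Ints simple_in_R by (metis Ints_cases)
  have np: "a \<le> 0" "b \<le> 0"
    using copair_simple_nonpos[OF assms] copair_simple_nonpos[OF assms[symmetric]] by (simp_all add: ab)
  have "real_of_int (b * a) < of_int 4"
    using copair_simple_mult_less[OF assms] by (simp add: ab)
  then have lt: "b * a < 4" by (simp only: of_int_less_iff)
  have zero: "a = 0 \<longleftrightarrow> b = 0"
  proof -
    have "a = 0 \<longleftrightarrow> \<alpha> i \<bullet> \<alpha> j = 0" "b = 0 \<longleftrightarrow> \<alpha> i \<bullet> \<alpha> j = 0"
      using ab simple_nonzero by (auto simp: copair_def inner_commute)
    then show ?thesis by simp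
  qed
  have "(b, a) \<in> {(0, 0), (-1, -1), (-1, -2), (-2, -1), (-1, -3), (-3, -1)}"
  proof (cases "a = 0")
    case False
    then have "a \<le> -1" "b \<le> -1" using np zero by auto
    then have "- a * 1 \<le> - a * - b" "1 * - b \<le> - a * - b"
      by (intro mult_left_mono mult_right_mono; simp)+
    then have "- 4 < a" "- 4 < b" using lt by (auto simp: mult.commute)
    then have "a \<in> {-3, -2, -1}" "b \<in> {-3, -2, -1}" using \<open>a \<le> -1\<close> \<open>b \<le> -1\<close> by auto
    then show ?thesis using lt by auto
  qed (use zero in auto)
  then show ?thesis by (auto simp: ab)
qed

lemma s_coords:
  "s i (x + a *\<^sub>R \<alpha> i + b *\<^sub>R \<alpha> j)
    = x + (- copair x (\<alpha> i) - a - b * copair (\<alpha> j) (\<alpha> i)) *\<^sub>R \<alpha> i + b *\<^sub>R \<alpha> j"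
  "s j (x + a *\<^sub>R \<alpha> i + b *\<^sub>R \<alpha> j)
    = x + a *\<^sub>R \<alpha> i + (- copair x (\<alpha> j) - b - a * copair (\<alpha> i) (\<alpha> j)) *\<^sub>R \<alpha> j"
proof -
  have "copair (\<alpha> k) (\<alpha> k) = 2" for k
    using simple_nonzero[of k] by (simp add: copair_def)
  then show "s i (x + a *\<^sub>R \<alpha> i + b *\<^sub>R \<alpha> j)
    = x + (- copair x (\<alpha> i) - a - b * copair (\<alpha> j) (\<alpha> i)) *\<^sub>R \<alpha> i + b *\<^sub>R \<alpha> j"
  "s j (x + a *\<^sub>R \<alpha> i + b *\<^sub>R \<alpha> j)
    = x + a *\<^sub>R \<alpha> i + (- copair x (\<alpha> j) - b - a * copair (\<alpha> i) (\<alpha> j)) *\<^sub>R \<alpha> j"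
    unfolding refl_at_def by (simp_all add: vec_eq_iff copair_linear algebra_simps)
qed

text \<open>A power of s_i s_j moves x by a combination of alpha_i and alpha_j whose coefficients
  depend only on the Cartan integers a, b and the pairings xi, xj of x. The order of s_i s_j thus
  becomes a symbolic calculation.\<close>

fun rot_coeffs :: "real \<Rightarrow> real \<Rightarrow> real \<Rightarrow> real \<Rightarrow> nat \<Rightarrow> real \<times> real" where
  "rot_coeffs a b xi xj 0 = (0, 0)"
| "rot_coeffs a b xi xj (Suc n) =
    (let (u, v) = rot_coeffs a b xi xj n; v' = - xj - v - u * a in (- xi - u - v' * b, v'))"

lemma rot_power:
  "((s i \<circ> s j) ^^ n) x = x + fst (rot_coeffs (copair (\<alpha> i) (\<alpha> j)) (copair (\<alpha> j) (\<alpha> i)) (copair x (\<alpha> i)) (copair x (\<alpha> j)) n) *\<^sub>R \<alpha> i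
    + snd (rot_coeffs (copair (\<alpha> i) (\<alpha> j)) (copair (\<alpha> j) (\<alpha> i)) (copair x (\<alpha> i)) (copair x (\<alpha> j)) n) *\<^sub>R \<alpha> j"
  by (induction n) (simp_all add: s_coords Let_def split_beta)

lemma coxeter_m_eq:
  assumes "i \<noteq> j" "0 < m"
    and id: "\<And>xi xj. rot_coeffs (copair (\<alpha> i) (\<alpha> j)) (copair (\<alpha> j) (\<alpha> i)) xi xj m = (0, 0)"
    and less: "\<And>k. 0 < k \<Longrightarrow> k < m \<Longrightarrow>
      fst (rot_coeffs (copair (\<alpha> i) (\<alpha> j)) (copair (\<alpha> j) (\<alpha> i)) 1 0 k) \<noteq> 0"
  shows "coxeter_m \<alpha> i j = m" and "((s i \<circ> s j) ^^ m) x = x"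
proof -
  have m: "((s i \<circ> s j) ^^ m) x = x" for x
    by (simp add: rot_power id)
  then show "((s i \<circ> s j) ^^ m) x = x" .
  have "m \<le> k" if k: "0 < k" "(s i \<circ> s j) ^^ k = id" for k
  proof (rule ccontr)
    assume "\<not> m \<le> k"
    \<comment> \<open>The fundamental weight has pairings 1 and 0 with the two coroots; its
      displacement shows that a smaller power is not the identity.\<close>
    let ?\<omega> = "fund_weight \<alpha> i"
    let ?r = "rot_coeffs (copair (\<alpha> i) (\<alpha> j)) (copair (\<alpha> j) (\<alpha> i)) 1 0 k"
    have "?\<omega> = ?\<omega> + fst ?r *\<^sub>R \<alpha> i + snd ?r *\<^sub>R \<alpha> j"
      using rot_power[where n = k and i = i and j = j and x = ?\<omega>] k(2) assms(1)
      by (simp add: copair_fund_weight[OF simple])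
    then have "coord i ?\<omega> = coord i (?\<omega> + fst ?r *\<^sub>R \<alpha> i + snd ?r *\<^sub>R \<alpha> j)"
      by (rule arg_cong)
    then have "fst ?r = 0"
      using assms(1) by (simp add: coord_linear coord_simple)
    then show False
      using less[of k] k(1) \<open>\<not> m \<le> k\<close> by simp
  qed
  then show "coxeter_m \<alpha> i j = m"
    unfolding coxeter_m_def using assms(2) m by (intro Least_equality) (auto simp: fun_eq_iff)
qed

lemma coxeter_m_cases:
  assumes "i \<noteq> j"
  shows
    "copair (\<alpha> j) (\<alpha> i) = 0 \<Longrightarrow> coxeter_m \<alpha> i j = 2 \<and> ((s i \<circ> s j) ^^ 2) x = x"
    "copair (\<alpha> j) (\<alpha> i) = -1 \<Longrightarrow> copair (\<alpha> i) (\<alpha> j) = -1 \<Longrightarrow>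
      coxeter_m \<alpha> i j = 3 \<and> ((s i \<circ> s j) ^^ 3) x = x"
    "copair (\<alpha> j) (\<alpha> i) * copair (\<alpha> i) (\<alpha> j) = 2 \<Longrightarrow>
      coxeter_m \<alpha> i j = 4 \<and> ((s i \<circ> s j) ^^ 4) x = x"
    "copair (\<alpha> j) (\<alpha> i) * copair (\<alpha> i) (\<alpha> j) = 3 \<Longrightarrow>
      coxeter_m \<alpha> i j = 6 \<and> ((s i \<circ> s j) ^^ 6) x = x"
proof -
  note cases = cartan_cases[OF assms]
  note r = numeral_eq_Suc Let_def
  have less: "k \<in> {1}" if "0 < k" "k < (2::nat)" for k using that by auto
  have less3: "k \<in> {1, 2}" if "0 < k" "k < (3::nat)" for k using that by auto
  have less4: "k \<in> {1, 2, 3}" if "0 < k" "k < (4::nat)" for k using that by auto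
  have less6: "k \<in> {1, 2, 3, 4, 5}" if "0 < k" "k < (6::nat)" for k using that by auto
  show "coxeter_m \<alpha> i j = 2 \<and> ((s i \<circ> s j) ^^ 2) x = x" if "copair (\<alpha> j) (\<alpha> i) = 0"
    using cases that by (intro conjI coxeter_m_eq[OF assms]) (auto dest!: less simp: r)
  show "coxeter_m \<alpha> i j = 3 \<and> ((s i \<circ> s j) ^^ 3) x = x"
    if "copair (\<alpha> j) (\<alpha> i) = -1" "copair (\<alpha> i) (\<alpha> j) = -1"
    using that by (intro conjI coxeter_m_eq[OF assms]) (auto dest!: less3 simp: r)
  show "coxeter_m \<alpha> i j = 4 \<and> ((s i \<circ> s j) ^^ 4) x = x"
    if "copair (\<alpha> j) (\<alpha> i) * copair (\<alpha> i) (\<alpha> j) = 2"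
    using cases that by (intro conjI coxeter_m_eq[OF assms]) (auto dest!: less4 simp: r)
  show "coxeter_m \<alpha> i j = 6 \<and> ((s i \<circ> s j) ^^ 6) x = x"
    if "copair (\<alpha> j) (\<alpha> i) * copair (\<alpha> i) (\<alpha> j) = 3"
    using cases that by (intro conjI coxeter_m_eq[OF assms]) (auto dest!: less6 simp: r)
qed

end

section \<open>Operators on functions on the tableaux\<close>

locale skew_shape = simple_root_system R \<alpha>
  for R :: "(real ^ 'n) set" and \<alpha> :: "'n \<Rightarrow> real ^ 'n" +
  fixes q :: complex and t :: "real ^ 'n \<Rightarrow> complex" and J :: "(real ^ 'n) set"
  assumes q_nonzero: "q \<noteq> 0" and q_root: "\<And>k :: nat. k > 0 \<Longrightarrow> q ^ k \<noteq> 1"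
    and skew: "placed_skew_shape R \<alpha> q t J"
begin

abbreviation "F \<equiv> std_tableaux R \<alpha> q t J"

lemma t_char: "weight_char \<alpha> t" and F_nonempty: "F \<noteq> {}"
  using skew by (auto simp: placed_skew_shape_def placed_shape_def)

lemma F_W: "w \<in> F \<Longrightarrow> w \<in> W"
  by (simp add: std_tableaux_def)

lemma finite_F: "finite F"
  by (rule finite_subset[OF _ finite_W]) (auto simp: F_W)

section \<open>Weights and signs of roots under left multiplication by simple reflections\<close>

definition sl :: "'n \<Rightarrow> (real ^ 'n \<Rightarrow> real ^ 'n) \<Rightarrow> real ^ 'n \<Rightarrow> real ^ 'n"
  where "sl i w = s i \<circ> w"

lemma sl_apply: "sl i w x = s i (w x)" and sl_sl [simp]: "sl i (sl i w) = w"
  by (simp_all add: sl_def fun_eq_iff)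

lemma s_W_iff: "sl i w \<in> W \<longleftrightarrow> w \<in> W"
  by (metis refl_group_comp s_in_W sl_def sl_sl)

lemma weyl_act_apply: "w \<in> W \<Longrightarrow> weyl_act w t (w \<nu>) = t \<nu>"
  by (simp add: weyl_act_def)

lemma weyl_act_char:
  assumes "w \<in> W"
  shows "weight_char \<alpha> (weyl_act w t)"
proof -
  have i: "inv_into UNIV w \<in> W" using assms refl_group_inverse by blast
  show ?thesis
    using t_char W_P[OF i] linear_add[OF refl_group_linear[OF i]]
    by (auto simp: weight_char_def weyl_act_def)
qed

lemma weyl_act_s: "w \<in> W \<Longrightarrow> weyl_act (sl i w) t \<nu> = weyl_act w t (s i \<nu>)"
  by (simp add: sl_def weyl_act_comp[OF s_in_W] weyl_act_refl)

lemma weyl_act_simple_nonzero: "w \<in> W \<Longrightarrow> weyl_act w t (\<alpha> i) \<noteq> 0"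
  using weight_char_nonzero[OF weyl_act_char R_in_P[OF simple_in_R]] .

lemma weyl_act_s_simple: "w \<in> W \<Longrightarrow> weyl_act (sl i w) t (\<alpha> i) = inverse (weyl_act w t (\<alpha> i))"
  by (simp add: weyl_act_s refl_at_self weight_char_uminus[OF weyl_act_char R_in_P[OF simple_in_R]])

text \<open>Both calibratable alternatives exclude the value 1 at simple roots, so any partner j of
  i will do; rank one is covered by its own clause.\<close>

lemma weyl_act_not_one: "w \<in> F \<Longrightarrow> weyl_act w t (\<alpha> i) \<noteq> 1"
proof -
  assume w: "w \<in> F"
  show ?thesis
  proof (cases "CARD('n) = 1")
    case True
    then show ?thesis using skew w by (auto simp: placed_skew_shape_def)
  next
    case False
    have "\<exists>j. i \<noteq> j"
    proof (rule ccontr)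
      assume "\<not> ?thesis"
      then have "(UNIV :: 'n set) = {i}" by auto
      then have "CARD('n) = card {i}" by (rule arg_cong)
      with False show False by simp
    qed
    then obtain j where "i \<noteq> j" by blast
    then have "calibratable \<alpha> q (weyl_act w t) i j"
      using skew w by (auto simp: placed_skew_shape_def)
    moreover have "\<alpha> i \<in> rank2_roots \<alpha> i j"
      unfolding rank2_roots_def by (intro UN_I[OF refl_group.id]) simp
    ultimately show ?thesis
      by (auto simp: calibratable_def calibratable_special_def)
  qed
qed

lemma q_powers: "q\<^sup>2 \<noteq> 1" "q ^ 4 \<noteq> 1" "q ^ 6 \<noteq> 1" "q\<^sup>2 \<noteq> inverse (q\<^sup>2)" "q\<^sup>2 + 1 \<noteq> 0"
  "inverse (q\<^sup>2) \<noteq> 1" "inverse (q ^ 4) \<noteq> 1" "q ^ 4 \<noteq> inverse (q\<^sup>2)" "q ^ 4 \<noteq> q\<^sup>2"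
proof -
  show 2: "q\<^sup>2 \<noteq> 1" and 4: "q ^ 4 \<noteq> 1" and 6: "q ^ 6 \<noteq> 1" using q_root by simp_all
  show "q\<^sup>2 \<noteq> inverse (q\<^sup>2)"
    using 4 q_nonzero by (auto simp: field_simps power_add[symmetric])
  show "q\<^sup>2 + 1 \<noteq> 0"
  proof
    assume "q\<^sup>2 + 1 = 0"
    then have "q\<^sup>2 * q\<^sup>2 = 1" by (simp add: add_eq_0_iff2)
    then show False using 4 by (simp add: power_add[symmetric])
  qed
  show "inverse (q\<^sup>2) \<noteq> 1" "inverse (q ^ 4) \<noteq> 1" using 2 4 by simp_all
  show "q ^ 4 \<noteq> inverse (q\<^sup>2)" using 6 q_nonzero by (auto simp: field_simps power_add[symmetric])
  show "q ^ 4 \<noteq> q\<^sup>2"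
  proof
    assume "q ^ 4 = q\<^sup>2"
    then have "q\<^sup>2 * q\<^sup>2 = q\<^sup>2 * 1" by (simp add: power_add[symmetric])
    then show False using 2 q_nonzero by (metis mult_left_cancel power_eq_0_iff)
  qed
qed

text \<open>A root of value q^-2 is the negative of one of value q^2. Letting beta run over all of R
  with value q^2 hence records the same data as the inversions inside P(t), in a form that is
  monotone along nonzero matrix entries.\<close>

definition active :: "(real ^ 'n \<Rightarrow> real ^ 'n) \<Rightarrow> (real ^ 'n) set"
  where "active w = {\<beta>\<in>R. t \<beta> = q\<^sup>2 \<and> ht (w \<beta>) > 0}"

lemma inversions_iff: "w \<in> W \<Longrightarrow> \<beta> \<in> inversions R \<alpha> w \<longleftrightarrow> \<beta> \<in> pos_roots R \<alpha> \<and> ht (w \<beta>) < 0"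
  using neg_iff_ht W_R pos_roots_in_R by (auto simp: inversions_def)

lemma F_iff:
  assumes w0: "w0 \<in> F" and w: "w \<in> W"
  shows "w \<in> F \<longleftrightarrow> (\<forall>\<beta>\<in>Z_set R \<alpha> t. ht (w \<beta>) > 0) \<and> active w = active w0"
proof -
  have w0W: "w0 \<in> W" using w0 F_W by blast
  have sign: "ht (v \<beta>) < 0 \<longleftrightarrow> \<not> ht (v \<beta>) > 0" if "v \<in> W" "\<beta> \<in> R" for v \<beta>
    using ht_root_nonzero W_R that by (meson not_less_iff_gr_or_eq)
  have "inversions R \<alpha> w \<inter> Z_set R \<alpha> t = {} \<longleftrightarrow> (\<forall>\<beta>\<in>Z_set R \<alpha> t. ht (w \<beta>) > 0)"
    using inversions_iff[OF w] sign[OF w] pos_roots_in_R by (auto simp: Z_set_def)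
  moreover have "inversions R \<alpha> w \<inter> P_set R \<alpha> q t = inversions R \<alpha> w0 \<inter> P_set R \<alpha> q t
      \<longleftrightarrow> active w = active w0" (is "?l \<longleftrightarrow> ?r")
  proof
    assume l: ?l
    have "ht (w \<beta>) > 0 \<longleftrightarrow> ht (w0 \<beta>) > 0" if \<beta>: "\<beta> \<in> R" "t \<beta> = q\<^sup>2" for \<beta>
      using root_pos_or_neg[OF \<beta>(1)]
    proof
      assume "\<beta> \<in> pos_roots R \<alpha>"
      then have "\<beta> \<in> P_set R \<alpha> q t" using \<beta> by (simp add: P_set_def)
      then show ?thesis
        using l inversions_iff[OF w, of \<beta>] inversions_iff[OF w0W, of \<beta>] \<open>\<beta> \<in> pos_roots R \<alpha>\<close>
          sign[OF w \<beta>(1)] sign[OF w0W \<beta>(1)] by blast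
    next
      assume n: "- \<beta> \<in> pos_roots R \<alpha>"
      then have "- \<beta> \<in> P_set R \<alpha> q t"
        using \<beta> weight_char_uminus[OF t_char R_in_P[OF \<beta>(1)]] by (simp add: P_set_def)
      then show ?thesis
        using l inversions_iff[OF w, of "- \<beta>"] inversions_iff[OF w0W, of "- \<beta>"] n
        by (simp add: W_uminus w w0W ht_linear) blast
    qed
    then show ?r by (auto simp: active_def)
  next
    assume r: ?r
    have "ht (w \<beta>) < 0 \<longleftrightarrow> ht (w0 \<beta>) < 0" if \<beta>: "\<beta> \<in> pos_roots R \<alpha>" "\<beta> \<in> P_set R \<alpha> q t" for \<beta>
    proof (cases "t \<beta> = q\<^sup>2")
      case True
      then have "ht (w \<beta>) > 0 \<longleftrightarrow> ht (w0 \<beta>) > 0"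
        using r pos_roots_in_R[OF \<beta>(1)] by (auto simp: active_def)
      then show ?thesis using sign[OF w] sign[OF w0W] pos_roots_in_R[OF \<beta>(1)] by blast
    next
      case False
      then have "t (- \<beta>) = q\<^sup>2"
        using \<beta> weight_char_uminus[OF t_char R_in_P[OF pos_roots_in_R[OF \<beta>(1)]]]
        by (auto simp: P_set_def)
      then have "ht (w (- \<beta>)) > 0 \<longleftrightarrow> ht (w0 (- \<beta>)) > 0"
        using r pos_roots_in_R[OF \<beta>(1)] uminus_R by (auto simp: active_def)
      then show ?thesis by (simp add: W_uminus w w0W ht_linear)
    qed
    then show ?l
      by (auto simp: inversions_iff w w0W P_set_def)
  qed
  ultimately show ?thesis
    using w w0 by (auto simp: std_tableaux_def)
qed

lemma s_sign:
  assumes "w \<in> W" "\<beta> \<in> R" "t \<beta> \<noteq> weyl_act w t (\<alpha> i)" "t \<beta> \<noteq> inverse (weyl_act w t (\<alpha> i))"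
  shows "ht (s i (w \<beta>)) > 0 \<longleftrightarrow> ht (w \<beta>) > 0"
proof -
  have "w \<beta> \<noteq> \<alpha> i"
    using assms(1,3) weyl_act_apply by metis
  moreover have "w \<beta> \<noteq> - \<alpha> i"
    using assms(1,4) weyl_act_apply[OF assms(1), of \<beta>]
      weight_char_uminus[OF weyl_act_char R_in_P[OF simple_in_R]] by metis
  ultimately show ?thesis
    using s_pos_iff W_R assms(1,2) by blast
qed

text \<open>The only root that turns positive on passing from w to s_i w is the one sent by w to
  -alpha_i, and t takes the inverse of (wt)(X^alpha_i) there.\<close>

lemma active_s_subset:
  assumes w: "w \<in> W" and x: "weyl_act w t (\<alpha> i) \<noteq> inverse (q\<^sup>2)"
  shows "active (sl i w) \<subseteq> active w"
proof
  fix \<beta> assume "\<beta> \<in> active (sl i w)"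
  then have \<beta>: "\<beta> \<in> R" "t \<beta> = q\<^sup>2" "ht (s i (w \<beta>)) > 0" by (auto simp: active_def sl_apply)
  have "w \<beta> \<noteq> \<alpha> i"
    using \<beta>(3) by (auto simp: refl_at_self ht_linear ht_simple)
  moreover have "w \<beta> \<noteq> - \<alpha> i"
    using x \<beta>(2) weyl_act_apply[OF w, of \<beta>]
      weight_char_uminus[OF weyl_act_char[OF w] R_in_P[OF simple_in_R[of i]]] by (metis inverse_inverse_eq)
  ultimately show "\<beta> \<in> active w"
    using \<beta> s_pos_iff[OF W_R[OF w \<beta>(1)]] by (simp add: active_def)
qed

lemma active_s_superset:
  assumes w: "w \<in> W" and x: "weyl_act w t (\<alpha> i) \<noteq> q\<^sup>2"
  shows "active w \<subseteq> active (sl i w)"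
  using active_s_subset[of "sl i w" i] assms by (simp add: s_W_iff weyl_act_s_simple)

lemma active_s_neq:
  assumes w: "w \<in> W" and x: "weyl_act w t (\<alpha> i) = q\<^sup>2 \<or> weyl_act w t (\<alpha> i) = inverse (q\<^sup>2)"
  shows "active (sl i w) \<noteq> active w"
proof -
  have *: "active (sl i v) \<noteq> active v" if v: "v \<in> W" and x: "weyl_act v t (\<alpha> i) = q\<^sup>2" for v
  proof -
    let ?\<gamma> = "inv_into UNIV v (\<alpha> i)"
    have \<gamma>: "v ?\<gamma> = \<alpha> i" "?\<gamma> \<in> R" "t ?\<gamma> = q\<^sup>2"
      using v x by (auto simp: weyl_act_def W_R refl_group_inverse simple_in_R)
    then have "?\<gamma> \<in> active v" by (simp add: active_def ht_simple)
    moreover have "?\<gamma> \<notin> active (sl i v)"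
      using \<gamma> by (simp add: active_def sl_apply refl_at_self ht_linear ht_simple)
    ultimately show ?thesis by blast
  qed
  show ?thesis
    using x *[OF w] *[of "sl i w"] w by (auto simp: s_W_iff weyl_act_s_simple)
qed

text \<open>Only the roots sent by w to alpha_i or -alpha_i change sign. Their value is not 1, so
  the condition on Z(t) survives, and \<open>active\<close> changes exactly when the value is q^2 or
  q^-2.\<close>

lemma F_s_iff:
  assumes w: "w \<in> F"
  shows "sl i w \<in> F \<longleftrightarrow> weyl_act w t (\<alpha> i) \<noteq> q\<^sup>2 \<and> weyl_act w t (\<alpha> i) \<noteq> inverse (q\<^sup>2)"
proof -
  have wW: "w \<in> W" using w F_W by blast
  have "\<forall>\<beta>\<in>Z_set R \<alpha> t. ht ((sl i w) \<beta>) > 0"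
  proof
    fix \<beta> assume \<beta>: "\<beta> \<in> Z_set R \<alpha> t"
    then have "ht (w \<beta>) > 0" using F_iff[OF w wW] w by blast
    moreover have "\<beta> \<in> R" "t \<beta> = 1" using \<beta> by (auto simp: Z_set_def pos_roots_in_R)
    ultimately show "ht ((sl i w) \<beta>) > 0"
      using s_sign[OF wW, of \<beta> i] weyl_act_not_one[OF w, of i] by (simp add: sl_apply)
  qed
  then show ?thesis
    using F_iff[OF w, of "sl i w"] active_s_subset[OF wW, of i] active_s_superset[OF wW, of i]
      active_s_neq[OF wW, of i] wW by (auto simp: s_W_iff)
qed

section \<open>Tableau operators as a subquotient of the operators on the whole Weyl group\<close>

definition Q :: complex where "Q = q + inverse q"

text \<open>The value off \<open>W\<close> makes \<open>wt_s\<close> hold without a side condition.\<close>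

definition wt :: "'n \<Rightarrow> (real ^ 'n \<Rightarrow> real ^ 'n) \<Rightarrow> complex"
  where "wt i w = (if w \<in> W then cfun q (weyl_act w t (\<alpha> i)) else Q / 2)"

abbreviation fullT :: "'n \<Rightarrow> ((real ^ 'n \<Rightarrow> real ^ 'n) \<Rightarrow> complex) \<Rightarrow> (real ^ 'n \<Rightarrow> real ^ 'n) \<Rightarrow> complex"
  where "fullT i \<equiv> hecke_op q (sl i) (wt i)"

definition tabT :: "'n \<Rightarrow> ((real ^ 'n \<Rightarrow> real ^ 'n) \<Rightarrow> complex) \<Rightarrow> (real ^ 'n \<Rightarrow> real ^ 'n) \<Rightarrow> complex"
  where "tabT i f w = (if w \<in> F then fullT i f w else 0)"

lemma wt_s: "wt i (sl i w) = Q - wt i w"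
proof (cases "w \<in> W")
  case True
  then show ?thesis
    by (simp add: wt_def s_W_iff weyl_act_s_simple cfun_inverse weyl_act_simple_nonzero Q_def)
qed (simp add: wt_def s_W_iff field_simps)

lemma two_hops: "two_hops q (sl i) (sl j) (wt i) (wt j) Q"
  by unfold_locales (simp_all add: q_nonzero Q_def wt_s)

lemma cfun_values: "cfun q (q\<^sup>2) = Q" "cfun q (inverse (q\<^sup>2)) = 0"
proof -
  have "(q\<^sup>2 - 1) \<noteq> 0" using q_powers(1) by simp
  then show "cfun q (q\<^sup>2) = Q"
    using q_nonzero by (simp add: cfun_def Q_def field_simps power2_eq_square)
  show "cfun q (inverse (q\<^sup>2)) = 0"
    using q_nonzero q_powers(6) by (simp add: cfun_def field_simps power2_eq_square)
qed

text \<open>Functions supported on \<open>U\<close> are stable under \<open>fullT\<close>, since an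
  edge leaving \<open>U\<close> has c(q^-2) = 0 at its source. Functions on \<open>F\<close> are the
  quotient of these by the functions supported on \<open>U\<close> outside \<open>F\<close>.\<close>

definition U :: "(real ^ 'n \<Rightarrow> real ^ 'n) set"
  where "U = {w\<in>W. \<exists>w0\<in>F. active w \<subseteq> active w0}"

lemma F_U: "w \<in> F \<Longrightarrow> w \<in> U"
  by (auto simp: U_def F_W)

lemma fullT_supp_U:
  assumes f: "\<And>w. w \<notin> U \<Longrightarrow> f w = 0" and w: "w \<notin> U"
  shows "fullT i f w = 0"
proof -
  have "wt i (sl i w) * f (sl i w) = 0"
  proof (cases "sl i w \<in> U")
    case True
    then have W: "sl i w \<in> W" "w \<in> W" by (auto simp: U_def s_W_iff)
    have "weyl_act (sl i w) t (\<alpha> i) = inverse (q\<^sup>2)"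
      using active_s_subset[OF W(1), of i] True w W by (auto simp: U_def)
    then show ?thesis using W by (simp add: wt_def cfun_values)
  qed (simp add: f)
  then show ?thesis using f[OF w] by (simp add: hecke_op_def)
qed

text \<open>Consider an edge from s_i w in \<open>U\<close> outside \<open>F\<close> into w in
  \<open>F\<close>. There \<open>active\<close> at s_i w is a proper subset of \<open>active\<close>
  at w, which forces the value q^2 at w, so q^-2 at the source, where c is zero.\<close>

lemma tabT_restrict:
  assumes f: "\<And>w. w \<notin> U \<Longrightarrow> f w = 0"
  shows "tabT i (\<lambda>w. if w \<in> F then f w else 0) = (\<lambda>w. if w \<in> F then fullT i f w else 0)"
proof
  fix w
  have "wt i (sl i w) * f (sl i w) = 0" if w: "w \<in> F" "sl i w \<notin> F"
  proof (cases "sl i w \<in> U")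
    case True
    have wW: "w \<in> W" "sl i w \<in> W" using w(1) F_W s_W_iff by blast+
    obtain w0 where "w0 \<in> F" "active (sl i w) \<subseteq> active w0"
      using True by (auto simp: U_def)
    then have "active (sl i w) \<subseteq> active w"
      using F_iff[of w0 w] w(1) wW by blast
    moreover have x: "weyl_act w t (\<alpha> i) = q\<^sup>2 \<or> weyl_act w t (\<alpha> i) = inverse (q\<^sup>2)"
      using F_s_iff w by blast
    ultimately have "weyl_act w t (\<alpha> i) = q\<^sup>2"
      using active_s_superset[OF wW(1)] active_s_neq[OF wW(1)] by blast
    then have "weyl_act (sl i w) t (\<alpha> i) = inverse (q\<^sup>2)"
      by (simp add: weyl_act_s_simple wW)
    then show ?thesis using wW by (simp add: wt_def cfun_values)
  qed (simp add: f)
  then show "tabT i (\<lambda>w. if w \<in> F then f w else 0) w = (if w \<in> F then fullT i f w else 0)"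
    by (auto simp: tabT_def hecke_op_def)
qed

abbreviation "word_full ks \<equiv> foldr fullT ks"
abbreviation "word_tab ks \<equiv> foldr tabT ks"

lemma word_full_supp_U:
  assumes f: "\<And>w. w \<notin> F \<Longrightarrow> f w = 0" and "w \<notin> U"
  shows "word_full ks f w = 0"
  using assms(2)
proof (induction ks arbitrary: w)
  case Nil
  then show ?case using f F_U by auto
next
  case (Cons i ks)
  show ?case
    unfolding foldr.simps comp_apply by (rule fullT_supp_U) (fact Cons)+
qed

text \<open>\<open>tabT\<close> cuts off after every letter, the right side only once at the end. An
  identity between full words at a single point of \<open>F\<close> thus carries over to
  tableaux.\<close>

lemma word_tab_eq:
  assumes f: "\<And>w. w \<notin> F \<Longrightarrow> f w = 0"
  shows "word_tab ks f = (\<lambda>w. if w \<in> F then word_full ks f w else 0)"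
proof (induction ks)
  case (Cons i ks)
  have "word_tab (i # ks) f = tabT i (\<lambda>w. if w \<in> F then word_full ks f w else 0)"
    by (simp only: foldr.simps comp_apply Cons)
  also have "\<dots> = (\<lambda>w. if w \<in> F then fullT i (word_full ks f) w else 0)"
    by (rule tabT_restrict, rule word_full_supp_U[OF f])
  finally show ?case
    by (simp only: foldr.simps comp_apply)
qed (use f in auto)

lemma tabT_quadratic:
  assumes f: "\<And>w. w \<notin> F \<Longrightarrow> f w = 0"
  shows "tabT i (tabT i f) w = (q - inverse q) * tabT i f w + f w"
proof -
  interpret two_hops q "sl i" "sl i" "wt i" "wt i" Q by (rule two_hops)
  show ?thesis
    using word_tab_eq[where f = f, OF f, where ks = "[i, i]"] word_tab_eq[where f = f, OF f, where ks = "[i]"] quadratic[of f w] f[of w]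
    by simp
qed

section \<open>Braid relations at points whose weight is regular on the rank two system\<close>

lemma weight_char_add_mult:
  assumes "weight_char \<alpha> \<tau>" "\<mu> \<in> P" "\<nu> \<in> P"
  shows "\<tau> (\<mu> + real n *\<^sub>R \<nu>) = \<tau> \<mu> * \<tau> \<nu> ^ n"
proof (induction n)
  case (Suc n)
  have "real n *\<^sub>R \<nu> \<in> P"
    using assms(3) by (induction n) (auto simp: P_zero P_add scaleR_left_distrib)
  then have "\<tau> ((\<mu> + real n *\<^sub>R \<nu>) + \<nu>) = \<tau> (\<mu> + real n *\<^sub>R \<nu>) * \<tau> \<nu>"
    using assms by (intro weight_char_add P_add)
  then show ?case
    using Suc by (simp add: scaleR_left_distrib add_ac mult_ac)
qed simp

lemma s_simple_nat: "copair (\<alpha> j) (\<alpha> i) = - real l \<Longrightarrow> s i (\<alpha> j) = \<alpha> j + real l *\<^sub>R \<alpha> i"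
  by (simp add: refl_at_def)

lemma weyl_act_s_other:
  assumes "w \<in> W" "copair (\<alpha> j) (\<alpha> i) = - real l"
  shows "weyl_act (sl i w) t (\<alpha> j) = weyl_act w t (\<alpha> j) * weyl_act w t (\<alpha> i) ^ l"
  using assms weight_char_add_mult[OF weyl_act_char R_in_P R_in_P] simple_in_R
  by (simp add: weyl_act_s s_simple_nat)

lemma refl_group_pair_W: "u \<in> refl_group {\<alpha> i, \<alpha> j} \<Longrightarrow> u \<in> W"
  using refl_group_mono[of "{\<alpha> i, \<alpha> j}" R] simple_in_R by auto

lemma rank_two:
  assumes w: "w \<in> W" and reg: "\<And>\<beta>. \<beta> \<in> rank2_roots \<alpha> i j \<Longrightarrow> weyl_act w t \<beta> \<noteq> 1"
    and k: "copair (\<alpha> i) (\<alpha> j) = - real k" and l: "copair (\<alpha> j) (\<alpha> i) = - real l"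
  shows "rank_two_weights q (sl i) (sl j) (wt i) (wt j) Q {u \<circ> w | u. u \<in> refl_group {\<alpha> i, \<alpha> j}}
    (\<lambda>v. weyl_act v t (\<alpha> i)) (\<lambda>v. weyl_act v t (\<alpha> j)) k l"
proof -
  let ?G = "refl_group {\<alpha> i, \<alpha> j}"
  let ?D = "{u \<circ> w | u. u \<in> ?G}"
  interpret two_hops q "sl i" "sl j" "wt i" "wt j" Q by (rule two_hops)
  have DW: "v \<in> W" if "v \<in> ?D" for v
    using that refl_group_comp[OF refl_group_pair_W w] by auto
  have D: "sl i v \<in> ?D" "sl j v \<in> ?D" if v: "v \<in> ?D" for v
  proof -
    obtain u where u: "u \<in> ?G" "v = u \<circ> w" using v by blast
    then have "sl i v = (s i \<circ> u) \<circ> w" "sl j v = (s j \<circ> u) \<circ> w"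
      by (simp_all add: sl_def comp_assoc)
    moreover have "s i \<circ> u \<in> ?G" "s j \<circ> u \<in> ?G"
      using u(1) by (auto intro: refl_group.refl)
    ultimately show "sl i v \<in> ?D" "sl j v \<in> ?D" by blast+
  qed
  have one: "weyl_act v t (\<alpha> i) \<noteq> 1" "weyl_act v t (\<alpha> j) \<noteq> 1" if v: "v \<in> ?D" for v
  proof -
    obtain u where u: "u \<in> ?G" "v = u \<circ> w" using v by blast
    then have "weyl_act v t \<nu> = weyl_act w t (inv_into UNIV u \<nu>)" for \<nu>
      using weyl_act_comp[OF refl_group_pair_W[OF u(1)] w] by (simp add: weyl_act_def)
    moreover have "inv_into UNIV u (\<alpha> i) \<in> rank2_roots \<alpha> i j" "inv_into UNIV u (\<alpha> j) \<in> rank2_roots \<alpha> i j"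
      unfolding rank2_roots_def using refl_group_inverse[OF u(1)] by blast+
    ultimately show "weyl_act v t (\<alpha> i) \<noteq> 1" "weyl_act v t (\<alpha> j) \<noteq> 1"
      using reg by auto
  qed
  show ?thesis
    by unfold_locales
      (use D DW one in \<open>auto simp: wt_def weyl_act_simple_nonzero weyl_act_s_simple
        weyl_act_s_other[OF _ k] weyl_act_s_other[OF _ l]\<close>)
qed

text \<open>The orientation makes alpha_i the long root when the lengths differ, as
  \<open>braid_4\<close> and \<open>braid_6\<close> expect.\<close>

lemma regular_braid_oriented:
  assumes ij: "i \<noteq> j" and w: "w \<in> W"
    and reg: "\<And>\<beta>. \<beta> \<in> rank2_roots \<alpha> i j \<Longrightarrow> weyl_act w t \<beta> \<noteq> 1"
    and orient: "copair (\<alpha> j) (\<alpha> i) \<in> {0, -1}"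
  shows "word_full (alternating (coxeter_m \<alpha> i j) i j) f w = word_full (alternating (coxeter_m \<alpha> i j) j i) f w"
proof -
  obtain k l where kl: "copair (\<alpha> i) (\<alpha> j) = - real k" "copair (\<alpha> j) (\<alpha> i) = - real l"
    and cases: "(k, l) \<in> {(0, 0), (1, 1), (2, 1), (3, 1)}"
  proof -
    have "\<exists>k l. copair (\<alpha> i) (\<alpha> j) = - real k \<and> copair (\<alpha> j) (\<alpha> i) = - real l
        \<and> (k, l) \<in> {(0, 0), (1, 1), (2, 1), (3, 1)}"
      using cartan_cases[OF ij] orient
      by (auto intro: exI[of _ 0] exI[of _ 1] exI[of _ 2] exI[of _ 3])
    then show ?thesis using that by blast
  qed
  interpret rank_two_weights q "sl i" "sl j" "wt i" "wt j" Q "{u \<circ> w | u. u \<in> refl_group {\<alpha> i, \<alpha> j}}"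
    "\<lambda>v. weyl_act v t (\<alpha> i)" "\<lambda>v. weyl_act v t (\<alpha> j)" k l
    by (rule rank_two[OF w reg kl])
  have wD: "w \<in> {u \<circ> w | u. u \<in> refl_group {\<alpha> i, \<alpha> j}}"
    by (auto intro: exI[of _ id] refl_group.id)
  have eq: "foldr (\<lambda>k. hecke_op q (sl k) (wt k)) (a # as) f = fullT a (word_full as f)" for a as f
    by (simp only: foldr.simps comp_apply)
  note pow = coxeter_m_cases[OF ij[symmetric]]
  note simps = kl fun_eq_iff sl_apply numeral_eq_Suc
  from cases consider "k = 0" "l = 0" | "k = 1" "l = 1" | "k = 2" "l = 1" | "k = 3" "l = 1" by auto
  then show ?thesis
  proof cases
    case 1
    have "sl j (sl i (sl j (sl i w))) = w"
      using pow(1) 1 by (simp add: simps)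
    moreover have "coxeter_m \<alpha> i j = 2"
      using coxeter_m_cases(1)[OF ij] 1 by (simp add: kl)
    ultimately show ?thesis
      using braid_2[OF 1 wD] by (simp add: numeral_eq_Suc)
  next
    case 2
    have "sl j (sl i (sl j (sl i (sl j (sl i w))))) = w"
      using pow(2) 2 by (simp add: simps)
    moreover have "coxeter_m \<alpha> i j = 3"
      using coxeter_m_cases(2)[OF ij] 2 by (simp add: kl)
    ultimately show ?thesis
      using braid_3[OF 2 wD] by (simp add: numeral_eq_Suc)
  next
    case 3
    have "sl j (sl i (sl j (sl i (sl j (sl i (sl j (sl i w))))))) = w"
      using pow(3) 3 by (simp add: simps)
    moreover have "coxeter_m \<alpha> i j = 4"
      using coxeter_m_cases(3)[OF ij] 3 by (simp add: kl)
    ultimately show ?thesis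
      using braid_4[OF 3 wD] by (simp add: numeral_eq_Suc)
  next
    case 4
    have "sl j (sl i (sl j (sl i (sl j (sl i (sl j (sl i (sl j (sl i (sl j (sl i w))))))))))) = w"
      using pow(4) 4 by (simp add: simps)
    moreover have "coxeter_m \<alpha> i j = 6"
      using coxeter_m_cases(4)[OF ij] 4 by (simp add: kl)
    ultimately show ?thesis
      using braid_6[OF 4 wD] by (simp add: numeral_eq_Suc)
  qed
qed

lemma coxeter_m_commute: "i \<noteq> j \<Longrightarrow> coxeter_m \<alpha> i j = coxeter_m \<alpha> j i"
  using cartan_cases[of i j] cartan_cases[of j i] coxeter_m_cases[of i j] coxeter_m_cases[of j i]
  by auto

lemma regular_braid:
  assumes ij: "i \<noteq> j" and w: "w \<in> W"
    and reg: "\<And>\<beta>. \<beta> \<in> rank2_roots \<alpha> i j \<Longrightarrow> weyl_act w t \<beta> \<noteq> 1"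
  shows "word_full (alternating (coxeter_m \<alpha> i j) i j) f w = word_full (alternating (coxeter_m \<alpha> i j) j i) f w"
proof (cases "copair (\<alpha> j) (\<alpha> i) \<in> {0, -1}")
  case True
  then show ?thesis using regular_braid_oriented assms by blast
next
  case False
  then have "copair (\<alpha> i) (\<alpha> j) \<in> {0, -1}"
    using cartan_cases[OF ij] by auto
  moreover have "rank2_roots \<alpha> j i = rank2_roots \<alpha> i j"
    by (simp add: rank2_roots_def insert_commute)
  ultimately show ?thesis
    using regular_braid_oriented[OF ij[symmetric] w, of f] reg coxeter_m_commute[OF ij] by simp
qed

end

text \<open>Here \<open>S \<circ> T\<close> has determinant \<open>1\<close> and trace \<open>-1\<close> on the span of the coordinates \<open>w\<close> and \<open>u\<close>.\<close>

lemma two_dim_order_3: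
  fixes S T :: "('p \<Rightarrow> complex) \<Rightarrow> 'p \<Rightarrow> complex"
  assumes closed: "\<And>g. V g \<Longrightarrow> V (S g)" "\<And>g. V g \<Longrightarrow> V (T g)"
    and S: "\<And>g. V g \<Longrightarrow> S g w = a * g w + b * g u" "\<And>g. V g \<Longrightarrow> S g u = c * g w + d * g u"
    and T: "\<And>g. V g \<Longrightarrow> T g w = e * g w" "\<And>g. V g \<Longrightarrow> T g u = e' * g u"
    and det: "e * e' = -1" "a * d - b * c = -1" and tr: "a * e + d * e' = -1"
    and f: "V f"
  shows "S (T (S (T (S (T f))))) w = f w" "T (S (T (S (T (S f))))) w = f w"
proof -
  have d: "d * e' = - 1 - a * e" using tr by (simp add: eq_diff_eq add.commute)
  have "a * d * (e * e') = a * e * (d * e')" by (simp add: mult_ac)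
  then have "a * d = a * e + (a * e)\<^sup>2"
    by (simp add: det d power2_eq_square algebra_simps)
  then have bc: "b * c = a * e + (a * e)\<^sup>2 + 1" using det(2) by (simp add: algebra_simps)
  have "(a * e) * (a * e) + (b * c) * (e * e') = - (a * e) - 1"
    by (simp add: det bc power2_eq_square)
  then have m: "a * (e * (a * e)) + b * (c * (e * e')) = - (a * e) - 1"
    by (simp add: mult_ac)
  \<comment> \<open>Cayley-Hamilton for ST, (ST)^2 + ST + 1 = 0, read at the coordinate w; applying
    it once more gives (ST)^3 = 1.\<close>
  have 1: "S (T (S (T g))) w = - S (T g) w - g w" if g: "V g" for g
  proof -
    have "S (T (S (T g))) w
        = (a * (e * (a * e)) + b * (c * (e * e'))) * g w + (b * e') * (a * e + d * e') * g u"
      using g by (simp add: S T closed algebra_simps)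
    then show ?thesis
      using g unfolding m tr by (simp add: S T closed algebra_simps)
  qed
  have 2: "T (S (T (S g))) w = - T (S g) w - g w" if g: "V g" for g
  proof -
    have "T (S (T (S g))) w
        = (a * (e * (a * e)) + b * (c * (e * e'))) * g w + (b * e) * (a * e + d * e') * g u"
      using g by (simp add: S T closed algebra_simps)
    then show ?thesis
      using g unfolding m tr by (simp add: S T closed algebra_simps)
  qed
  show "S (T (S (T (S (T f))))) w = f w" "T (S (T (S (T (S f))))) w = f w"
    using 1[of "S (T f)"] 1[OF f] 2[of "T (S f)"] 2[OF f] f closed by simp_all
qed

context skew_shape
begin

section \<open>Braid relations in the exceptional calibratable cases\<close>

lemma tabT_supp: "w \<notin> F \<Longrightarrow> tabT i g w = 0"
  by (simp add: tabT_def)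

lemma tabT_boundary:
  assumes w: "w \<in> F" and g: "\<And>v. v \<notin> F \<Longrightarrow> g v = 0"
  shows "weyl_act w t (\<alpha> i) = q\<^sup>2 \<Longrightarrow> tabT i g w = q * g w"
    "weyl_act w t (\<alpha> i) = inverse (q\<^sup>2) \<Longrightarrow> tabT i g w = - inverse q * g w"
proof -
  show "tabT i g w = q * g w" if x: "weyl_act w t (\<alpha> i) = q\<^sup>2"
  proof -
    have "g (sl i w) = 0" using F_s_iff[OF w, of i] x g by simp
    then show ?thesis
      using w F_W[OF w] x by (simp add: tabT_def hecke_op_def wt_def cfun_values Q_def)
  qed
  show "tabT i g w = - inverse q * g w" if x: "weyl_act w t (\<alpha> i) = inverse (q\<^sup>2)"
  proof -
    have "g (sl i w) = 0" using F_s_iff[OF w, of i] x g by simp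
    then show ?thesis
      using w F_W[OF w] x by (simp add: tabT_def hecke_op_def wt_def cfun_values)
  qed
qed

text \<open>Neither neighbour of w is a tableau, so at w both operators multiply by scalars, q and
  -q^-1. For even m both words contain each letter equally often.\<close>

lemma boundary_braid:
  assumes w: "w \<in> F" and f: "\<And>v. v \<notin> F \<Longrightarrow> f v = 0"
    and x: "weyl_act w t (\<alpha> i) = q\<^sup>2 \<and> weyl_act w t (\<alpha> j) = inverse (q\<^sup>2)
      \<or> weyl_act w t (\<alpha> i) = inverse (q\<^sup>2) \<and> weyl_act w t (\<alpha> j) = q\<^sup>2"
    and m: "m = 4 \<or> m = 6"
  shows "word_tab (alternating m i j) f w = word_tab (alternating m j i) f w"
proof -
  obtain a b where T: "tabT i g w = a * g w" "tabT j g w = b * g w" if "\<And>v. v \<notin> F \<Longrightarrow> g v = 0" for g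
    using x tabT_boundary[OF w] by metis
  show ?thesis
    using m by (elim disjE) (simp_all add: T f tabT_supp numeral_eq_Suc)
qed

text \<open>How s_i (\<open>True\<close>) and s_j (\<open>False\<close>) move the pair of values at
  alpha_i and alpha_j when alpha_j is short and the Cartan integers are -1 and -k.\<close>

fun pair_step :: "nat \<Rightarrow> bool \<Rightarrow> complex \<times> complex \<Rightarrow> complex \<times> complex" where
  "pair_step k True (x, y) = (inverse x, y * x)"
| "pair_step k False (x, y) = (x * y ^ k, inverse y)"

lemma special_orbit:
  assumes w: "w \<in> W" and k: "copair (\<alpha> i) (\<alpha> j) = - real k" and l: "copair (\<alpha> j) (\<alpha> i) = -1"
    and S: "\<And>b z. z \<in> S \<Longrightarrow> pair_step k b z \<in> S"
    and u: "u \<in> refl_group {\<alpha> i, \<alpha> j}" and "(weyl_act (u \<circ> w) t (\<alpha> i), weyl_act (u \<circ> w) t (\<alpha> j)) \<in> S"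
  shows "(weyl_act w t (\<alpha> i), weyl_act w t (\<alpha> j)) \<in> S"
  using u assms(6)
proof (induction rule: refl_group.induct)
  case id
  then show ?case by simp
next
  case (refl \<beta> u)
  let ?v = "u \<circ> w"
  have v: "?v \<in> W"
    using refl(2) refl_group_pair_W w refl_group_comp by blast
  have l1: "copair (\<alpha> j) (\<alpha> i) = - real 1" using l by simp
  have step: "(weyl_act (sl i v) t (\<alpha> i), weyl_act (sl i v) t (\<alpha> j))
        = pair_step k True (weyl_act v t (\<alpha> i), weyl_act v t (\<alpha> j))"
      "(weyl_act (sl j v) t (\<alpha> i), weyl_act (sl j v) t (\<alpha> j))
        = pair_step k False (weyl_act v t (\<alpha> i), weyl_act v t (\<alpha> j))" if "v \<in> W" for v
    using weyl_act_s_other[OF that k] weyl_act_s_other[OF that l1] that by (simp_all add: weyl_act_s_simple)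
  from refl(1) consider "\<beta> = \<alpha> i" | "\<beta> = \<alpha> j" by blast
  then have "(weyl_act ?v t (\<alpha> i), weyl_act ?v t (\<alpha> j)) \<in> S"
  proof cases
    case 1
    then have "refl_at \<beta> \<circ> u \<circ> w = sl i ?v" by (simp add: sl_def comp_assoc)
    then show ?thesis
      using S[OF refl.prems[unfolded \<open>_ = sl i ?v\<close>], of True] step(1)[of "sl i ?v"] v by (simp add: s_W_iff)
  next
    case 2
    then have "refl_at \<beta> \<circ> u \<circ> w = sl j ?v" by (simp add: sl_def comp_assoc)
    then show ?thesis
      using S[OF refl.prems[unfolded \<open>_ = sl j ?v\<close>], of False] step(2)[of "sl j ?v"] v by (simp add: s_W_iff)
  qed
  then show ?case by (rule refl.IH)
qed

text \<open>The sets \<open>?S\<close> in the proof are the full \<open>W_ij\<close>-orbits of the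
  pair (q^2, 1), of size 4 in type C2 and 6 in type G2. Discarding the pairs with an entry 1 leaves
  the listed values.\<close>

lemma special_values:
  assumes w: "w \<in> W" and ne: "weyl_act w t (\<alpha> i) \<noteq> 1" "weyl_act w t (\<alpha> j) \<noteq> 1"
    and u: "u \<in> refl_group {\<alpha> i, \<alpha> j}" "weyl_act u (weyl_act w t) (\<alpha> i) = q\<^sup>2"
      "weyl_act u (weyl_act w t) (\<alpha> j) = 1"
    and l: "copair (\<alpha> j) (\<alpha> i) = -1"
  defines "z \<equiv> (weyl_act w t (\<alpha> i), weyl_act w t (\<alpha> j))"
  shows "copair (\<alpha> i) (\<alpha> j) = -2 \<Longrightarrow> z \<in> {(inverse (q\<^sup>2), q\<^sup>2), (q\<^sup>2, inverse (q\<^sup>2))}"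
    "copair (\<alpha> i) (\<alpha> j) = -3 \<Longrightarrow> z \<in> {(inverse (q\<^sup>2), q\<^sup>2), (q\<^sup>2, inverse (q\<^sup>2)),
      (q ^ 4, inverse (q\<^sup>2)), (inverse (q ^ 4), q\<^sup>2)}"
proof -
  have u': "weyl_act (u \<circ> w) t (\<alpha> i) = q\<^sup>2" "weyl_act (u \<circ> w) t (\<alpha> j) = 1"
    using u weyl_act_comp[OF refl_group_pair_W[OF u(1)] w] by simp_all
  note r = q_nonzero field_simps power_add[symmetric] power_mult[symmetric]
  show "z \<in> {(inverse (q\<^sup>2), q\<^sup>2), (q\<^sup>2, inverse (q\<^sup>2))}" if "copair (\<alpha> i) (\<alpha> j) = -2"
  proof -
    let ?S = "{(q\<^sup>2, 1), (inverse (q\<^sup>2), 1), (inverse (q\<^sup>2), q\<^sup>2), (q\<^sup>2, inverse (q\<^sup>2))}"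
    have "pair_step 2 b z \<in> ?S" if "z \<in> ?S" for b z
      using that by (cases b) (auto simp: r)
    then have "z \<in> ?S"
      unfolding z_def using special_orbit[OF w, of i j 2 ?S u] that l u(1) u' by simp
    then show ?thesis using ne by (auto simp: z_def)
  qed
  show "z \<in> {(inverse (q\<^sup>2), q\<^sup>2), (q\<^sup>2, inverse (q\<^sup>2)), (q ^ 4, inverse (q\<^sup>2)), (inverse (q ^ 4), q\<^sup>2)}"
    if "copair (\<alpha> i) (\<alpha> j) = -3"
  proof -
    let ?S = "{(q\<^sup>2, 1), (inverse (q\<^sup>2), 1), (inverse (q\<^sup>2), q\<^sup>2), (q\<^sup>2, inverse (q\<^sup>2)),
      (q ^ 4, inverse (q\<^sup>2)), (inverse (q ^ 4), q\<^sup>2)}"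
    have "pair_step 3 b z \<in> ?S" if "z \<in> ?S" for b z
      using that by (cases b) (auto simp: r)
    then have "z \<in> ?S"
      unfolding z_def using special_orbit[OF w, of i j 3 ?S u] that l u(1) u' by simp
    then show ?thesis using ne by (auto simp: z_def)
  qed
qed

text \<open>These two G2 weights are exchanged by s_i, so w and s_i w are both tableaux, while s_j
  leads out of \<open>F\<close> from either. T_j is thus diagonal on the pair, with eigenvalues q
  and -q^-1 in some order, and both words of length six act as the identity at w by
  \<open>two_dim_order_3\<close>.\<close>

lemma two_dim_braid:
  assumes w: "w \<in> F" and f: "\<And>v. v \<notin> F \<Longrightarrow> f v = 0"
    and xy: "weyl_act w t (\<alpha> i) = q ^ 4 \<and> weyl_act w t (\<alpha> j) = inverse (q\<^sup>2)
      \<or> weyl_act w t (\<alpha> i) = inverse (q ^ 4) \<and> weyl_act w t (\<alpha> j) = q\<^sup>2"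
    and l: "copair (\<alpha> j) (\<alpha> i) = -1"
  shows "word_tab (alternating 6 i j) f w = word_tab (alternating 6 j i) f w"
proof -
  let ?u = "sl i w"
  let ?V = "\<lambda>g. \<forall>v. v \<notin> F \<longrightarrow> g v = 0"
  have wW: "w \<in> W" using F_W w .
  have q: "q ^ 4 \<noteq> q\<^sup>2" "q ^ 4 \<noteq> inverse (q\<^sup>2)" "inverse (q ^ 4) \<noteq> q\<^sup>2" "inverse (q ^ 4) \<noteq> inverse (q\<^sup>2)"
  proof -
    show q: "q ^ 4 \<noteq> q\<^sup>2" "q ^ 4 \<noteq> inverse (q\<^sup>2)" by (fact q_powers)+
    show "inverse (q ^ 4) \<noteq> q\<^sup>2" using q(2) inverse_inverse_eq by metis
    show "inverse (q ^ 4) \<noteq> inverse (q\<^sup>2)" using q(1) inverse_eq_iff_eq by metis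
  qed
  have u: "?u \<in> F"
    unfolding F_s_iff[OF w] using xy q by metis
  define x y where "x = weyl_act w t (\<alpha> i)" and "y = weyl_act w t (\<alpha> j)"
  have l1: "copair (\<alpha> j) (\<alpha> i) = - real 1" using l by simp
  have ux: "weyl_act ?u t (\<alpha> i) = inverse x" and uy: "weyl_act ?u t (\<alpha> j) = y * x"
    using wW weyl_act_s_other[OF wW l1] by (simp_all add: x_def y_def weyl_act_s_simple)
  define c where "c = cfun q x"
  have cu: "cfun q (inverse x) = Q - c"
    using cfun_inverse[of x q] weyl_act_simple_nonzero[OF wW] by (simp add: c_def Q_def x_def)
  have S: "tabT i g w = (c - inverse q) * g w + (Q - c) * g ?u"
    "tabT i g ?u = c * g w + (Q - c - inverse q) * g ?u" for g
    using w u F_W by (simp_all add: tabT_def hecke_op_def wt_def ux cu x_def[symmetric] c_def[symmetric])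
  obtain e e' where ee: "\<And>g. ?V g \<Longrightarrow> tabT j g w = e * g w" "\<And>g. ?V g \<Longrightarrow> tabT j g ?u = e' * g ?u"
    "e * e' = -1" "(c - inverse q) * e + (Q - c - inverse q) * e' = -1"
  proof -
    from xy consider "x = q ^ 4" "y = inverse (q\<^sup>2)" | "x = inverse (q ^ 4)" "y = q\<^sup>2"
      by (auto simp: x_def y_def)
    then show ?thesis
    proof cases
      case 1
      have eq: "q ^ 4 = q\<^sup>2 * q\<^sup>2" by (simp add: power_add[symmetric])
      have "inverse a * (a * a) = a" if "a \<noteq> 0" for a :: complex using that by simp
      from this[of "q\<^sup>2"] have "y * x = q\<^sup>2"
        unfolding 1 eq using q_nonzero by (metis power_not_zero)
      moreover have "c = (q ^ 4 + q\<^sup>2 + 1) / (q * (q\<^sup>2 + 1))"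
      proof -
        have "q ^ 4 - 1 \<noteq> 0" using q_powers by simp
        then show ?thesis
          using q_nonzero q_powers(2,5) unfolding c_def 1 cfun_def
          by (simp add: divide_simps) (simp add: algebra_simps eval_nat_numeral)
      qed
      ultimately show ?thesis
        using that[of "- inverse q" q] tabT_boundary[OF w] tabT_boundary[OF u] 1 uy q_nonzero q_powers(5)
        by (auto simp: y_def Q_def) (simp add: divide_simps, simp add: algebra_simps eval_nat_numeral)
    next
      case 2
      have eq: "q ^ 4 = q\<^sup>2 * q\<^sup>2" by (simp add: power_add[symmetric])
      have "a * inverse (a * a) = inverse a" if "a \<noteq> 0" for a :: complex using that by simp
      from this[of "q\<^sup>2"] have "y * x = inverse (q\<^sup>2)"
        unfolding 2 eq using q_nonzero by (metis power_not_zero)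
      moreover have "c = q / (q\<^sup>2 + 1)"
      proof -
        have "1 - q ^ 4 \<noteq> 0" using q_powers by simp
        then show ?thesis
          using q_nonzero q_powers(2,5) unfolding c_def 2 cfun_def
          by (simp add: divide_simps) (simp add: algebra_simps eval_nat_numeral)
      qed
      ultimately show ?thesis
        using that[of q "- inverse q"] tabT_boundary[OF w] tabT_boundary[OF u] 2 uy q_nonzero q_powers(5)
        by (auto simp: y_def Q_def) (simp add: divide_simps, simp add: algebra_simps eval_nat_numeral)
    qed
  qed
  have det: "(c - inverse q) * (Q - c - inverse q) - (Q - c) * c = -1"
    using q_nonzero by (simp add: Q_def algebra_simps)
  note order_3 = two_dim_order_3[of ?V "tabT i" "tabT j" w "c - inverse q" "Q - c" ?u c "Q - c - inverse q",
      OF _ _ S(1) S(2) ee(1) ee(2) ee(3) det ee(4)]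
  show ?thesis
    using order_3[of f] f by (simp add: tabT_supp numeral_eq_Suc)
qed

lemma special_braid:
  assumes w: "w \<in> F" and f: "\<And>v. v \<notin> F \<Longrightarrow> f v = 0" and ij: "i \<noteq> j"
    and sp: "calibratable_special \<alpha> q (weyl_act w t) i j"
  shows "word_tab (alternating (coxeter_m \<alpha> i j) i j) f w = word_tab (alternating (coxeter_m \<alpha> i j) j i) f w"
proof -
  have wW: "w \<in> W" using F_W w .
  obtain u where u: "u \<in> refl_group {\<alpha> i, \<alpha> j}" "weyl_act u (weyl_act w t) (\<alpha> i) = q\<^sup>2"
      "weyl_act u (weyl_act w t) (\<alpha> j) = 1"
    and ne: "weyl_act w t (\<alpha> i) \<noteq> 1" "weyl_act w t (\<alpha> j) \<noteq> 1"
    and l: "copair (\<alpha> j) (\<alpha> i) = -1" and k: "copair (\<alpha> i) (\<alpha> j) = -2 \<or> copair (\<alpha> i) (\<alpha> j) = -3"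
    using sp by (auto simp: calibratable_special_def C2_G2_long_short_def)
  note vals = special_values[OF wW ne u l]
  from k show ?thesis
  proof
    assume k: "copair (\<alpha> i) (\<alpha> j) = -2"
    then have "coxeter_m \<alpha> i j = 4" using coxeter_m_cases(3)[OF ij] l by simp
    then show ?thesis
      using boundary_braid[OF w, where f = f and i = i and j = j and m = 4, OF f] vals(1)[OF k] by auto
  next
    assume k: "copair (\<alpha> i) (\<alpha> j) = -3"
    then have "coxeter_m \<alpha> i j = 6" using coxeter_m_cases(4)[OF ij] l by simp
    then show ?thesis
      using boundary_braid[OF w, where f = f and i = i and j = j and m = 6, OF f]
        two_dim_braid[OF w, where f = f, OF f _ l] vals(2)[OF k] by auto
  qed
qed

text \<open>Proved separately at each w, as different points may fall under different calibratable
  cases.\<close>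

lemma tabT_braid:
  assumes f: "\<And>v. v \<notin> F \<Longrightarrow> f v = 0" and ij: "i \<noteq> j"
  shows "word_tab (alternating (coxeter_m \<alpha> i j) i j) f = word_tab (alternating (coxeter_m \<alpha> i j) j i) f"
proof
  fix w
  show "word_tab (alternating (coxeter_m \<alpha> i j) i j) f w = word_tab (alternating (coxeter_m \<alpha> i j) j i) f w"
  proof (cases "w \<in> F")
    case True
    then have "calibratable \<alpha> q (weyl_act w t) i j"
      using skew ij by (auto simp: placed_skew_shape_def)
    then consider "\<forall>\<beta>\<in>rank2_roots \<alpha> i j. weyl_act w t \<beta> \<noteq> 1"
      | "calibratable_special \<alpha> q (weyl_act w t) i j" | "calibratable_special \<alpha> q (weyl_act w t) j i"
      by (auto simp: calibratable_def)
    then show ?thesis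
    proof cases
      case 1
      then show ?thesis
        using regular_braid[OF ij F_W[OF True], of f] by (simp add: word_tab_eq[OF f])
    next
      case 2
      then show ?thesis using special_braid True f ij by blast
    next
      case 3
      then show ?thesis
        using special_braid[OF True f ij[symmetric]] coxeter_m_commute[OF ij] by simp
    qed
  qed (simp add: word_tab_eq[OF f])
qed

lemma tabT_T_diag:
  assumes w: "w \<in> F"
  shows "cfun q (weyl_act w t (\<alpha> i)) = inverse q + T_diag \<alpha> q t i w"
proof -
  have x: "weyl_act w t (\<alpha> i) \<noteq> 1" "weyl_act w t (\<alpha> i) \<noteq> 0"
    using weyl_act_not_one[OF w] weyl_act_simple_nonzero F_W w by blast+
  have eq: "weyl_act w t (- \<alpha> i) = inverse (weyl_act w t (\<alpha> i))"
    using weight_char_uminus[OF weyl_act_char[OF F_W[OF w]] R_in_P[OF simple_in_R]] .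
  then show ?thesis
    using x q_nonzero unfolding T_diag_def cfun_def eq by (simp add: divide_simps) (simp add: algebra_simps)
qed

end

section \<open>Representations of free algebras\<close>

abbreviation "lookup \<equiv> Poly_Mapping.lookup"

text \<open>The linear extension of phi to formal combinations. It serves both for evaluating
  elements of C[X] at a character and for extending an action of words to the free algebra.\<close>

definition pm_eval :: "('k \<Rightarrow> complex) \<Rightarrow> ('k \<Rightarrow>\<^sub>0 complex) \<Rightarrow> complex"
  where "pm_eval \<phi> x = (\<Sum>k\<in>Poly_Mapping.keys x. lookup x k * \<phi> k)"

lemma pm_eval_superset:
  "finite A \<Longrightarrow> Poly_Mapping.keys x \<subseteq> A \<Longrightarrow> pm_eval \<phi> x = (\<Sum>k\<in>A. lookup x k * \<phi> k)"
  unfolding pm_eval_def by (rule sum.mono_neutral_left) (auto simp: in_keys_iff)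

lemma pm_eval_add: "pm_eval \<phi> (x + y) = pm_eval \<phi> x + pm_eval \<phi> y"
proof -
  let ?A = "Poly_Mapping.keys x \<union> Poly_Mapping.keys y"
  have "pm_eval \<phi> (x + y) = (\<Sum>k\<in>?A. lookup (x + y) k * \<phi> k)"
    by (rule pm_eval_superset) (simp_all add: keys_add)
  also have "\<dots> = (\<Sum>k\<in>?A. lookup x k * \<phi> k) + (\<Sum>k\<in>?A. lookup y k * \<phi> k)"
    by (simp add: lookup_add distrib_right sum.distrib)
  also have "\<dots> = pm_eval \<phi> x + pm_eval \<phi> y"
    by (simp add: pm_eval_superset[of ?A])
  finally show ?thesis .
qed

lemma pm_eval_zero [simp]: "pm_eval \<phi> 0 = 0"
  by (simp add: pm_eval_def)

lemma pm_eval_uminus: "pm_eval \<phi> (- x) = - pm_eval \<phi> x"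
  using pm_eval_add[of \<phi> x "- x"] by (simp add: eq_neg_iff_add_eq_0 add.commute)

lemma pm_eval_diff: "pm_eval \<phi> (x - y) = pm_eval \<phi> x - pm_eval \<phi> y"
  using pm_eval_add[of \<phi> x "- y"] by (simp add: pm_eval_uminus)

lemma pm_eval_single [simp]: "pm_eval \<phi> (Poly_Mapping.single k c) = c * \<phi> k"
  by (simp add: pm_eval_def)

lemma pm_eval_one [simp]: "pm_eval \<phi> 1 = \<phi> 0"
  by (simp add: pm_eval_def)

lemma pm_eval_sum: "pm_eval \<phi> (sum f A) = (\<Sum>a\<in>A. pm_eval \<phi> (f a))"
  by (induction A rule: infinite_finite_induct) (simp_all add: pm_eval_add)

lemma poly_mapping_sum_single: "x = (\<Sum>k\<in>Poly_Mapping.keys x. Poly_Mapping.single k (lookup x k))"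
  by (rule poly_mapping_eqI) (auto simp: lookup_sum lookup_single when_def in_keys_iff)

lemma pm_eval_mult:
  "pm_eval \<phi> (x * y) = (\<Sum>k\<in>Poly_Mapping.keys x. lookup x k * pm_eval (\<lambda>l. \<phi> (k + l)) y)"
proof -
  have "x * y = (\<Sum>k\<in>Poly_Mapping.keys x. \<Sum>l\<in>Poly_Mapping.keys y.
      Poly_Mapping.single (k + l) (lookup x k * lookup y l))"
  proof -
    have "x * y = (\<Sum>k\<in>Poly_Mapping.keys x. Poly_Mapping.single k (lookup x k))
        * (\<Sum>l\<in>Poly_Mapping.keys y. Poly_Mapping.single l (lookup y l))"
      by (rule arg_cong2[where f = "(*)"]) (rule poly_mapping_sum_single)+
    then show ?thesis by (simp add: sum_product mult_single)
  qed
  then show ?thesis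
    by (simp add: pm_eval_sum pm_eval_def[of _ y] sum_distrib_left mult.assoc)
qed

lemma free_algebra_simps:
  "x \<oplus>\<^bsub>free_algebra A\<^esub> y = x + y" "x \<otimes>\<^bsub>free_algebra A\<^esub> y = x * y"
  "\<one>\<^bsub>free_algebra A\<^esub> = 1" "\<zero>\<^bsub>free_algebra A\<^esub> = 0"
  by (simp_all add: free_algebra_def)

lemma free_algebra_word: "set gs \<subseteq> A \<Longrightarrow> word gs \<in> carrier (free_algebra A)"
  and free_algebra_scalar: "scalar c \<in> carrier (free_algebra A)"
  and free_algebra_one: "1 \<in> carrier (free_algebra A)"
  and free_algebra_zero: "0 \<in> carrier (free_algebra A)"
  by (auto simp: free_algebra_def word_def scalar_def zero_free_monoid_def)

lemma free_algebra_closed: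
  assumes "x \<in> carrier (free_algebra A)" "y \<in> carrier (free_algebra A)"
  shows "x + y \<in> carrier (free_algebra A)" "x * y \<in> carrier (free_algebra A)"
    "- x \<in> carrier (free_algebra A)" "x - y \<in> carrier (free_algebra A)"
proof -
  have uminus: "- z \<in> carrier (free_algebra A)" if "z \<in> carrier (free_algebra A)" for z
    using that by (auto simp: free_algebra_def in_keys_iff)
  have add: "x + z \<in> carrier (free_algebra A)" if "z \<in> carrier (free_algebra A)" for z
    using that assms(1) keys_add[of x z] by (auto simp: free_algebra_def)
  show "x + y \<in> carrier (free_algebra A)" "- x \<in> carrier (free_algebra A)"
    by (simp_all add: add uminus assms)
  show "x - y \<in> carrier (free_algebra A)"
    using add[OF uminus[OF assms(2)]] by simp
  show "x * y \<in> carrier (free_algebra A)"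
    using assms keys_mult[of x y] by (fastforce simp: free_algebra_def plus_free_monoid_def)
qed

lemma free_algebra_ring: "ring (free_algebra A)"
proof (rule ringI)
  show "abelian_group (free_algebra A)"
  proof (rule abelian_groupI)
    fix x assume "x \<in> carrier (free_algebra A)"
    then show "\<exists>y\<in>carrier (free_algebra A). y \<oplus>\<^bsub>free_algebra A\<^esub> x = \<zero>\<^bsub>free_algebra A\<^esub>"
      using free_algebra_closed(3) by (intro bexI[of _ "- x"]) (simp_all add: free_algebra_simps)
  qed (simp_all add: free_algebra_simps free_algebra_closed(1) free_algebra_zero add_ac)
  show "Group.monoid (free_algebra A)"
    by (rule monoidI)
      (simp_all add: free_algebra_simps free_algebra_closed(2) free_algebra_one mult.assoc)
qed (simp_all add: free_algebra_simps distrib_left distrib_right)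

lemma free_algebra_sum: "(\<And>a. a \<in> B \<Longrightarrow> f a \<in> carrier (free_algebra A)) \<Longrightarrow> sum f B \<in> carrier (free_algebra A)"
  by (induction B rule: infinite_finite_induct) (simp_all add: free_algebra_closed(1) free_algebra_zero)

lemma set_alternating: "set (alternating m a b) \<subseteq> {a, b}"
  by (induction m a b rule: alternating.induct) auto

lemma alternating_map: "alternating m (g a) (g b) = map g (alternating m a b)"
  by (induction m a b rule: alternating.induct) auto

context simple_root_system
begin

lemma hecke_relations_carrier: "hecke_relations \<alpha> q \<subseteq> carrier (free_algebra (hecke_gens \<alpha>))"
proof
  have T: "word gs \<in> carrier (free_algebra (hecke_gens \<alpha>))"
    if "set gs \<subseteq> range Tgen \<union> Xgen ` P" for gs
    using that by (intro free_algebra_word) (simp add: hecke_gens_def)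
  fix x assume "x \<in> hecke_relations \<alpha> q"
  then show "x \<in> carrier (free_algebra (hecke_gens \<alpha>))"
  proof (induction rule: hecke_relations.induct)
    case (quadratic i)
    show ?case
      by (intro free_algebra_closed T free_algebra_scalar free_algebra_one) auto
  next
    case (braid i j)
    show ?case
      by (intro free_algebra_closed T order_trans[OF set_alternating]) auto
  next
    case (X_mult \<nu> \<mu>)
    then show ?case
      by (intro free_algebra_closed T) (auto intro: P_add)
  next
    case X_one
    show ?case
      by (intro free_algebra_closed T free_algebra_one) (auto intro: P_zero)
  next
    case (X_T \<nu> i p)
    then have "lift_X p \<in> carrier (free_algebra (hecke_gens \<alpha>))"
      unfolding lift_X_def demazure_quotient_def
      by (intro free_algebra_sum free_algebra_closed(2) T free_algebra_scalar) auto
    then show ?case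
      using X_T by (intro free_algebra_closed T free_algebra_scalar) (auto intro: s_P)
  qed
qed

end

context skew_shape
begin

fun gen_op :: "'n hecke_gen \<Rightarrow> ((real ^ 'n \<Rightarrow> real ^ 'n) \<Rightarrow> complex) \<Rightarrow> (real ^ 'n \<Rightarrow> real ^ 'n) \<Rightarrow> complex" where
  "gen_op (Tgen i) f w = tabT i f w"
| "gen_op (Xgen \<nu>) f w = (if w \<in> F then weyl_act w t \<nu> * f w else 0)"

lemma gen_op_Tgen [simp]: "gen_op (Tgen i) = tabT i"
  by (simp add: fun_eq_iff)

definition rep :: "('n hecke_gen free_monoid \<Rightarrow>\<^sub>0 complex) \<Rightarrow>
    ((real ^ 'n \<Rightarrow> real ^ 'n) \<Rightarrow> complex) \<Rightarrow> (real ^ 'n \<Rightarrow> real ^ 'n) \<Rightarrow> complex"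
  where "rep x f w = pm_eval (\<lambda>u. foldr gen_op (letters u) f w) x"

lemma gen_op_linear:
  "gen_op g (\<lambda>w. f w + h w) = (\<lambda>w. gen_op g f w + gen_op g h w)"
  "gen_op g (\<lambda>w. c * f w) = (\<lambda>w. c * gen_op g f w)"
  "gen_op g (\<lambda>w. 0) = (\<lambda>w. 0)"
  by (cases g; simp add: fun_eq_iff tabT_def hecke_op_def algebra_simps)+

lemma foldr_gen_op_linear:
  "foldr gen_op gs (\<lambda>w. f w + h w) = (\<lambda>w. foldr gen_op gs f w + foldr gen_op gs h w)"
  "foldr gen_op gs (\<lambda>w. c * f w) = (\<lambda>w. c * foldr gen_op gs f w)"
  "foldr gen_op gs (\<lambda>w. 0) = (\<lambda>w. 0)"
  by (induction gs) (simp_all add: gen_op_linear)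

lemma foldr_gen_op_sum:
  "foldr gen_op gs (\<lambda>w. \<Sum>a\<in>A. c a * f a w) = (\<lambda>w. \<Sum>a\<in>A. c a * foldr gen_op gs (f a) w)"
  by (induction A rule: infinite_finite_induct) (simp_all add: foldr_gen_op_linear)

lemma gen_op_supp: "(\<And>v. v \<notin> F \<Longrightarrow> f v = 0) \<Longrightarrow> w \<notin> F \<Longrightarrow> foldr gen_op gs f w = 0"
  by (cases gs, simp) (rename_tac g gs', case_tac g; simp add: tabT_supp)

lemma rep_supp: "(\<And>v. v \<notin> F \<Longrightarrow> f v = 0) \<Longrightarrow> w \<notin> F \<Longrightarrow> rep x f w = 0"
  by (simp add: rep_def pm_eval_def gen_op_supp)

lemma rep_plus: "rep (x + y) f = (\<lambda>w. rep x f w + rep y f w)"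
  and rep_minus: "rep (x - y) f = (\<lambda>w. rep x f w - rep y f w)"
  and rep_uminus: "rep (- x) f = (\<lambda>w. - rep x f w)"
  by (simp_all add: rep_def pm_eval_add pm_eval_diff pm_eval_uminus fun_eq_iff)

lemma rep_times: "rep (x * y) f = rep x (rep y f)"
proof
  fix w
  have "rep y f = (\<lambda>w. \<Sum>l\<in>Poly_Mapping.keys y. lookup y l * foldr gen_op (letters l) f w)"
    by (simp add: rep_def pm_eval_def fun_eq_iff)
  then have "foldr gen_op (letters k) (rep y f) w = pm_eval (\<lambda>l. foldr gen_op (letters (k + l)) f w) y" for k
    by (simp add: foldr_gen_op_sum pm_eval_def plus_free_monoid_def)
  then show "rep (x * y) f w = rep x (rep y f) w"
    by (simp add: rep_def[of x] rep_def[of "x * y"] pm_eval_mult) (simp add: pm_eval_def)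
qed

lemma rep_word: "rep (word gs) f = foldr gen_op gs f"
  and rep_scalar: "rep (scalar c) f = (\<lambda>w. c * f w)"
  and rep_one: "rep 1 f = f"
  and rep_zero: "rep 0 f = (\<lambda>w. 0)"
  by (simp_all add: rep_def word_def scalar_def zero_free_monoid_def fun_eq_iff)

lemma rep_add_right: "rep x (\<lambda>w. f w + h w) = (\<lambda>w. rep x f w + rep x h w)"
  by (simp add: rep_def pm_eval_def foldr_gen_op_linear distrib_left sum.distrib fun_eq_iff)

lemma rep_zero_right: "rep x (\<lambda>w. 0) = (\<lambda>w. 0)"
  by (simp add: rep_def pm_eval_def foldr_gen_op_linear fun_eq_iff)

lemma foldr_gen_op_Tgen: "foldr gen_op (map Tgen ks) f = word_tab ks f"
  by (induction ks) simp_all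

lemma rep_sum: "rep (sum x A) f w = (\<Sum>a\<in>A. rep (x a) f w)"
  by (simp add: rep_def pm_eval_sum)

lemma rep_lift_X: "w \<in> F \<Longrightarrow> rep (lift_X p) f w = pm_eval (weyl_act w t) p * f w"
  by (simp add: lift_X_def rep_sum rep_times rep_scalar rep_word pm_eval_def sum_distrib_right mult.assoc)

text \<open>A character is multiplicative on P, so it can be applied to the identity defining the
  quotient. This determines the value of p wherever the character is not 1 at alpha_i, in particular
  at the weights of tableaux.\<close>

lemma demazure_eval:
  assumes "weight_char \<alpha> \<tau>" "\<nu> \<in> P" "demazure_quotient \<alpha> i \<nu> p"
  shows "pm_eval \<tau> p * (1 - inverse (\<tau> (\<alpha> i))) = \<tau> \<nu> - \<tau> (s i \<nu>)"
proof -
  have p: "Poly_Mapping.keys p \<subseteq> P"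
    and eq: "p * (1 - Poly_Mapping.single (- \<alpha> i) 1) = Poly_Mapping.single \<nu> 1 - Poly_Mapping.single (s i \<nu>) 1"
    using assms(3) by (auto simp: demazure_quotient_def)
  have a: "\<alpha> i \<in> P" by (simp add: R_in_P simple_in_R)
  have "pm_eval \<tau> (p * Poly_Mapping.single (- \<alpha> i) 1) = (\<Sum>k\<in>Poly_Mapping.keys p. lookup p k * \<tau> (k + - \<alpha> i))"
    by (simp only: pm_eval_mult pm_eval_single mult_1)
  also have "\<dots> = (\<Sum>k\<in>Poly_Mapping.keys p. lookup p k * \<tau> k * inverse (\<tau> (\<alpha> i)))"
  proof (rule sum.cong)
    fix k assume "k \<in> Poly_Mapping.keys p"
    then have "\<tau> (k + - \<alpha> i) = \<tau> k * inverse (\<tau> (\<alpha> i))"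
      using weight_char_add[OF assms(1) _ P_uminus[OF a]] weight_char_uminus[OF assms(1) a] p by auto
    then show "lookup p k * \<tau> (k + - \<alpha> i) = lookup p k * \<tau> k * inverse (\<tau> (\<alpha> i))"
      by simp
  qed simp
  also have "\<dots> = pm_eval \<tau> p * inverse (\<tau> (\<alpha> i))"
    by (simp add: pm_eval_def sum_distrib_right)
  finally have "pm_eval \<tau> (p * (1 - Poly_Mapping.single (- \<alpha> i) 1)) = pm_eval \<tau> p * (1 - inverse (\<tau> (\<alpha> i)))"
    by (simp add: right_diff_distrib pm_eval_diff)
  then show ?thesis
    by (simp add: eq pm_eval_diff)
qed

lemma rep_relation:
  assumes "x \<in> hecke_relations \<alpha> q" and f: "\<And>v. v \<notin> F \<Longrightarrow> f v = 0"
  shows "rep x f = (\<lambda>w. 0)"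
  using assms(1)
proof (induction rule: hecke_relations.induct)
  case (quadratic i)
  show ?case
    using tabT_quadratic[where f = f and i = i, OF f]
    by (simp add: rep_minus rep_plus rep_times rep_scalar rep_word rep_one fun_eq_iff)
next
  case (braid i j)
  then show ?case
    using tabT_braid[where f = f, OF f braid]
    by (simp add: rep_minus rep_word alternating_map foldr_gen_op_Tgen)
next
  case (X_mult \<nu> \<mu>)
  then show ?case
    using weight_char_add[OF weyl_act_char[OF F_W]] by (simp add: rep_minus rep_word fun_eq_iff)
next
  case X_one
  show ?case
    using weight_char_zero[OF weyl_act_char[OF F_W]] f by (auto simp: rep_minus rep_word rep_one fun_eq_iff)
next
  case (X_T \<nu> i p)
  show ?case
  proof
    fix w
    let ?x = "word [Xgen \<nu>, Tgen i] - (word [Tgen i, Xgen (s i \<nu>)] + scalar (q - inverse q) * lift_X p)"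
    show "rep ?x f w = 0"
    proof (cases "w \<in> F")
      case True
      have wW: "w \<in> W" using F_W True .
      define x c where "x = weyl_act w t (\<alpha> i)" and "c = cfun q x"
      have x: "x \<noteq> 1" "x \<noteq> 0"
        using weyl_act_not_one[OF True] weyl_act_simple_nonzero[OF wW] by (simp_all add: x_def)
      have "pm_eval (weyl_act w t) p * (1 - inverse x) = weyl_act w t \<nu> - weyl_act w t (s i \<nu>)"
        using demazure_eval[OF weyl_act_char[OF wW] X_T] by (simp add: x_def)
      moreover have "(c - inverse q) * (1 - inverse x) = q - inverse q"
        using x q_nonzero unfolding c_def cfun_def by (simp add: divide_simps) (simp add: algebra_simps)
      moreover have "1 - inverse x \<noteq> 0" using x by simp
      ultimately have key: "(c - inverse q) * (weyl_act w t \<nu> - weyl_act w t (s i \<nu>))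
          = (q - inverse q) * pm_eval (weyl_act w t) p"
        by (metis mult.assoc mult.commute)
      \<comment> \<open>The off-diagonal contributions of both orders of multiplication agree,
        because s_i w t at s_i nu equals w t at nu. Only the diagonal remains, and
        \<open>key\<close> identifies it with the quotient term.\<close>
      have "weyl_act (sl i w) t (s i \<nu>) = weyl_act w t \<nu>"
        by (simp add: weyl_act_s[OF wW])
      moreover have "f (sl i w) = 0" if "sl i w \<notin> F" using f that .
      ultimately have 1: "rep (word [Tgen i, Xgen (s i \<nu>)]) f w
          = (c - inverse q) * weyl_act w t (s i \<nu>) * f w + wt i (sl i w) * (weyl_act w t \<nu> * f (sl i w))"
        using True wW by (auto simp: rep_word tabT_def hecke_op_def wt_def[of i w] x_def c_def)
      have 2: "rep (word [Xgen \<nu>, Tgen i]) f w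
          = weyl_act w t \<nu> * ((c - inverse q) * f w + wt i (sl i w) * f (sl i w))"
        using True wW by (auto simp: rep_word tabT_def hecke_op_def wt_def[of i w] x_def c_def)
      have 3: "rep (scalar (q - inverse q) * lift_X p) f w
          = (c - inverse q) * (weyl_act w t \<nu> - weyl_act w t (s i \<nu>)) * f w"
        using True by (simp add: rep_times rep_scalar rep_lift_X key)
      show ?thesis
        unfolding rep_minus rep_plus 1 2 3 by (simp add: algebra_simps)
    qed (use rep_supp f in blast)
  qed
qed

end

section \<open>The module\<close>

lemma lookup_vscale [simp]: "lookup (vscale c v) w = c * lookup v w"
  by (simp add: vscale_def map.rep_eq when_def)

lemma lookup_tab_vec: "lookup (tab_vec F w) v = (if w \<in> F \<and> v = w then 1 else 0)"
  by (auto simp: tab_vec_def lookup_single when_def)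

context skew_shape
begin

abbreviation "A \<equiv> free_algebra (hecke_gens \<alpha>)"
abbreviation "I \<equiv> hecke_ideal \<alpha> q"

lemma ideal_hecke: "ideal I A"
  unfolding hecke_ideal_def
  by (rule ring.genideal_ideal[OF free_algebra_ring hecke_relations_carrier])

lemma rep_ideal:
  assumes "x \<in> I" and f: "\<And>v. v \<notin> F \<Longrightarrow> f v = 0"
  shows "rep x f = (\<lambda>w. 0)"
proof -
  interpret A: ring A by (rule free_algebra_ring)
  \<comment> \<open>The annihilator of the functions supported on \<open>F\<close>. It absorbs right
    factors because \<open>rep\<close> preserves this support.\<close>
  let ?K = "{x \<in> carrier A. \<forall>f. (\<forall>v. v \<notin> F \<longrightarrow> f v = 0) \<longrightarrow> rep x f = (\<lambda>w. 0)}"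
  have uminus: "\<ominus>\<^bsub>A\<^esub> x = - x" if "x \<in> carrier A" for x
    using A.minus_equality[of "- x" x] that free_algebra_closed(3)[OF that that] by (simp add: free_algebra_simps)
  have "ideal ?K A"
  proof (rule idealI[OF free_algebra_ring])
    show "subgroup ?K (add_monoid A)"
    proof (rule group.subgroupI[OF A.add.is_group])
      show "?K \<noteq> {}" using free_algebra_zero rep_zero by blast
      fix a assume "a \<in> ?K"
      then show "inv\<^bsub>add_monoid A\<^esub> a \<in> ?K"
        using uminus[of a] free_algebra_closed(3)[of a _ a] by (simp add: a_inv_def rep_uminus)
    qed (auto simp: free_algebra_simps free_algebra_closed(1) rep_plus)
    fix a x assume a: "a \<in> ?K" and x: "x \<in> carrier A"
    show "x \<otimes>\<^bsub>A\<^esub> a \<in> ?K"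
      using a x by (auto simp: free_algebra_simps free_algebra_closed(2) rep_times rep_zero_right)
    show "a \<otimes>\<^bsub>A\<^esub> x \<in> ?K"
      using a x by (auto simp: free_algebra_simps free_algebra_closed(2) rep_times rep_supp)
  qed
  moreover have "hecke_relations \<alpha> q \<subseteq> ?K"
    using hecke_relations_carrier rep_relation by auto
  ultimately have "I \<subseteq> ?K"
    unfolding hecke_ideal_def by (rule A.genideal_minimal)
  then show ?thesis using assms by blast
qed

definition to_pm :: "((real ^ 'n \<Rightarrow> real ^ 'n) \<Rightarrow> complex) \<Rightarrow> (real ^ 'n \<Rightarrow> real ^ 'n) \<Rightarrow>\<^sub>0 complex"
  where "to_pm f = Abs_poly_mapping (\<lambda>w. if w \<in> F then f w else 0)"

lemma lookup_to_pm: "lookup (to_pm f) w = (if w \<in> F then f w else 0)"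
proof -
  have "finite {w. (if w \<in> F then f w else 0) \<noteq> 0}"
    by (rule finite_subset[OF _ finite_F]) auto
  then show ?thesis by (simp add: to_pm_def)
qed

text \<open>A coset acts through a chosen representative; \<open>rep_ideal\<close> makes the choice
  harmless on vectors supported on \<open>F\<close>.\<close>

definition act :: "('n hecke_gen free_monoid \<Rightarrow>\<^sub>0 complex) set \<Rightarrow>
    ((real ^ 'n \<Rightarrow> real ^ 'n) \<Rightarrow>\<^sub>0 complex) \<Rightarrow> (real ^ 'n \<Rightarrow> real ^ 'n) \<Rightarrow>\<^sub>0 complex"
  where "act a v = to_pm (rep (SOME x. x \<in> a) (lookup v))"

abbreviation "M \<equiv> tab_module F act"

lemma carrier_M: "v \<in> carrier M \<longleftrightarrow> (\<forall>w. w \<notin> F \<longrightarrow> lookup v w = 0)"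
  by (auto simp: tab_module_def in_keys_iff)

lemma M_simps: "x \<oplus>\<^bsub>M\<^esub> y = x + y" "\<zero>\<^bsub>M\<^esub> = 0" "a \<odot>\<^bsub>M\<^esub> x = act a x"
  by (simp_all add: tab_module_def)

lemma lookup_act:
  assumes x: "x \<in> carrier A" and v: "v \<in> carrier M"
  shows "lookup (act (hecke_class \<alpha> q x) v) = rep x (lookup v)"
proof -
  interpret ideal I A by (rule ideal_hecke)
  let ?a = "hecke_class \<alpha> q x" and ?f = "lookup v"
  have f: "?f w = 0" if "w \<notin> F" for w using v that by (simp add: carrier_M)
  have "x \<in> ?a"
    unfolding hecke_class_def by (rule a_rcos_self[OF x])
  then have "(SOME y. y \<in> ?a) \<in> ?a" by (rule someI)
  then obtain i where "i \<in> I" "(SOME y. y \<in> ?a) = i + x"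
    by (auto simp: hecke_class_def a_r_coset_def' free_algebra_simps)
  then have "rep (SOME y. y \<in> ?a) ?f = rep x ?f"
    by (simp add: rep_plus rep_ideal f)
  then show ?thesis
    using rep_supp[of ?f] f by (simp add: act_def lookup_to_pm fun_eq_iff)
qed

lemma act_closed: "act a v \<in> carrier M"
  by (simp add: carrier_M act_def lookup_to_pm)

lemma hecke_carrierE:
  assumes "a \<in> carrier (affine_hecke \<alpha> q)"
  obtains x where "x \<in> carrier A" "a = hecke_class \<alpha> q x"
  using assms by (auto simp: affine_hecke_def FactRing_def A_RCOSETS_def' hecke_class_def)

lemma hecke_class_carrier: "x \<in> carrier A \<Longrightarrow> hecke_class \<alpha> q x \<in> carrier (affine_hecke \<alpha> q)"
  by (auto simp: affine_hecke_def FactRing_def A_RCOSETS_def' hecke_class_def)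

lemma hecke_class_ops:
  assumes "x \<in> carrier A" "y \<in> carrier A"
  shows "hecke_class \<alpha> q x \<oplus>\<^bsub>affine_hecke \<alpha> q\<^esub> hecke_class \<alpha> q y = hecke_class \<alpha> q (x + y)"
    "hecke_class \<alpha> q x \<otimes>\<^bsub>affine_hecke \<alpha> q\<^esub> hecke_class \<alpha> q y = hecke_class \<alpha> q (x * y)"
    "\<one>\<^bsub>affine_hecke \<alpha> q\<^esub> = hecke_class \<alpha> q 1"
proof -
  interpret ideal I A by (rule ideal_hecke)
  show "hecke_class \<alpha> q x \<oplus>\<^bsub>affine_hecke \<alpha> q\<^esub> hecke_class \<alpha> q y = hecke_class \<alpha> q (x + y)"
    using a_rcos_sum[OF assms] by (simp add: affine_hecke_def FactRing_def hecke_class_def free_algebra_simps)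
  show "hecke_class \<alpha> q x \<otimes>\<^bsub>affine_hecke \<alpha> q\<^esub> hecke_class \<alpha> q y = hecke_class \<alpha> q (x * y)"
    using rcoset_mult_add[OF assms] by (simp add: affine_hecke_def FactRing_def hecke_class_def free_algebra_simps)
  show "\<one>\<^bsub>affine_hecke \<alpha> q\<^esub> = hecke_class \<alpha> q 1"
    by (simp add: affine_hecke_def FactRing_def hecke_class_def free_algebra_simps)
qed

lemma abelian_group_M: "abelian_group M"
proof (rule abelian_groupI)
  fix x assume "x \<in> carrier M"
  then show "\<exists>y\<in>carrier M. y \<oplus>\<^bsub>M\<^esub> x = \<zero>\<^bsub>M\<^esub>"
    by (intro bexI[of _ "- x"]) (simp_all add: M_simps carrier_M)
qed (simp_all add: M_simps carrier_M lookup_add add_ac)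

lemma left_module_M: "left_module (affine_hecke \<alpha> q) M"
proof -
  have add: "x + y \<in> carrier M" if "x \<in> carrier M" "y \<in> carrier M" for x y
    using that by (simp add: carrier_M lookup_add)
  have lookup_plus: "lookup (x + y) = (\<lambda>w. lookup x w + lookup y w)"
    for x y :: "(real ^ 'n \<Rightarrow> real ^ 'n) \<Rightarrow>\<^sub>0 complex"
    by (simp add: fun_eq_iff lookup_add)
  have "module_axioms (affine_hecke \<alpha> q) M"
  proof
    fix a x assume "a \<in> carrier (affine_hecke \<alpha> q)" "x \<in> carrier M"
    show "a \<odot>\<^bsub>M\<^esub> x \<in> carrier M" by (simp add: M_simps act_closed)
  next
    fix a b v assume "a \<in> carrier (affine_hecke \<alpha> q)" "b \<in> carrier (affine_hecke \<alpha> q)" and v: "v \<in> carrier M"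
    then obtain x y where xy: "x \<in> carrier A" "a = hecke_class \<alpha> q x" "y \<in> carrier A" "b = hecke_class \<alpha> q y"
      by (elim hecke_carrierE)
    show "(a \<oplus>\<^bsub>affine_hecke \<alpha> q\<^esub> b) \<odot>\<^bsub>M\<^esub> v = a \<odot>\<^bsub>M\<^esub> v \<oplus>\<^bsub>M\<^esub> b \<odot>\<^bsub>M\<^esub> v"
      using xy v by (intro poly_mapping_eqI)
        (simp add: M_simps hecke_class_ops lookup_act free_algebra_closed lookup_plus rep_plus)
    show "(a \<otimes>\<^bsub>affine_hecke \<alpha> q\<^esub> b) \<odot>\<^bsub>M\<^esub> v = a \<odot>\<^bsub>M\<^esub> (b \<odot>\<^bsub>M\<^esub> v)"
      using xy v by (intro poly_mapping_eqI)
        (simp add: M_simps hecke_class_ops lookup_act free_algebra_closed act_closed rep_times)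
  next
    fix a v u assume "a \<in> carrier (affine_hecke \<alpha> q)" and vu: "v \<in> carrier M" "u \<in> carrier M"
    then obtain x where "x \<in> carrier A" "a = hecke_class \<alpha> q x"
      by (elim hecke_carrierE)
    then show "a \<odot>\<^bsub>M\<^esub> (v \<oplus>\<^bsub>M\<^esub> u) = a \<odot>\<^bsub>M\<^esub> v \<oplus>\<^bsub>M\<^esub> a \<odot>\<^bsub>M\<^esub> u"
      using vu by (intro poly_mapping_eqI)
        (simp add: M_simps lookup_act add lookup_plus rep_add_right)
  next
    fix v assume v: "v \<in> carrier M"
    show "\<one>\<^bsub>affine_hecke \<alpha> q\<^esub> \<odot>\<^bsub>M\<^esub> v = v"
      by (intro poly_mapping_eqI)
        (simp add: M_simps hecke_class_ops(3)[OF free_algebra_one free_algebra_one]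
          lookup_act[OF free_algebra_one v] rep_one)
  qed
  moreover have "ring (affine_hecke \<alpha> q)"
    unfolding affine_hecke_def by (rule ideal.quotient_is_ring[OF ideal_hecke])
  ultimately show ?thesis
    by (simp add: left_module_def abelian_group_M)
qed

lemma gens_carrier: "word [Tgen i] \<in> carrier A" "\<nu> \<in> P \<Longrightarrow> word [Xgen \<nu>] \<in> carrier A"
  by (auto intro!: free_algebra_word simp: hecke_gens_def)

lemma act_scalar: "v \<in> carrier M \<Longrightarrow> act (hecke_scalar \<alpha> q c) v = vscale c v"
  by (rule poly_mapping_eqI) (simp add: lookup_act free_algebra_scalar rep_scalar)

lemma act_X:
  assumes "v \<in> carrier M" "\<nu> \<in> P"
  shows "lookup (act (hecke_X \<alpha> q \<nu>) v) w = (if w \<in> F then weyl_act w t \<nu> * lookup v w else 0)"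
  using assms by (simp add: lookup_act gens_carrier rep_word)

lemma tab_vec_carrier: "tab_vec F w \<in> carrier M"
  by (simp add: carrier_M lookup_tab_vec)

lemma act_X_tab_vec:
  assumes "w \<in> F" "\<nu> \<in> P"
  shows "act (hecke_X \<alpha> q \<nu>) (tab_vec F w) = vscale (weyl_act w t \<nu>) (tab_vec F w)"
  using assms by (intro poly_mapping_eqI) (auto simp: act_X tab_vec_carrier lookup_tab_vec)

lemma sl_neq: "sl i w \<noteq> w" if "w \<in> F"
proof
  assume eq: "sl i w = w"
  have "s i (\<alpha> i) = \<alpha> i"
    using fun_cong[OF eq, of "inv_into UNIV w (\<alpha> i)"] F_W[OF that] by (simp add: sl_apply)
  then have "ht (- \<alpha> i) = ht (\<alpha> i)"
    by (simp only: refl_at_self)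
  then show False
    by (simp add: ht_linear ht_simple)
qed

lemma act_T_tab_vec:
  assumes w: "w \<in> F"
  shows "act (hecke_T \<alpha> q i) (tab_vec F w) = vscale (T_diag \<alpha> q t i w) (tab_vec F w)
      + vscale (inverse q + T_diag \<alpha> q t i w) (tab_vec F (s i \<circ> w))"
proof (rule poly_mapping_eqI)
  fix v
  let ?\<delta> = "lookup (tab_vec F w)"
  have wt: "wt i w = inverse q + T_diag \<alpha> q t i w"
    using F_W[OF w] tabT_T_diag[OF w] by (simp add: wt_def)
  have "lookup (act (hecke_T \<alpha> q i) (tab_vec F w)) v = tabT i ?\<delta> v"
    by (simp add: lookup_act gens_carrier tab_vec_carrier rep_word)
  also have "\<dots> = T_diag \<alpha> q t i w * ?\<delta> v
      + (inverse q + T_diag \<alpha> q t i w) * lookup (tab_vec F (sl i w)) v"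
  proof (cases "v \<in> F")
    case True
    show ?thesis
    proof (cases "v = w")
      case True
      then show ?thesis
        using w wt sl_neq[OF w, of i] by (auto simp: tabT_def hecke_op_def lookup_tab_vec)
    next
      case False
      then show ?thesis
        using w \<open>v \<in> F\<close> wt sl_sl[of i v] sl_sl[of i w] by (auto simp: tabT_def hecke_op_def lookup_tab_vec)
    qed
  next
    case False
    then show ?thesis using w by (auto simp: tabT_supp lookup_tab_vec)
  qed
  finally show "lookup (act (hecke_T \<alpha> q i) (tab_vec F w)) v
      = lookup (vscale (T_diag \<alpha> q t i w) (tab_vec F w)
      + vscale (inverse q + T_diag \<alpha> q t i w) (tab_vec F (s i \<circ> w))) v"
    by (simp add: lookup_add sl_def)
qed

section \<open>Irreducibility: distinct weights, connectedness of the tableaux, submodules\<close>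

lemma tableaux_separated:
  assumes w: "w \<in> F" and w': "w' \<in> F" and ne: "w \<noteq> w'"
  shows "\<exists>\<nu>\<in>P. weyl_act w t \<nu> \<noteq> weyl_act w' t \<nu>"
proof (rule ccontr)
  assume "\<not> ?thesis"
  then have eq: "weyl_act w t \<nu> = weyl_act w' t \<nu>" if "\<nu> \<in> P" for \<nu> using that by blast
  have W: "w \<in> W" "w' \<in> W" using w w' F_W by auto
  \<comment> \<open>Equal weights mean that z fixes t. For beta in Z(t), w sends z beta to w' beta,
    which is positive; as w keeps Z(t) positive, z beta cannot be negative. So z preserves Z(t), as
    \<open>weight_stabilizer_trivial\<close> requires.\<close>
  define z where "z = inv_into UNIV w \<circ> w'"
  have z: "z \<in> W" unfolding z_def using W by (intro refl_group_comp refl_group_inverse)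
  have fixed: "t (z \<mu>) = t \<mu>" if "\<mu> \<in> P" for \<mu>
    using eq[OF W_P[OF W(2) that]] weyl_act_apply[OF W(2)] by (simp add: z_def weyl_act_def)
  have "z \<beta> \<in> Z_set R \<alpha> t" if \<beta>: "\<beta> \<in> Z_set R \<alpha> t" for \<beta>
  proof -
    have R: "\<beta> \<in> R" "t \<beta> = 1" using \<beta> by (auto simp: Z_set_def pos_roots_in_R)
    have zR: "z \<beta> \<in> R" and tz: "t (z \<beta>) = 1"
      using W_R[OF z R(1)] fixed[OF R_in_P[OF R(1)]] R(2) by simp_all
    have wz: "ht (w (z \<beta>)) > 0"
      using F_iff[OF w' W(2)] w' \<beta> W(1) by (simp add: z_def)
    have "\<not> - z \<beta> \<in> pos_roots R \<alpha>"
    proof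
      assume n: "- z \<beta> \<in> pos_roots R \<alpha>"
      then have "- z \<beta> \<in> Z_set R \<alpha> t"
        using tz weight_char_uminus[OF t_char R_in_P[OF zR]] by (simp add: Z_set_def)
      then have "ht (w (- z \<beta>)) > 0" using F_iff[OF w W(1)] w by blast
      then show False using wz by (simp add: W_uminus W ht_linear)
    qed
    then show ?thesis
      using root_pos_or_neg[OF zR] tz by (simp add: Z_set_def)
  qed
  then have "z = id" using weight_stabilizer_trivial[OF t_char z fixed] by blast
  then have "w (z x) = w x" for x by simp
  then show False using ne W(1) by (simp add: z_def fun_eq_iff)
qed

text \<open>Some gamma = w^-1 alpha_i is sent to a negative root by w'. Equality of the active sets
  of w and w' excludes the values q^2 and q^-2 at gamma, so s_i w is a tableau, and gamma no longer
  separates it from w'.\<close>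

lemma tableaux_connected_step:
  assumes w: "w \<in> F" and w': "w' \<in> F" and ne: "w \<noteq> w'"
  shows "\<exists>i. sl i w \<in> F \<and> card {\<beta>\<in>R. ht (sl i w \<beta>) > 0 \<and> ht (w' \<beta>) < 0}
    < card {\<beta>\<in>R. ht (w \<beta>) > 0 \<and> ht (w' \<beta>) < 0}"
proof -
  have W: "w \<in> W" "w' \<in> W" using w w' F_W by auto
  let ?w = "inv_into UNIV w"
  have "w' \<circ> ?w \<noteq> id"
  proof
    assume "w' \<circ> ?w = id"
    then have "w' (?w (w x)) = w x" for x by (simp add: fun_eq_iff)
    then show False using ne W(1) by (simp add: fun_eq_iff)
  qed
  moreover have "w' \<circ> ?w \<in> W" using W refl_group_comp refl_group_inverse by blast
  ultimately obtain i where "ht ((w' \<circ> ?w) (\<alpha> i)) < 0" using W_neg_simple_ex by blast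
  then have i: "ht (w' (?w (\<alpha> i))) < 0" by simp
  let ?\<gamma> = "?w (\<alpha> i)"
  have \<gamma>: "?\<gamma> \<in> R" "w ?\<gamma> = \<alpha> i" "t ?\<gamma> = weyl_act w t (\<alpha> i)"
    using W by (simp_all add: W_R refl_group_inverse simple_in_R weyl_act_def)
  have act: "active w = active w'" using F_iff[OF w' W(1)] w by blast
  have "t ?\<gamma> \<noteq> q\<^sup>2"
  proof
    assume "t ?\<gamma> = q\<^sup>2"
    then have "?\<gamma> \<in> active w" "?\<gamma> \<notin> active w'" using \<gamma> i by (simp_all add: active_def ht_simple)
    then show False using act by blast
  qed
  moreover have "t ?\<gamma> \<noteq> inverse (q\<^sup>2)"
  proof
    assume "t ?\<gamma> = inverse (q\<^sup>2)"
    then have "t (- ?\<gamma>) = q\<^sup>2" using weight_char_uminus[OF t_char R_in_P[OF \<gamma>(1)]] by simp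
    then have "- ?\<gamma> \<in> active w'" "- ?\<gamma> \<notin> active w"
      using \<gamma> i W by (simp_all add: active_def ht_simple W_uminus ht_linear uminus_R)
    then show False using act by blast
  qed
  ultimately have "sl i w \<in> F" using F_s_iff[OF w] \<gamma>(3) by simp
  moreover have "{\<beta>\<in>R. ht (sl i w \<beta>) > 0 \<and> ht (w' \<beta>) < 0} \<subset> {\<beta>\<in>R. ht (w \<beta>) > 0 \<and> ht (w' \<beta>) < 0}"
  proof
    show "{\<beta>\<in>R. ht (sl i w \<beta>) > 0 \<and> ht (w' \<beta>) < 0} \<subseteq> {\<beta>\<in>R. ht (w \<beta>) > 0 \<and> ht (w' \<beta>) < 0}"
    proof safe
      fix \<beta> assume \<beta>: "\<beta> \<in> R" "ht (sl i w \<beta>) > 0" "ht (w' \<beta>) < 0"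
      have "w \<beta> \<noteq> - \<alpha> i"
      proof
        assume "w \<beta> = - \<alpha> i"
        then have "w \<beta> = w (- ?\<gamma>)" using \<gamma>(2) W by (simp add: W_uminus)
        then have "\<beta> = - ?\<gamma>" using W(1) by (metis refl_group_inv_apply(2))
        then show False using \<beta>(3) i W by (simp add: W_uminus ht_linear)
      qed
      moreover have "w \<beta> \<noteq> \<alpha> i" using \<beta>(2) by (auto simp: sl_apply refl_at_self ht_linear ht_simple)
      ultimately show "ht (w \<beta>) > 0"
        using \<beta> s_pos_iff[OF W_R[OF W(1) \<beta>(1)]] by (simp add: sl_apply)
    qed
    have "?\<gamma> \<in> {\<beta>\<in>R. ht (w \<beta>) > 0 \<and> ht (w' \<beta>) < 0}" "?\<gamma> \<notin> {\<beta>\<in>R. ht (sl i w \<beta>) > 0 \<and> ht (w' \<beta>) < 0}"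
      using \<gamma> i by (simp_all add: ht_simple sl_apply refl_at_self ht_linear)
    then show "{\<beta>\<in>R. ht (sl i w \<beta>) > 0 \<and> ht (w' \<beta>) < 0} \<noteq> {\<beta>\<in>R. ht (w \<beta>) > 0 \<and> ht (w' \<beta>) < 0}"
      by blast
  qed
  ultimately show ?thesis
    using psubset_card_mono[of "{\<beta>\<in>R. ht (w \<beta>) > 0 \<and> ht (w' \<beta>) < 0}"] finite_R by auto
qed

lemma irreducible_M: "irreducible_module (affine_hecke \<alpha> q) M"
proof -
  have "carrier M \<noteq> {\<zero>\<^bsub>M\<^esub>}"
  proof -
    obtain w where w: "w \<in> F" using F_nonempty by blast
    then have "tab_vec F w \<noteq> 0"
      using lookup_tab_vec[of F w w] by force
    then show ?thesis using tab_vec_carrier[of w] by (auto simp: M_simps)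
  qed
  moreover have "N = carrier M" if N: "submodule N (affine_hecke \<alpha> q) M" and ne: "N \<noteq> {\<zero>\<^bsub>M\<^esub>}" for N
  proof -
    interpret N: subgroup N "add_monoid M" using N by (rule submodule.axioms)
    have sub: "v \<in> carrier M" if "v \<in> N" for v using that N.subset by auto
    have zero: "0 \<in> N" using N.one_closed by (simp add: M_simps)
    have add: "u + v \<in> N" if "u \<in> N" "v \<in> N" for u v
      using N.m_closed[OF that] by (simp add: M_simps)
    have act: "act (hecke_class \<alpha> q x) v \<in> N" if "x \<in> carrier A" "v \<in> N" for x v
      using submodule.smult_closed[OF N hecke_class_carrier[OF that(1)] that(2)] by (simp add: M_simps)
    have scale: "vscale c v \<in> N" if "v \<in> N" for c v
      using act[OF free_algebra_scalar that, of c] act_scalar[OF sub[OF that]] by simp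
    have "\<exists>w\<in>F. tab_vec F w \<in> N"
    proof -
      obtain v where "v \<in> N \<and> v \<noteq> 0"
        using ne zero by (auto simp: M_simps)
      then obtain v where v: "v \<in> N" "v \<noteq> 0"
        and min: "\<And>u. u \<in> N \<Longrightarrow> u \<noteq> 0 \<Longrightarrow> card (Poly_Mapping.keys v) \<le> card (Poly_Mapping.keys u)"
        using ex_has_least_nat[of "\<lambda>v. v \<in> N \<and> v \<noteq> 0" v "\<lambda>v. card (Poly_Mapping.keys v)"] by blast
      have keys: "w \<in> F" if "w \<in> Poly_Mapping.keys v" for w
        using sub[OF v(1)] that by (auto simp: carrier_M in_keys_iff)
      obtain w where w: "w \<in> Poly_Mapping.keys v" using v(2) by fastforce
      have only: "w' = w" if w': "w' \<in> Poly_Mapping.keys v" for w'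
      proof (rule ccontr)
        assume "w' \<noteq> w"
        then obtain \<nu> where \<nu>: "\<nu> \<in> P" "weyl_act w' t \<nu> \<noteq> weyl_act w t \<nu>"
          using tableaux_separated keys w w' by blast
        \<comment> \<open>Subtracting the eigenvalue at w removes w from the support and keeps w',
          against the minimality of v.\<close>
        define u where "u = act (hecke_X \<alpha> q \<nu>) v + vscale (- weyl_act w t \<nu>) v"
        have u: "u \<in> N"
          unfolding u_def using v(1) \<nu>(1) by (intro add act scale gens_carrier)
        have lookup: "lookup u x = (weyl_act x t \<nu> - weyl_act w t \<nu>) * lookup v x" for x
          using sub[OF v(1)] \<nu>(1)
          by (cases "x \<in> F") (auto simp: u_def lookup_add act_X carrier_M algebra_simps)
        have "w' \<in> Poly_Mapping.keys u" using w' \<nu>(2) by (simp add: in_keys_iff lookup)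
        then have "u \<noteq> 0" by auto
        moreover have "Poly_Mapping.keys u \<subset> Poly_Mapping.keys v"
        proof
          show "Poly_Mapping.keys u \<subseteq> Poly_Mapping.keys v" by (auto simp: in_keys_iff lookup)
          show "Poly_Mapping.keys u \<noteq> Poly_Mapping.keys v" using w by (auto simp: in_keys_iff lookup set_eq_iff)
        qed
        ultimately show False
          using min[OF u] psubset_card_mono[OF finite_keys] by (meson not_le)
      qed
      have "lookup v w' = 0" if "w' \<noteq> w" for w'
        using only that in_keys_iff by metis
      moreover have "lookup v w \<noteq> 0" using w by (simp add: in_keys_iff)
      ultimately have "vscale (inverse (lookup v w)) v = tab_vec F w"
        using keys[OF w] by (intro poly_mapping_eqI) (simp add: lookup_tab_vec)
      then show ?thesis using scale[OF v(1)] keys[OF w] by metis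
    qed
    then obtain w where w: "w \<in> F" "tab_vec F w \<in> N" by blast
    have step: "tab_vec F (sl i w) \<in> N" if "w \<in> F" "sl i w \<in> F" "tab_vec F w \<in> N" for i w
    proof -
      let ?c = "inverse q + T_diag \<alpha> q t i w"
      have x: "weyl_act w t (\<alpha> i) \<noteq> inverse (q\<^sup>2)" "weyl_act w t (\<alpha> i) \<noteq> 1"
        using F_s_iff that(1,2) weyl_act_not_one by blast+
      \<comment> \<open>\<open>?c\<close> is c at the weight of w, whose only zero is q^-2; that
        value is excluded because s_i w is a tableau.\<close>
      have "?c \<noteq> 0"
        unfolding tabT_T_diag[OF that(1), symmetric] cfun_def
        using x q_nonzero by (auto simp: field_simps power2_eq_square)
      have "act (hecke_T \<alpha> q i) (tab_vec F w) + vscale (- T_diag \<alpha> q t i w) (tab_vec F w) \<in> N"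
        using that(3) by (intro add act scale gens_carrier)
      also have "act (hecke_T \<alpha> q i) (tab_vec F w) + vscale (- T_diag \<alpha> q t i w) (tab_vec F w)
          = vscale ?c (tab_vec F (sl i w))"
        by (rule poly_mapping_eqI) (simp add: act_T_tab_vec[OF that(1)] lookup_add sl_def)
      finally have "vscale (inverse ?c) (vscale ?c (tab_vec F (sl i w))) \<in> N"
        by (rule scale)
      also have "vscale (inverse ?c) (vscale ?c (tab_vec F (sl i w))) = tab_vec F (sl i w)"
        using \<open>?c \<noteq> 0\<close> by (intro poly_mapping_eqI) simp
      finally show ?thesis .
    qed
    have all: "tab_vec F w' \<in> N" if w': "w' \<in> F" for w'
      using w
    proof (induction "card {\<beta>\<in>R. ht (w \<beta>) > 0 \<and> ht (w' \<beta>) < 0}" arbitrary: w rule: less_induct)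
      case less
      show ?case
      proof (cases "w = w'")
        case False
        then show ?thesis
          using tableaux_connected_step[OF less.prems(1) w' False] less step by blast
      qed (use less in simp)
    qed
    have "v \<in> N" if v: "v \<in> carrier M" for v
    proof -
      have mem: "(\<Sum>w\<in>B. vscale (lookup v w) (tab_vec F w)) \<in> N" if "B \<subseteq> F" for B
        using finite_subset[OF that finite_F] that
        by (induction B rule: finite_induct) (simp_all add: zero add scale all)
      have eq: "v = (\<Sum>w\<in>F. vscale (lookup v w) (tab_vec F w))"
      proof (rule poly_mapping_eqI)
        fix w
        have "lookup (\<Sum>w\<in>F. vscale (lookup v w) (tab_vec F w)) w
            = (\<Sum>u\<in>F. if u = w then lookup v u else 0)"
          unfolding lookup_sum by (rule sum.cong) (auto simp: lookup_tab_vec)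
        then show "lookup v w
            = lookup (\<Sum>w\<in>F. vscale (lookup v w) (tab_vec F w)) w"
          using v by (simp add: finite_F carrier_M)
      qed
      show ?thesis by (subst eq) (rule mem[OF order_refl])
    qed
    then show ?thesis using sub by blast
  qed
  ultimately show ?thesis
    unfolding irreducible_module_def using left_module_M by blast
qed

end

text \<open>Submodules here are additive subgroups closed under the algebra. The clause on
  \<open>hecke_scalar\<close> ties constants of the algebra to the complex structure of the span, so
  these submodules are complex subspaces.\<close>

theorem theorem3p1:
  fixes R :: "(real ^ 'n) set" and \<alpha> :: "'n \<Rightarrow> real ^ 'n" and q :: complex
    and t :: "real ^ 'n \<Rightarrow> complex" and J :: "(real ^ 'n) set"
  assumes "reduced_root_system R" and "irreducible_root_system R" and "simple_roots R \<alpha>"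
    and "q \<noteq> 0" and "\<And>k::nat. k > 0 \<Longrightarrow> q ^ k \<noteq> 1"
    and "placed_skew_shape R \<alpha> q t J"
  shows "let F = std_tableaux R \<alpha> q t J in \<exists>act.
    irreducible_module (affine_hecke \<alpha> q) (tab_module F act) \<and>
    (\<forall>c. \<forall>v\<in>carrier (tab_module F act). act (hecke_scalar \<alpha> q c) v = vscale c v) \<and>
    (\<forall>w\<in>F. \<forall>\<nu>\<in>weight_lattice \<alpha>.
      act (hecke_X \<alpha> q \<nu>) (tab_vec F w) = vscale (weyl_act w t \<nu>) (tab_vec F w)) \<and>
    (\<forall>w\<in>F. \<forall>i.
      act (hecke_T \<alpha> q i) (tab_vec F w) =
        vscale (T_diag \<alpha> q t i w) (tab_vec F w)
        + vscale (inverse q + T_diag \<alpha> q t i w) (tab_vec F (simple_refl \<alpha> i \<circ> w)))"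
proof -
  interpret skew_shape R \<alpha> q t J
    using assms by unfold_locales
  show ?thesis
    unfolding Let_def
    by (intro exI[of _ act] conjI ballI allI irreducible_M act_scalar act_X_tab_vec act_T_tab_vec)
qed

end
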